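(* Let $\Sigma\ni 0$ be a finite alphabet and suppose $H \leq \mathrm{Aut}_0(\Sigma^{\mathbb{Z}})$ is weakly pointy with special point $x_0$. Then $A \wr_{x_0} H \in \mathcal{G}$ for all finitely generated abelian groups $A$.
   Context: For a finite set (alphabet) $\Sigma$, the full shift $\Sigma^{\mathbb{Z}}$ carries the product topology and the shift homeomorphism $\sigma(x)_i = x_{i+1}$. $\mathrm{Aut}(\Sigma^{\mathbb{Z}})$ is the group of homeomorphisms of $\Sigma^{\mathbb{Z}}$ commuting with $\sigma$. $\mathcal{G}$ is the class of groups that embed (as abstract groups) in $\mathrm{Aut}(\Sigma^{\mathbb{Z}})$, where $\Sigma$ is a finite alphabet with at least two elements; it is known that this class does not depend on the choice of such $\Sigma$. For an alphabet $\Sigma\ni 0$, $\mathrm{Aut}_0(\Sigma^{\mathbb{Z}})$ is the stabilizer of the point $0^{\mathbb{Z}}$ in $\mathrm{Aut}(\Sigma^{\mathbb{Z}})$. With $\mathbb{Z}_n=\mathbb{Z}/n\mathbb{Z}$, elements of $\Sigma^{\mathbb{Z}_n}$ are written as words of length $n$ and identified with the points $x\in\Sigma^{\mathbb{Z}}$ satisfying $\sigma^n(x)=x$; via this identification any $H\le\mathrm{Aut}_0(\Sigma^{\mathbb{Z}})$ acts naturally on $\Sigma^{\mathbb{Z}_n}$. $H\le\mathrm{Aut}_0(\Sigma^{\mathbb{Z}})$ is weakly pointy with special point $x_0 = \ldots 000u000\ldots\in\Sigma^{\mathbb{Z}}$ ($u$ a finite word over $\Sigma$) if for all large enough $n$,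 the stabilizer of $x_0$ in $H$ is contained in the stabilizer of $u0^{n-|u|}\in\Sigma^{\mathbb{Z}_n}$ for the natural action of $H$ on $\Sigma^{\mathbb{Z}_n}$. $A\wr_{x_0}H$ denotes the (restricted) permutational wreath product $A\wr_\Omega H$ with $\Omega=Hx_0$ the $H$-orbit of $x_0$: the semidirect product $A^{(\Omega)}\rtimes H$, where $A^{(\Omega)}$ is the group of finitely supported functions $y:\Omega\to A$ and $h\in H$ acts by $(hy)_{\omega}=y_{h^{-1}\omega}$. *)

theory Defs
  imports "HOL-Analysis.Analysis" "HOL-Algebra.Algebra"
begin

section \<open>Full shifts and their automorphism groups\<close>

definition full_shift :: "'a set \<Rightarrow> (int \<Rightarrow> 'a) topology" where
  "full_shift \<Sigma> = product_topology (\<lambda>_. discrete_topology \<Sigma>) UNIV"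

abbreviation configs :: "'a set \<Rightarrow> (int \<Rightarrow> 'a) set" where
  "configs \<Sigma> \<equiv> topspace (full_shift \<Sigma>)"

definition shift :: "(int \<Rightarrow> 'a) \<Rightarrow> int \<Rightarrow> 'a" where
  "shift x = (\<lambda>i. x (i + 1))"

text \<open>
  Automorphisms are total functions on \<^typ>\<open>int \<Rightarrow> 'a\<close> that are extensional outside
  \<^term>\<open>configs \<Sigma>\<close>, so that equality of automorphisms is equality on \<^term>\<open>configs \<Sigma>\<close>.
  The product of \<^term>\<open>g\<close> and \<^term>\<open>f\<close> in \<^const>\<open>BijGroup\<close> is the composition applying
  \<^term>\<open>f\<close> first, hence automorphisms act from the left.
\<close>

definition shift_Aut :: "'a set \<Rightarrow> ((int \<Rightarrow> 'a) \<Rightarrow> int \<Rightarrow> 'a) monoid" where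
  "shift_Aut \<Sigma> = BijGroup (configs \<Sigma>)
     \<lparr>carrier := {f \<in> Bij (configs \<Sigma>).
        homeomorphic_map (full_shift \<Sigma>) (full_shift \<Sigma>) f \<and>
        (\<forall>x \<in> configs \<Sigma>. f (shift x) = shift (f x))}\<rparr>"

definition shift_Aut0 :: "'a set \<Rightarrow> 'a \<Rightarrow> ((int \<Rightarrow> 'a) \<Rightarrow> int \<Rightarrow> 'a) monoid" where
  "shift_Aut0 \<Sigma> a0 = shift_Aut \<Sigma> \<lparr>carrier := stabilizer (shift_Aut \<Sigma>) (\<lambda>f. f) (\<lambda>_. a0)\<rparr>"

text \<open>
  The class of groups embedding in the automorphism group of a full shift on a finite alphabet
  with at least two letters. Renaming letters does not change the automorphism group up to
  isomorphism, so alphabets of natural numbers suffice.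
\<close>

definition embeds_in_shift_Aut :: "('g, 'm) monoid_scheme \<Rightarrow> bool" where
  "embeds_in_shift_Aut G \<longleftrightarrow> group G \<and>
     (\<exists>\<Gamma> :: nat set. finite \<Gamma> \<and> card \<Gamma> \<ge> 2 \<and> mon G (shift_Aut \<Gamma>) \<noteq> {})"


section \<open>Weakly pointy groups\<close>

text \<open>
  A word \<^term>\<open>w\<close> of length \<^term>\<open>n > 0\<close> is identified with the point \<^term>\<open>periodic_point w\<close>,
  which is fixed by the \<^term>\<open>n\<close>-th power of the shift; the inverse identification reads off the
  coordinates \<open>0, \<dots>, n - 1\<close>.
\<close>

definition periodic_point :: "'a list \<Rightarrow> int \<Rightarrow> 'a" where
  "periodic_point w = (\<lambda>i. w ! nat (i mod int (length w)))"

definition word_act :: "((int \<Rightarrow> 'a) \<Rightarrow> int \<Rightarrow> 'a) \<Rightarrow> 'a list \<Rightarrow> 'a list" where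
  "word_act h w = map (\<lambda>i. h (periodic_point w) (int i)) [0..<length w]"

definition finite_point :: "'a \<Rightarrow> 'a list \<Rightarrow> int \<Rightarrow> int \<Rightarrow> 'a" where
  "finite_point a0 u k =
     (\<lambda>i. if k \<le> i \<and> i < k + int (length u) then u ! nat (i - k) else a0)"

text \<open>
  The position \<^term>\<open>k\<close> of the word \<^term>\<open>u\<close> in the special point is left arbitrary.
\<close>

definition weakly_pointy ::
  "'a set \<Rightarrow> 'a \<Rightarrow> ((int \<Rightarrow> 'a) \<Rightarrow> int \<Rightarrow> 'a) set \<Rightarrow> (int \<Rightarrow> 'a) \<Rightarrow> bool" where
  "weakly_pointy \<Sigma> a0 H x0 \<longleftrightarrow>
     subgroup H (shift_Aut0 \<Sigma> a0) \<and>
     (\<exists>u k. set u \<subseteq> \<Sigma> \<and> x0 = finite_point a0 u k \<and>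
        (\<forall>\<^sub>F n in sequentially.
           stabilizer (shift_Aut \<Sigma>\<lparr>carrier := H\<rparr>) (\<lambda>h. h) x0 \<subseteq>
           stabilizer (shift_Aut \<Sigma>\<lparr>carrier := H\<rparr>) word_act
             (u @ replicate (n - length u) a0)))"


section \<open>Permutational wreath products\<close>

definition semidirect_product ::
  "('n, 'p) monoid_scheme \<Rightarrow> ('h, 'q) monoid_scheme \<Rightarrow> ('h \<Rightarrow> 'n \<Rightarrow> 'n) \<Rightarrow> ('n \<times> 'h) monoid" where
  "semidirect_product N H \<theta> =
     \<lparr>carrier = carrier N \<times> carrier H,
      monoid.mult = (\<lambda>(y, h) (y', h'). (y \<otimes>\<^bsub>N\<^esub> \<theta> h y', h \<otimes>\<^bsub>H\<^esub> h')),
      one = (\<one>\<^bsub>N\<^esub>, \<one>\<^bsub>H\<^esub>)\<rparr>"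

text \<open>
  The restricted wreath product for an action \<^term>\<open>\<phi>\<close> of \<^term>\<open>H\<close> on \<^term>\<open>\<Omega>\<close>;
  \<^const>\<open>sum_group\<close> is the group of finitely supported functions.
\<close>

definition wreath_product ::
  "('b, 'p) monoid_scheme \<Rightarrow> ('h, 'q) monoid_scheme \<Rightarrow> ('h \<Rightarrow> 'o \<Rightarrow> 'o) \<Rightarrow> 'o set
    \<Rightarrow> (('o \<Rightarrow> 'b) \<times> 'h) monoid" where
  "wreath_product A H \<phi> \<Omega> =
     semidirect_product (sum_group \<Omega> (\<lambda>_. A)) H (\<lambda>h y. \<lambda>\<omega>\<in>\<Omega>. y (\<phi> (inv\<^bsub>H\<^esub> h) \<omega>))"

definition orbit_wreath_product ::
  "('b, 'p) monoid_scheme \<Rightarrow> 'a set \<Rightarrow> ((int \<Rightarrow> 'a) \<Rightarrow> int \<Rightarrow> 'a) set \<Rightarrow> (int \<Rightarrow> 'a)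
    \<Rightarrow> (((int \<Rightarrow> 'a) \<Rightarrow> 'b) \<times> ((int \<Rightarrow> 'a) \<Rightarrow> int \<Rightarrow> 'a)) monoid" where
  "orbit_wreath_product A \<Sigma> H x0 =
     (let H' = shift_Aut \<Sigma>\<lparr>carrier := H\<rparr>
      in wreath_product A H' (\<lambda>h. h) (orbit H' (\<lambda>h. h) x0))"

definition finitely_generated :: "('b, 'p) monoid_scheme \<Rightarrow> bool" where
  "finitely_generated G \<longleftrightarrow> (\<exists>S \<subseteq> carrier G. finite S \<and> generate G S = carrier G)"

end

theory Submission
  imports Defs
begin

text \<open>
Why the wreath product embeds. Every lamp of \<open>A \<wr> H\<close> sits at a point \<open>\<omega>\<close> of the orbit
of the special point, and \<open>\<omega>\<close> agrees with the letter \<open>a0\<close> outside a finite window. The automorphisms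
in \<open>H\<close> can be made to act on many independent finite tapes, but a cellular automaton has a bounded
radius, so the difficulty is to recognise, within such a radius, that a tape contains \<open>\<omega>\<close> \<^emph>\<open>and
nothing else\<close>. A cylinder around \<open>\<omega>\<close> is not good enough, because the stabilizer of \<open>\<omega>\<close> need not preserve it.

\<^bold>\<open>Belts.\<close> A configuration over a larger alphabet has two tracks of labels. Walls cut it into belts; a walk
runs to the right on one track, turns at a wall, and runs back on the other one. On a belt with
\<open>m\<close> columns this is a cyclic tape of length \<open>2 * m\<close>, so \<open>h\<close> in \<open>H\<close> acts on it by its action on
periodic points (\<open>simulate\<close>).

\<^bold>\<open>Flags.\<close> A blank column carries a flag for each direction which claims that all columns up to the end of
the belt in that direction are blank. These claims can be kept up to date locally: an automorphism
that fixes the constant point \<open>a0\<close> and its inverse move the boundary of the blank part of a belt by at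
most a radius (\<open>near_flag_lift\<close>). Thus the tape can be seen to contain \<open>\<omega>\<close> and nothing else by looking
at a bounded window, because the flags beyond the support of \<open>\<omega>\<close> vouch for the rest. Arbitrary flags
have to be admitted, since the alphabet must give a full shift. A flag that disagrees with its
neighbour is declared to be a wall. Such walls persist, because operations that
preserve blankness in both directions never turn a blank belt into a nonblank one or conversely
(\<open>wall_recode\<close>).

\<^bold>\<open>Lamps.\<close> A belt may carry a mark, which is the origin for reading its tape. The lamp configuration \<open>y\<close>
acts on a belt that is blank apart from one mark and the tape \<open>\<omega>\<close> read from there: with \<open>a = y \<omega>\<close> it
rotates the whole belt by an integer depending additively on \<open>a\<close>, and it lets \<open>a\<close> act on the value
of the mark (\<open>switch\<close>). On a short belt several points \<open>\<omega>\<close> can have the same periodic version, and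
then the corresponding values \<open>y \<omega>\<close> are multiplied; this is where commutativity of \<open>A\<close> enters. Rotations by the integers
give actions of unbounded order although everything happens near the mark: the mark moves together
with the tape, and the length of the belt does not change. Since every finitely generated abelian group
embeds into a product of copies of the integers and a finite group, finitely many values of the mark
suffice to tell the elements of \<open>A\<close> apart (\<open>lamps_exist\<close>).

\<^bold>\<open>Weak pointiness.\<close> For the tape of a belt of period \<open>n\<close> to correspond to \<open>\<omega> = h x0\<close> it has to be the
\<open>h\<close>-image of the \<open>n\<close>-periodic version of \<open>x0\<close>, and this must depend on \<open>\<omega>\<close> only. That is precisely what
weak pointiness provides, for all large \<open>n\<close> at once (\<open>wrapped_eq\<close>). The operations \<open>simulate\<close> and \<open>switch\<close> then
satisfy the relations of the wreath product (\<open>switch_simulate\<close>), and belts without walls, on which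
the tapes are not periodic at all, show that the resulting homomorphism is injective.
\<close>

section \<open>Topology of full shifts\<close>

lemma configs_iff: "x \<in> configs S \<longleftrightarrow> (\<forall>i. x i \<in> S)"
  by (auto simp: full_shift_def topspace_product_topology PiE_iff)

lemma shift_configs: "x \<in> configs S \<Longrightarrow> shift x \<in> configs S"
  by (simp add: configs_iff shift_def)

text \<open>
Cylinders form a base of the product topology. Below, continuity is always obtained in this form:
each coordinate of the image is locally constant.
\<close>
lemma eventually_nhdsin_full_shift:
  assumes "x \<in> configs S"
  shows "eventually P (nhdsin (full_shift S) x) \<longleftrightarrow>
    (\<exists>I. finite I \<and> (\<forall>x' \<in> configs S. (\<forall>i\<in>I. x' i = x i) \<longrightarrow> P x'))" (is "?l \<longleftrightarrow> ?r")
proof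
  assume ?l
  then obtain U where U: "openin (full_shift S) U" "x \<in> U" "\<forall>x\<in>U. P x"
    using assms by (auto simp: eventually_nhdsin)
  then obtain V where V: "finite {i \<in> UNIV. V i \<noteq> topspace (discrete_topology S)}"
      "x \<in> Pi\<^sub>E UNIV V" "Pi\<^sub>E UNIV V \<subseteq> U" "\<forall>i. V i \<subseteq> S"
    unfolding full_shift_def openin_product_topology_alt by (fastforce simp: openin_discrete_topology)
  have "\<forall>x' \<in> configs S. (\<forall>i\<in>{i. V i \<noteq> S}. x' i = x i) \<longrightarrow> P x'"
  proof (intro ballI impI)
    fix x' assume x': "x' \<in> configs S" "\<forall>i\<in>{i. V i \<noteq> S}. x' i = x i"
    have "x' i \<in> V i" for i
      using x' V(2) by (cases "V i = S") (auto simp: configs_iff PiE_iff)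
    then have "x' \<in> Pi\<^sub>E UNIV V" by (auto simp: PiE_iff)
    then show "P x'" using V U by blast
  qed
  then show ?r using V(1) by (intro exI[of _ "{i. V i \<noteq> S}"]) auto
next
  assume ?r
  then obtain I where I: "finite I" "\<forall>x' \<in> configs S. (\<forall>i\<in>I. x' i = x i) \<longrightarrow> P x'" by blast
  let ?V = "\<lambda>i. if i \<in> I then {x i} else S"
  have "openin (full_shift S) (Pi\<^sub>E UNIV ?V)"
    unfolding full_shift_def
    by (rule openin_PiE_gen[THEN iffD2])
       (use I(1) assms in \<open>auto simp: configs_iff intro: finite_subset[of _ I]\<close>)
  moreover have "x \<in> Pi\<^sub>E UNIV ?V" using assms by (auto simp: configs_iff)
  moreover have "P x'" if "x' \<in> Pi\<^sub>E UNIV ?V" for x'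
  proof -
    have *: "x' i \<in> ?V i" for i using that by (auto simp: PiE_iff)
    have "x' i \<in> S" for i using assms *[of i] by (cases "i \<in> I") (auto simp: configs_iff)
    moreover have "x' i = x i" if "i \<in> I" for i using *[of i] that by simp
    ultimately show ?thesis using I(2) by (auto simp: configs_iff)
  qed
  ultimately show ?l by (auto simp: eventually_nhdsin)
qed

lemma eventually_coordinate: "eventually (\<lambda>x'. x' i = x i) (nhdsin (full_shift S) x)"
proof (cases "x \<in> configs S")
  case True
  then show ?thesis by (subst eventually_nhdsin_full_shift) (auto intro!: exI[of _ "{i}"])
qed (simp add: eventually_nhdsin)

lemma eventually_in_configs: "eventually (\<lambda>x'. x' \<in> configs S) (nhdsin (full_shift S) x)"
  unfolding eventually_nhdsin by (metis openin_topspace)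

lemma continuous_map_full_shift_iff:
  "continuous_map (full_shift S) (full_shift T) f \<longleftrightarrow>
    f \<in> configs S \<rightarrow> configs T \<and>
    (\<forall>x \<in> configs S. \<forall>j. eventually (\<lambda>x'. f x' j = f x j) (nhdsin (full_shift S) x))" (is "?l \<longleftrightarrow> ?r")
proof
  assume c: ?l
  have "eventually (\<lambda>x'. f x' j = f x j) (nhdsin (full_shift S) x)" if x: "x \<in> configs S" for x j
  proof -
    have fx: "f x \<in> configs T" using c x unfolding continuous_map_def by blast
    then obtain U where U: "openin (full_shift T) U" "f x \<in> U" "\<forall>y\<in>U. y j = f x j"
      using eventually_coordinate[of j "f x" T] unfolding eventually_nhdsin by blast
    have "openin (full_shift S) {x' \<in> configs S. f x' \<in> U}"
      using c U(1) unfolding continuous_map_def by blast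
    moreover have "x \<in> {x' \<in> configs S. f x' \<in> U}" "\<forall>x' \<in> {x' \<in> configs S. f x' \<in> U}. f x' j = f x j"
      using U(2,3) x by blast+
    ultimately show ?thesis unfolding eventually_nhdsin by blast
  qed
  moreover have "f \<in> configs S \<rightarrow> configs T" using c unfolding continuous_map_def by blast
  ultimately show ?r by blast
next
  assume r: ?r
  have "continuous_map (full_shift S) (discrete_topology T) (\<lambda>x. f x j)" for j
    unfolding continuous_map_def
  proof (intro conjI allI impI)
    show "(\<lambda>x. f x j) \<in> configs S \<rightarrow> topspace (discrete_topology T)"
      using r by (auto simp: configs_iff Pi_iff)
    fix U assume "openin (discrete_topology T) U"
    show "openin (full_shift S) {x \<in> configs S. f x j \<in> U}"
    proof (subst openin_subopen, intro ballI)
      fix x assume x: "x \<in> {x \<in> configs S. f x j \<in> U}"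
      then obtain V where V: "openin (full_shift S) V" "x \<in> V" and eq: "\<forall>x'\<in>V. f x' j = f x j"
        using r unfolding eventually_nhdsin by blast
      have "y \<in> {x \<in> configs S. f x j \<in> U}" if "y \<in> V" for y
      proof -
        have "f y j \<in> U" using bspec[OF eq that] x by simp
        then show ?thesis using openin_subset[OF V(1)] that by blast
      qed
      then show "\<exists>V. openin (full_shift S) V \<and> x \<in> V \<and> V \<subseteq> {x \<in> configs S. f x j \<in> U}"
        using V by blast
    qed
  qed
  then show ?l unfolding full_shift_def[of T] continuous_map_componentwise_UNIV by simp
qed

section \<open>Conveyor belts\<close>

definition dir :: "bool \<Rightarrow> int" where
  "dir e = (if e then 1 else -1)"

definition flip :: "int \<times> bool \<Rightarrow> int \<times> bool" where
  "flip p = (fst p, \<not> snd p)"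

text \<open>
A position is a column with a track; on the track \<open>e\<close> one moves in the direction \<open>dir e\<close>. The
predicate \<open>W\<close> marks the walls. A step that would enter or leave a wall changes the track instead.
\<close>
definition step :: "(int \<Rightarrow> bool) \<Rightarrow> int \<times> bool \<Rightarrow> int \<times> bool" where
  "step W p = (if W (fst p) \<or> W (fst p + dir (snd p)) then flip p else (fst p + dir (snd p), snd p))"

text \<open>
Negative walks are walks on the other track: \<open>flip\<close> conjugates \<open>step\<close> to its inverse, which is
\<open>step_flip_step\<close>.
\<close>
definition walk :: "(int \<Rightarrow> bool) \<Rightarrow> int \<Rightarrow> int \<times> bool \<Rightarrow> int \<times> bool" where
  "walk W i p = (if 0 \<le> i then (step W ^^ nat i) p else flip ((step W ^^ nat (- i)) (flip p)))"

lemma dir_not [simp]: "dir (\<not> e) = - dir e" by (simp add: dir_def)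
lemma abs_dir [simp]: "\<bar>dir e\<bar> = 1" by (simp add: dir_def)
lemma dir_sq [simp]: "dir e * dir e = 1" by (simp add: dir_def)

lemma flip_flip [simp]: "flip (flip p) = p" by (simp add: flip_def)
lemma fst_flip [simp]: "fst (flip p) = fst p" by (simp add: flip_def)
lemma flip_neq [simp]: "flip p \<noteq> p" by (cases p) (simp add: flip_def)
lemma step_flip_step: "step W (flip (step W p)) = flip p"
  by (auto simp: step_def flip_def)

lemma walk_0 [simp]: "walk W 0 p = p" by (simp add: walk_def)
lemma walk_1 [simp]: "walk W 1 p = step W p" by (simp add: walk_def)

lemma walk_step: "walk W (i + 1) p = step W (walk W i p)"
proof (cases "0 \<le> i")
  case True
  then show ?thesis by (simp add: walk_def nat_add_distrib)
next
  case False
  define n where "n = nat (- i) - 1"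
  have "nat (- i) = Suc n" "nat (- (i + 1)) = n" "i + 1 = - int n" using False by (auto simp: n_def)
  moreover have "step W (flip ((step W ^^ Suc n) (flip p))) = flip ((step W ^^ n) (flip p))"
    by (simp add: step_flip_step)
  moreover have "walk W (- int n) p = flip ((step W ^^ n) (flip p))" by (simp add: walk_def)
  ultimately show ?thesis using False by (simp add: walk_def)
qed

lemma walk_add: "walk W (i + j) p = walk W i (walk W j p)"
proof (induction i rule: int_induct[of _ 0])
  case base then show ?case by simp
next
  case (step1 i)
  have "walk W (i + 1 + j) p = step W (walk W (i + j) p)" using walk_step[of W "i + j"] by (simp add: add_ac)
  then show ?case using step1 by (simp add: walk_step)
next
  case (step2 i)
  have "step W (walk W (i - 1 + j) p) = walk W (i + j) p" using walk_step[of W "i - 1 + j"] by (simp add: add_ac)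
  moreover have "step W (walk W (i - 1) (walk W j p)) = walk W i (walk W j p)" using walk_step[of W "i - 1"] by simp
  moreover have "inj (step W)" by (metis flip_flip injI step_flip_step)
  ultimately show ?case using step2 by (metis injD)
qed

lemma walk_uminus [simp]: "walk W (- i) (walk W i p) = p" "walk W i (walk W (- i) p) = p"
  using walk_add[of W "- i" i p] walk_add[of W i "- i" p] by simp_all

lemma walk_eq_iff: "walk W i p = q \<longleftrightarrow> p = walk W (- i) q"
  by auto

lemma walk_flip: "walk W i (flip p) = flip (walk W (- i) p)"
  by (cases "i = 0") (auto simp: walk_def)

lemma fst_walk: "fst (walk W i p) = fst ((step W ^^ nat \<bar>i\<bar>) (if 0 \<le> i then p else flip p))"
  by (auto simp: walk_def)

lemma fst_step_dist: "\<bar>fst (step W p) - fst p\<bar> \<le> 1"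
  by (simp add: step_def)

lemma fst_walk_dist: "\<bar>fst (walk W i p) - fst p\<bar> \<le> \<bar>i\<bar>"
proof -
  have "\<bar>fst ((step W ^^ n) q) - fst q\<bar> \<le> int n" for n q
  proof (induction n)
    case (Suc n) then show ?case using fst_step_dist[of W "(step W ^^ n) q"] by simp
  qed simp
  from this[of "nat \<bar>i\<bar>" "if 0 \<le> i then p else flip p"] show ?thesis by (simp add: fst_walk split: if_splits)
qed

lemma fst_walk_induct [consumes 1, case_names step]:
  assumes "P (fst p)" "\<And>q. P (fst q) \<Longrightarrow> P (fst (step W q))"
  shows "P (fst (walk W i p))"
proof -
  have "P (fst ((step W ^^ n) q))" if "P (fst q)" for n q
    by (induction n) (use that assms in auto)
  then show ?thesis using assms(1) by (simp add: fst_walk)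
qed

lemma walk_from_wall: "W (fst p) \<Longrightarrow> fst (walk W i p) = fst p"
  by (rule fst_walk_induct[where P = "\<lambda>j. j = fst p"]) (auto simp: step_def)

definition right :: "int \<times> bool \<Rightarrow> int \<times> bool" where
  "right p = (fst p + 1, snd p)"

lemma step_right: "step W (right p) = right (step (\<lambda>j. W (j + 1)) p)"
  by (simp add: step_def right_def flip_def add_ac)

lemma flip_right: "flip (right p) = right (flip p)"
  by (simp add: flip_def right_def)

lemma walk_right: "walk W i (right p) = right (walk (\<lambda>j. W (j + 1)) i p)"
proof -
  have "(step W ^^ n) (right q) = right ((step (\<lambda>j. W (j + 1)) ^^ n) q)" for n q
    by (induction n) (simp_all add: step_right)
  then show ?thesis by (simp add: walk_def flip_right)
qed

lemma right_inject [simp]: "right p = right q \<longleftrightarrow> p = q"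
  by (auto simp: right_def prod_eq_iff)

lemma right_surj: obtains q where "p = right q"
  using that[of "(fst p - 1, snd p)"] by (simp add: right_def)

definition clear :: "(int \<Rightarrow> bool) \<Rightarrow> bool \<Rightarrow> int \<Rightarrow> nat \<Rightarrow> bool" where
  "clear W e j n \<longleftrightarrow> (\<forall>k\<le>n. \<not> W (j + dir e * int k))"

lemma clear_mono: "clear W e j n \<Longrightarrow> m \<le> n \<Longrightarrow> clear W e j m"
  by (auto simp: clear_def)

lemma step_in_ray:
  assumes c: "clear W e j m" and q: "fst q = j + dir e * int m" and m: "0 < m \<or> W (j - dir e)"
  obtains m' where "clear W e j m'" "fst (step W q) = j + dir e * int m'" "m \<le> Suc m'"
proof (cases "fst (step W q) = fst q")
  case True then show ?thesis using c q that[of m] by auto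
next
  case False
  then have W: "\<not> W (fst q + dir (snd q))" "fst (step W q) = fst q + dir (snd q)" by (auto simp: step_def split: if_splits)
  show ?thesis
  proof (cases "snd q = e")
    case True
    then have "clear W e j (Suc m)" using c q W(1) by (auto simp: clear_def algebra_simps le_Suc_eq)
    then show ?thesis using that[of "Suc m"] W(2) q True by (simp add: algebra_simps)
  next
    case F: False
    then have d: "dir (snd q) = - dir e" by (auto simp: dir_def)
    have "0 < m" using W(1) m q d by (cases m) auto
    then obtain k where k: "m = Suc k" by (cases m) auto
    show ?thesis using that[of k] c clear_mono[OF c, of k] W(2) d q k by (simp add: algebra_simps)
  qed
qed

text \<open>
A walk that starts \<open>m\<close> columns inside a ray without walls stays in the ray for \<open>m\<close> steps, and forever if there
is a wall just before the ray, since it would have to leave through the first column.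
\<close>
lemma walk_in_ray:
  assumes "clear W e j m" and "fst p = j + dir e * int m" and "\<bar>i\<bar> \<le> int m \<or> W (j - dir e)"
  obtains m' where "clear W e j m'" "fst (walk W i p) = j + dir e * int m'" "int m - \<bar>i\<bar> \<le> int m'"
proof -
  have "\<exists>m'. clear W e j m' \<and> fst ((step W ^^ n) q) = j + dir e * int m' \<and> m \<le> n + m'"
    if "fst q = j + dir e * int m" "n \<le> m \<or> W (j - dir e)" for n q
    using that(2)
  proof (induction n)
    case 0 then show ?case using assms that by auto
  next
    case (Suc n)
    then obtain m' where m': "clear W e j m'" "fst ((step W ^^ n) q) = j + dir e * int m'" "m \<le> n + m'" by auto
    then have "0 < m' \<or> W (j - dir e)" using Suc.prems by auto
    from step_in_ray[OF m'(1,2) this] obtain m'' where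
      "clear W e j m''" "fst (step W ((step W ^^ n) q)) = j + dir e * int m''" "m' \<le> Suc m''" by blast
    then show ?case using m' by (intro exI[of _ m'']) auto
  qed
  moreover have "fst (if 0 \<le> i then p else flip p) = j + dir e * int m" "nat \<bar>i\<bar> \<le> m \<or> W (j - dir e)"
    using assms by auto
  ultimately obtain m' where
    "clear W e j m'" "fst (walk W i p) = j + dir e * int m'" "m \<le> nat \<bar>i\<bar> + m'"
    unfolding fst_walk by blast
  then show ?thesis using that[of m'] by linarith
qed

text \<open>
The positions of the belt of \<open>p\<close>. Both orbits are needed because the two tracks are connected only if
there is a wall on at least one side.
\<close>
definition assoc :: "(int \<Rightarrow> bool) \<Rightarrow> int \<times> bool \<Rightarrow> int \<times> bool \<Rightarrow> bool" where
  "assoc W p q \<longleftrightarrow> (\<exists>i. q = walk W i p \<or> q = flip (walk W i p))"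

text \<open>
The length of the cyclic tape through \<open>p\<close>, and \<open>0\<close> if the tape is infinite.
\<close>
definition period :: "(int \<Rightarrow> bool) \<Rightarrow> int \<times> bool \<Rightarrow> nat" where
  "period W p = (if \<exists>n>0. walk W (int n) p = p then LEAST n. 0 < n \<and> walk W (int n) p = p else 0)"

lemma assoc_refl [simp]: "assoc W p p"
  unfolding assoc_def by (intro exI[of _ 0]) simp

lemma assoc_walk [simp]: "assoc W p (walk W i p)"
  unfolding assoc_def by blast

lemma assoc_flip [simp]: "assoc W p (flip p)"
  unfolding assoc_def by (intro exI[of _ 0]) simp

lemma assoc_sym: "assoc W p q \<Longrightarrow> assoc W q p"
  unfolding assoc_def by (metis walk_uminus flip_flip walk_flip)

lemma assoc_trans:
  assumes "assoc W p q" "assoc W q s"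
  shows "assoc W p s"
proof -
  have "walk W i (walk W j p) = walk W (i + j) p" "walk W i (flip (walk W j p)) = flip (walk W (j - i) p)" for i j
    using walk_add[of W i j p] walk_add[of W "- i" j p] by (auto simp: walk_flip)
  then show ?thesis using assms unfolding assoc_def by (metis flip_flip)
qed

lemma assoc_cong: "assoc W p q \<Longrightarrow> assoc W p s \<longleftrightarrow> assoc W q s"
  using assoc_sym assoc_trans by blast

lemma walk_multiple: "walk W d p = p \<Longrightarrow> walk W (t * d) p = p"
proof (induction t rule: int_induct[of _ 0])
  case (step1 t)
  then show ?case using walk_add[of W "t * d" d p] by (simp add: algebra_simps)
next
  case (step2 t)
  then have "walk W (- d) p = p" by (metis walk_uminus(1))
  then show ?case using walk_add[of W "t * d" "- d" p] step2 by (simp add: algebra_simps)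
qed simp

lemma walk_period [simp]: "walk W (int (period W p)) p = p"
proof (cases "\<exists>n>0. walk W (int n) p = p")
  case True
  then have "walk W (int (LEAST n. 0 < n \<and> walk W (int n) p = p)) p = p"
    using LeastI_ex[of "\<lambda>n. 0 < n \<and> walk W (int n) p = p"] by blast
  then show ?thesis using True by (simp add: period_def)
next
  case False
  then have "period W p = 0" unfolding period_def by (simp only: if_False)
  then show ?thesis by simp
qed

lemma walk_add_period: "walk W (i + t * int (period W p)) p = walk W i p"
  by (simp add: walk_add walk_multiple)

lemma walk_fixes_iff: "walk W d p = p \<longleftrightarrow> int (period W p) dvd d"
proof
  assume d: "walk W d p = p"
  show "int (period W p) dvd d"
  proof (cases "d = 0")
    case False
    have "walk W (int (nat \<bar>d\<bar>)) p = p" using d walk_multiple[OF d, of "sgn d"] by (simp add: abs_sgn mult.commute)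
    then have ex: "\<exists>n>0. walk W (int n) p = p" using False by (intro exI[of _ "nat \<bar>d\<bar>"]) auto
    define n where "n = period W p"
    have n: "n = (LEAST n. 0 < n \<and> walk W (int n) p = p)" using ex by (simp add: n_def period_def)
    have n0: "0 < n" using LeastI_ex[OF ex] n by simp
    have "d = d mod int n + (d div int n) * int n" by simp
    then have "walk W (d mod int n) p = p" using d walk_add_period[of W "d mod int n" "d div int n" p] by (simp add: n_def)
    moreover have "d mod int n = int (nat (d mod int n))" "nat (d mod int n) < n" using n0 by (auto simp: nat_less_iff)
    ultimately have "\<not> 0 < nat (d mod int n)"
      using not_less_Least[of "nat (d mod int n)" "\<lambda>n. 0 < n \<and> walk W (int n) p = p"] n by auto
    then show ?thesis using n0 by (simp add: n_def[symmetric] dvd_eq_mod_eq_0) (smt (verit) n0 of_nat_0_less_iff pos_mod_sign)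
  qed simp
next
  assume "int (period W p) dvd d"
  then obtain t where "d = t * int (period W p)" by (metis dvdE mult.commute)
  then show "walk W d p = p" using walk_multiple[OF walk_period] by simp
qed

lemma period_walk [simp]: "period W (walk W i p) = period W p"
proof -
  have "walk W d (walk W i p) = walk W i p \<longleftrightarrow> walk W d p = p" for d
    using walk_add[of W d i p] walk_add[of W i d p] by (metis add.commute walk_uminus(1))
  then show ?thesis unfolding period_def by (simp only:)
qed

lemma assoc_right: "assoc W (right p) (right q) \<longleftrightarrow> assoc (\<lambda>j. W (j + 1)) p q"
  by (simp add: assoc_def walk_right flip_right)

lemma period_right: "period W (right p) = period (\<lambda>j. W (j + 1)) p"
  by (simp only: period_def walk_right right_inject)

section \<open>Flags and walls\<close>

type_synonym 'l configuration = "int \<Rightarrow> (bool \<Rightarrow> 'l) \<times> (bool \<Rightarrow> bool)"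

definition label :: "'l configuration \<Rightarrow> int \<times> bool \<Rightarrow> 'l" where
  "label x p = fst (x (fst p)) (snd p)"

definition flag :: "'l configuration \<Rightarrow> bool \<Rightarrow> int \<Rightarrow> bool" where
  "flag x e j = snd (x j) e"

text \<open>
The letter \<open>b\<close> is the blank label and \<open>L\<close> is the set of all labels.
\<close>
locale belts =
  fixes b :: 'l and L :: "'l set"
  assumes blank_letter: "b \<in> L" and finite_letters: "finite L"
begin

text \<open>
A cell consists of two labels and two flags. The flags of a nonblank column are fixed to be
false. Otherwise, when such a column becomes blank, the information in its flags would have nowhere to go, and
recoding would not be injective.
\<close>
definition cells :: "((bool \<Rightarrow> 'l) \<times> (bool \<Rightarrow> bool)) set" where
  "cells = {c. range (fst c) \<subseteq> L \<and> ((\<exists>e. fst c e \<noteq> b) \<longrightarrow> (\<forall>e. \<not> snd c e))}"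

definition blank_at :: "(int \<times> bool \<Rightarrow> 'l) \<Rightarrow> int \<Rightarrow> bool" where
  "blank_at l j \<longleftrightarrow> (\<forall>e. l (j, e) = b)"

text \<open>
In a consistent belt, the flag of a blank column equals the flag of the next column in the same
direction. Inconsistencies cannot be excluded in a full shift and serve as the ends of the belts.
\<close>
definition wall :: "'l configuration \<Rightarrow> int \<Rightarrow> bool" where
  "wall x j \<longleftrightarrow> blank_at (label x) j \<and> (\<exists>e. flag x e j \<noteq> flag x e (j + dir e))"

text \<open>
The flag at the end of the belt of \<open>j\<close> in direction \<open>e\<close>. For a belt without end in this direction, this is the
eventual value of the flags.
\<close>
definition capped :: "'l configuration \<Rightarrow> bool \<Rightarrow> int \<Rightarrow> bool" where
  "capped x e j \<longleftrightarrow> (\<exists>n. (\<forall>k<n. \<not> wall x (j + dir e * int k)) \<and> flag x e (j + dir e * int n))"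

text \<open>
The statement which the flag \<open>e\<close> in column \<open>j\<close> stands for.
\<close>
definition tail_blank :: "(int \<Rightarrow> bool) \<Rightarrow> (int \<times> bool \<Rightarrow> 'l) \<Rightarrow> bool \<Rightarrow> int \<Rightarrow> bool" where
  "tail_blank W l e j \<longleftrightarrow> (\<forall>n. clear W e j n \<longrightarrow> blank_at l (j + dir e * int n))"

text \<open>
The flags at walls are left alone, since their disagreement with the neighbouring flags is what makes the walls.
\<close>
definition recode ::
  "'l configuration \<Rightarrow> (int \<times> bool \<Rightarrow> 'l) \<Rightarrow> 'l configuration" where
  "recode x l = (\<lambda>j. (\<lambda>e. l (j, e),
     \<lambda>e. if wall x j then flag x e j else capped x e j \<and> tail_blank (wall x) l e j))"

text \<open>
Distances are measured along walks, since nothing can be transported through a wall.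
\<close>
definition controls :: "nat \<Rightarrow> (int \<Rightarrow> bool) \<Rightarrow> (int \<times> bool \<Rightarrow> 'l) \<Rightarrow> (int \<times> bool \<Rightarrow> 'l) \<Rightarrow> bool" where
  "controls r W l l' \<longleftrightarrow>
     (\<forall>p. (\<forall>i. \<bar>i\<bar> \<le> int r \<longrightarrow> blank_at l (fst (walk W i p))) \<longrightarrow> l' p = b)"

lemma finite_cells: "finite cells"
proof -
  have "cells \<subseteq> (UNIV \<rightarrow>\<^sub>E L) \<times> UNIV"
    by (auto simp: cells_def)
  moreover have "finite (((UNIV :: bool set) \<rightarrow>\<^sub>E L) \<times> (UNIV :: (bool \<Rightarrow> bool) set))"
    by (intro finite_cartesian_product finite_PiE finite_class.finite_UNIV finite_letters)
  ultimately show ?thesis by (rule finite_subset)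
qed

lemma label_in:
  assumes "x \<in> configs cells"
  shows "label x p \<in> L"
  using assms unfolding configs_iff cells_def label_def by blast

lemma blank_at_iff: "blank_at l j \<longleftrightarrow> l (j, True) = b \<and> l (j, False) = b"
  by (auto simp: blank_at_def all_bool_eq)

lemma flag_imp_blank:
  assumes "x \<in> configs cells" "flag x e j"
  shows "blank_at (label x) j"
  using assms unfolding configs_iff cells_def label_def flag_def blank_at_def fst_conv snd_conv by blast

lemma flag_step: "\<not> wall x j \<Longrightarrow> blank_at (label x) j \<Longrightarrow> flag x e (j + dir e) = flag x e j"
  by (auto simp: wall_def)

lemma clear_0 [simp]: "clear W e j 0 \<longleftrightarrow> \<not> W j"
  by (simp add: clear_def)

lemma clear_shift: "clear W e j n \<Longrightarrow> clear W e (j + dir e * int n) m \<longleftrightarrow> clear W e j (n + m)"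
proof
  assume c: "clear W e j n" and c': "clear W e (j + dir e * int n) m"
  show "clear W e j (n + m)" unfolding clear_def
  proof (intro allI impI)
    fix k assume k: "k \<le> n + m"
    show "\<not> W (j + dir e * int k)"
    proof (cases "k \<le> n")
      case False
      then have "\<not> W (j + dir e * int n + dir e * int (k - n))" using c' k
        by (simp add: clear_def del: of_nat_diff)
      then show ?thesis using False by (simp add: algebra_simps)
    qed (use c in \<open>auto simp: clear_def\<close>)
  qed
next
  assume c: "clear W e j (n + m)"
  show "clear W e (j + dir e * int n) m" unfolding clear_def
  proof (intro allI impI)
    fix k assume "k \<le> m"
    then have "\<not> W (j + dir e * int (n + k))" using c[unfolded clear_def, rule_format, of "n + k"] by linarith
    then show "\<not> W (j + dir e * int n + dir e * int k)" by (simp add: algebra_simps)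
  qed
qed

lemma tail_blank_wall: "W j \<Longrightarrow> tail_blank W l e j"
  by (auto simp: tail_blank_def clear_def)

lemma tail_blank_step:
  assumes "\<not> W j"
  shows "tail_blank W l e j \<longleftrightarrow> blank_at l j \<and> tail_blank W l e (j + dir e)"
proof -
  have "(\<forall>k\<le>Suc n. P k) \<longleftrightarrow> P 0 \<and> (\<forall>k\<le>n. P (Suc k))" for P n
    by (metis Suc_le_mono le0 not0_implies_Suc)
  then have *: "clear W e (j + dir e) n \<longleftrightarrow> clear W e j (Suc n)" for n
    using assms by (simp add: clear_def algebra_simps)
  show ?thesis
  proof
    assume "tail_blank W l e j"
    then have t: "blank_at l (j + dir e * int n)" if "clear W e j n" for n
      using that by (auto simp: tail_blank_def)
    have "blank_at l (j + dir e + dir e * int n)" if "clear W e (j + dir e) n" for n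
      using t[of "Suc n"] that * by (simp add: algebra_simps)
    then show "blank_at l j \<and> tail_blank W l e (j + dir e)"
      using t[of 0] assms by (auto simp: tail_blank_def)
  next
    assume t: "blank_at l j \<and> tail_blank W l e (j + dir e)"
    show "tail_blank W l e j" unfolding tail_blank_def
    proof (intro allI impI)
      fix n assume "clear W e j n"
      then show "blank_at l (j + dir e * int n)"
        using t * by (cases n) (auto simp: tail_blank_def algebra_simps)
    qed
  qed
qed

lemma capped_wall: "wall x j \<Longrightarrow> capped x e j = flag x e j"
  by (auto simp: capped_def intro: exI[of _ 0])
     (metis add.right_neutral gr0I mult_zero_right of_nat_0)

lemma capped_extend:
  assumes "\<forall>k<n. \<not> wall x (j + dir e * int k)" "capped x e (j + dir e * int n)"
  shows "capped x e j"
proof -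
  obtain m where m: "\<forall>k<m. \<not> wall x (j + dir e * int n + dir e * int k)" "flag x e (j + dir e * int n + dir e * int m)"
    using assms(2) by (auto simp: capped_def)
  have "\<not> wall x (j + dir e * int k)" if "k < n + m" for k
  proof (cases "k < n")
    case False
    then have "\<not> wall x (j + dir e * int n + dir e * int (k - n))"
      using m(1) that by (simp del: of_nat_diff)
    then show ?thesis using False by (simp add: algebra_simps)
  qed (use assms in auto)
  then show ?thesis using m(2) unfolding capped_def by (intro exI[of _ "n + m"]) (simp add: algebra_simps)
qed

lemma flag_imp_capped: "flag x e j \<Longrightarrow> capped x e j"
  unfolding capped_def by (intro exI[of _ 0]) simp

lemma capped_step:
  assumes "x \<in> configs cells" "\<not> wall x j"
  shows "capped x e j \<longleftrightarrow> capped x e (j + dir e)"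
proof
  assume "capped x e j"
  then obtain n where n: "\<forall>k<n. \<not> wall x (j + dir e * int k)" "flag x e (j + dir e * int n)"
    by (auto simp: capped_def)
  show "capped x e (j + dir e)"
  proof (cases n)
    case 0
    then have "flag x e (j + dir e)" using n assms flag_imp_blank flag_step by auto
    then show ?thesis by (rule flag_imp_capped)
  next
    case (Suc m)
    have "\<not> wall x (j + dir e + dir e * int k)" if "k < m" for k
      using n(1)[rule_format, of "Suc k"] that Suc by (simp add: algebra_simps)
    then show ?thesis using n(2) Suc unfolding capped_def by (intro exI[of _ m]) (simp add: algebra_simps)
  qed
next
  assume "capped x e (j + dir e)"
  then show "capped x e j" using capped_extend[of 1 x j e] assms by auto
qed

lemma flag_along:
  assumes "x \<in> configs cells" "flag x e j" "\<forall>k<n. \<not> wall x (j + dir e * int k)"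
  shows "flag x e (j + dir e * int n)"
  using assms(3)
proof (induction n)
  case 0 then show ?case using assms by simp
next
  case (Suc n)
  then have "flag x e (j + dir e * int n)" "\<not> wall x (j + dir e * int n)" by auto
  then show ?case using flag_step[of x "j + dir e * int n" e] flag_imp_blank[OF assms(1)]
    by (simp add: algebra_simps)
qed

text \<open>
Away from the walls the flags carry no information beyond the labels and the ends of the belt: they
propagate outwards along a blank ray, and inwards from the end of the belt.
\<close>
lemma flag_iff_capped_tail:
  assumes x: "x \<in> configs cells" and j: "\<not> wall x j"
  shows "flag x e j \<longleftrightarrow> capped x e j \<and> tail_blank (wall x) (label x) e j"
proof
  assume f: "flag x e j"
  have "blank_at (label x) (j + dir e * int n)" if "clear (wall x) e j n" for n
    using flag_imp_blank[OF x flag_along[OF x f, of n]] that by (auto simp: clear_def)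
  then show "capped x e j \<and> tail_blank (wall x) (label x) e j"
    using flag_imp_capped[OF f] by (auto simp: tail_blank_def)
next
  assume a: "capped x e j \<and> tail_blank (wall x) (label x) e j"
  then obtain n where n: "\<forall>k<n. \<not> wall x (j + dir e * int k)" "flag x e (j + dir e * int n)"
    by (auto simp: capped_def)
  have "flag x e (j + dir e * int (n - m))" if "m \<le> n" for m
    using that
  proof (induction m)
    case 0 then show ?case using n by simp
  next
    case (Suc m)
    define k where "k = n - Suc m"
    have k: "n - m = Suc k" "k < n" using Suc.prems by (auto simp: k_def)
    have "clear (wall x) e j k" using n(1) k by (auto simp: clear_def)
    then have "blank_at (label x) (j + dir e * int k)" using a by (auto simp: tail_blank_def)
    moreover have "flag x e (j + dir e * int k + dir e)" using Suc k by (simp add: algebra_simps)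
    ultimately have "flag x e (j + dir e * int k)" using flag_step n(1) k by blast
    then show ?case by (simp add: k_def)
  qed
  from this[of n] show "flag x e j" by simp
qed

text \<open>
The case of a whole belt: a ray that starts next to a wall has no boundary through which labels could enter.
\<close>
lemma controls_tail_from_wall:
  assumes "controls r W l l'" "W (j - dir e)" "tail_blank W l e j"
  shows "tail_blank W l' e j"
  unfolding tail_blank_def blank_at_def
proof (intro allI impI)
  fix n s assume c: "clear W e j n"
  have "blank_at l (fst (walk W i (j + dir e * int n, s)))" for i
    using walk_in_ray[OF c, of "(j + dir e * int n, s)" i] assms by (fastforce simp: tail_blank_def)
  then show "l' (j + dir e * int n, s) = b" using assms(1) by (auto simp: controls_def)
qed

lemma controls_tail_later:
  assumes "controls r W l l'" "clear W e j r" "tail_blank W l e j"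
  shows "tail_blank W l' e (j + dir e * int r)"
  unfolding tail_blank_def blank_at_def
proof (intro allI impI)
  fix n s assume "clear W e (j + dir e * int r) n"
  then have c: "clear W e j (r + n)" using clear_shift[OF assms(2)] by simp
  have "blank_at l (fst (walk W i (j + dir e * int (r + n), s)))" if "\<bar>i\<bar> \<le> int r" for i
    using walk_in_ray[OF c, of "(j + dir e * int (r + n), s)" i] assms that by (fastforce simp: tail_blank_def)
  then show "l' (j + dir e * int r + dir e * int n, s) = b"
    using assms(1) by (auto simp: controls_def algebra_simps)
qed

lemma controls_wall: "controls r W l l' \<Longrightarrow> W j \<Longrightarrow> blank_at l j \<Longrightarrow> blank_at l' j"
  by (auto simp: controls_def blank_at_def walk_from_wall)

text \<open>
The labels \<open>l'\<close> are blank where those of \<open>x\<close> are blank in a neighbourhood, and conversely. Symmetry is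
essential: it makes a belt blank for \<open>x\<close> if and only if it is blank for \<open>l'\<close>.
\<close>
definition compatible where
  "compatible x l' \<longleftrightarrow> range l' \<subseteq> L \<and>
     (\<exists>r. controls r (wall x) (label x) l' \<and> controls r (wall x) l' (label x))"

context
  fixes x l'
  assumes x: "x \<in> configs cells" and c: "compatible x l'"
begin

lemma compatible_wall_blank: "wall x j \<Longrightarrow> blank_at l' j"
  using c controls_wall unfolding compatible_def by (metis wall_def)

lemma compatible_tail: "wall x (j - dir e) \<Longrightarrow> tail_blank (wall x) l' e j = tail_blank (wall x) (label x) e j"
  using c controls_tail_from_wall unfolding compatible_def by metis

lemma label_recode [simp]: "label (recode x l') = l'"
  by (auto simp: label_def recode_def)

lemma flag_recode: "flag (recode x l') e j =
    (if wall x j then flag x e j else capped x e j \<and> tail_blank (wall x) l' e j)"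
  by (simp add: flag_def recode_def)

lemma flag_recode_next_wall:
  assumes "wall x j"
  shows "flag (recode x l') e (j + dir e) = flag x e (j + dir e)"
  using compatible_tail[of "j + dir e" e] assms flag_iff_capped_tail[OF x, of "j + dir e"]
  by (auto simp: flag_recode)

text \<open>
Walls persist. At a wall, the neighbouring flags belong to belts that start there, so they only record
whether these belts are blank. Inside a belt the recomputed flags are consistent.
\<close>
lemma wall_recode [simp]: "wall (recode x l') = wall x"
proof
  fix j
  show "wall (recode x l') j = wall x j"
  proof (cases "wall x j")
    case True
    then show ?thesis
      using flag_recode_next_wall[OF True] compatible_wall_blank[OF True]
      by (auto simp: wall_def[of "recode x l'"] flag_recode) (auto simp: wall_def)
  next
    case False
    have "flag (recode x l') e j = flag (recode x l') e (j + dir e)" if "blank_at l' j" for e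
      using False that tail_blank_step[of "wall x" j l' e] capped_step[OF x False, of e]
        capped_wall[of x "j + dir e" e] tail_blank_wall[of "wall x" "j + dir e" l' e]
      by (auto simp: flag_recode)
    then show ?thesis using False by (auto simp: wall_def[of "recode x l'"])
  qed
qed

text \<open>
In a belt without end, the eventual flag survives because the labels stay blank \<open>r\<close> columns further out.
\<close>
lemma capped_recode [simp]: "capped (recode x l') = capped x"
proof (intro ext)
  fix e j
  show "capped (recode x l') e j = capped x e j"
  proof
    assume "capped (recode x l') e j"
    then obtain n where n: "\<forall>k<n. \<not> wall x (j + dir e * int k)" "flag (recode x l') e (j + dir e * int n)"
      by (auto simp: capped_def)
    have "capped x e (j + dir e * int n)"
      using n(2) flag_imp_capped by (auto simp: flag_recode split: if_splits)
    then show "capped x e j" using capped_extend n(1) by blast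
  next
    assume "capped x e j"
    then obtain n where n: "\<forall>k<n. \<not> wall x (j + dir e * int k)" "flag x e (j + dir e * int n)"
      by (auto simp: capped_def)
    define i where "i = j + dir e * int n"
    obtain r where r: "controls r (wall x) (label x) l'" using c by (auto simp: compatible_def)
    have "capped (recode x l') e i"
    proof (cases "clear (wall x) e i r")
      case True
      then have nw: "\<not> wall x i" "\<not> wall x (i + dir e * int r)" by (auto simp: clear_def)
      have "tail_blank (wall x) (label x) e i" using flag_iff_capped_tail[OF x nw(1)] n(2) by (simp add: i_def)
      then have "tail_blank (wall x) l' e (i + dir e * int r)" using controls_tail_later[OF r True] by simp
      moreover have "flag x e (i + dir e * int r)"
        using flag_along[OF x, of e i r] n(2) True by (auto simp: clear_def i_def)
      ultimately have "flag (recode x l') e (i + dir e * int r)"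
        using nw flag_imp_capped by (auto simp: flag_recode)
      then show ?thesis using True unfolding capped_def by (intro exI[of _ r]) (auto simp: clear_def)
    next
      case False
      define k where "k = (LEAST k. wall x (i + dir e * int k))"
      have "\<exists>k. wall x (i + dir e * int k)" using False by (auto simp: clear_def)
      then have k: "wall x (i + dir e * int k)" "\<forall>m<k. \<not> wall x (i + dir e * int m)"
        unfolding k_def by (metis LeastI, metis not_less_Least)
      then have "flag x e (i + dir e * int k)" using flag_along[OF x, of e i k] n(2) by (simp add: i_def)
      then show ?thesis using k unfolding capped_def by (intro exI[of _ k]) (auto simp: flag_recode)
    qed
    then show "capped (recode x l') e j"
      using capped_extend[of n "recode x l'" j e] n(1) by (simp add: i_def)
  qed
qed

lemma recode_in_configs: "recode x l' \<in> configs cells"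
proof -
  have "\<not> flag (recode x l') e j" if "\<not> blank_at l' j" for e j
  proof -
    have "\<not> wall x j" using that compatible_wall_blank by blast
    then show ?thesis using that tail_blank_step[of "wall x" j l' e] by (auto simp: flag_recode)
  qed
  then show ?thesis using c
    unfolding configs_iff cells_def compatible_def flag_def blank_at_def
    by (auto simp: recode_def image_subset_iff)
qed

text \<open>
Recoding only remembers walls, ends and the last labels; hence actions on labels become actions on
configurations.
\<close>
lemma recode_recode: "recode (recode x l') l'' = recode x l''"
  by (intro ext) (simp add: recode_def[of "recode x l'"] flag_recode, simp add: recode_def)

end

lemma recode_label: "x \<in> configs cells \<Longrightarrow> recode x (label x) = x"
  using flag_iff_capped_tail[of x]
  by (auto simp: recode_def fun_eq_iff prod_eq_iff label_def flag_def)

end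

section \<open>Local operations on labels are automorphisms\<close>

context belts
begin

text \<open>
An operation \<open>T\<close> on labels sees the configuration only through its frame, which consists of the walls and the
values at the ends of the belts, and which recoding leaves alone.
\<close>
definition lift where
  "lift T x = recode x (T (wall x) (capped x) (label x))"

text \<open>
Operations that lift to cellular automata: they preserve blankness with some radius, depend
continuously on the configuration, and commute with the shift.
\<close>
definition local_op where
  "local_op T \<longleftrightarrow>
     (\<forall>W C l. range l \<subseteq> L \<longrightarrow> range (T W C l) \<subseteq> L) \<and>
     (\<exists>r. \<forall>W C l. range l \<subseteq> L \<longrightarrow> controls r W l (T W C l)) \<and>
     (\<forall>x \<in> configs cells. \<forall>p. eventually (\<lambda>x'. T (wall x') (capped x') (label x') p =
        T (wall x) (capped x) (label x) p) (nhdsin (full_shift cells) x)) \<and>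
     (\<forall>W C l p. T (\<lambda>j. W (j + 1)) (\<lambda>e j. C e (j + 1)) (l \<circ> right) p = T W C l (right p))"

definition inverse_ops where
  "inverse_ops T T' \<longleftrightarrow> (\<forall>W C l. range l \<subseteq> L \<longrightarrow> T' W C (T W C l) = l \<and> T W C (T' W C l) = l)"

lemma local_op_controls:
  assumes "local_op T"
  obtains r where "\<And>W C l. range l \<subseteq> L \<Longrightarrow> controls r W l (T W C l)"
proof -
  have "\<exists>r. \<forall>W C l. range l \<subseteq> L \<longrightarrow> controls r W l (T W C l)" using assms unfolding local_op_def by argo
  then show ?thesis using that by blast
qed

lemma inverse_ops_sym: "inverse_ops T T' \<Longrightarrow> inverse_ops T' T"
  by (auto simp: inverse_ops_def)

lemma range_label: "x \<in> configs cells \<Longrightarrow> range (label x) \<subseteq> L"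
  using label_in by auto

lemma controls_mono: "controls r W l l' \<Longrightarrow> r \<le> s \<Longrightarrow> controls s W l l'"
  unfolding controls_def by fastforce

lemma local_op_compatible:
  assumes T: "local_op T" "local_op T'" "inverse_ops T T'" and x: "x \<in> configs cells"
  shows "compatible x (T (wall x) (capped x) (label x))"
proof -
  let ?l = "T (wall x) (capped x) (label x)"
  have l: "range (label x) \<subseteq> L" "range ?l \<subseteq> L"
    using T(1) range_label[OF x] by (auto simp: local_op_def)
  obtain r where r: "controls r (wall x) (label x) ?l" using local_op_controls[OF T(1)] l by metis
  obtain r' where "controls r' (wall x) ?l (T' (wall x) (capped x) ?l)"
    using local_op_controls[OF T(2)] l by metis
  then have r': "controls r' (wall x) ?l (label x)" using T(3) l by (simp add: inverse_ops_def)
  show ?thesis unfolding compatible_def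
    using l r r' controls_mono[of _ _ _ _ "max r r'"] by (meson max.cobounded1 max.cobounded2)
qed

lemma lift_in_configs:
  assumes "local_op T" "local_op T'" "inverse_ops T T'" "x \<in> configs cells"
  shows "lift T x \<in> configs cells"
  using recode_in_configs local_op_compatible assms by (auto simp: lift_def)

lemma lift_lift:
  assumes T: "local_op T" "local_op T'" "inverse_ops T T'" and x: "x \<in> configs cells"
  shows "lift S (lift T x) = lift (\<lambda>W C l. S W C (T W C l)) x"
  using local_op_compatible[OF T x] by (simp add: lift_def x recode_recode)

lemma lift_cong:
  assumes "x \<in> configs cells" "\<And>W C l. range l \<subseteq> L \<Longrightarrow> S W C l = T W C l"
  shows "lift S x = lift T x"
  by (simp add: lift_def assms range_label)

lemma lift_id: "x \<in> configs cells \<Longrightarrow> lift (\<lambda>W C l. l) x = x"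
  by (simp add: lift_def recode_label)

lemma lift_inverse:
  assumes "local_op T" "local_op T'" "inverse_ops T T'" "x \<in> configs cells"
  shows "lift T' (lift T x) = x"
  using lift_lift[OF assms, of T'] lift_cong[of x "\<lambda>W C l. T' W C (T W C l)" "\<lambda>W C l. l"] assms
  by (simp add: lift_id inverse_ops_def)

lemma wall_shift: "wall (shift x) = (\<lambda>j. wall x (j + 1))"
  by (simp add: fun_eq_iff wall_def blank_at_def label_def flag_def shift_def add_ac)

lemma flag_shift: "flag (shift x) e j = flag x e (j + 1)"
  by (simp add: flag_def shift_def)

lemma capped_shift: "capped (shift x) = (\<lambda>e j. capped x e (j + 1))"
  by (simp add: fun_eq_iff capped_def wall_shift flag_shift add_ac)

lemma label_shift: "label (shift x) = label x \<circ> right"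
  by (simp add: fun_eq_iff label_def right_def shift_def)

lemma lift_shift:
  assumes "local_op T"
  shows "lift T (shift x) = shift (lift T x)"
proof -
  have t: "T (\<lambda>j. wall x (j + 1)) (\<lambda>e j. capped x e (j + 1)) (label x \<circ> right) =
      T (wall x) (capped x) (label x) \<circ> right"
    using assms by (auto simp: local_op_def)
  have tail: "tail_blank (\<lambda>j. W (j + 1)) (l \<circ> right) e j = tail_blank W l e (j + 1)" for W l e j
    by (simp add: tail_blank_def clear_def blank_at_def right_def add_ac)
  show ?thesis
    by (intro ext) (simp add: lift_def wall_shift capped_shift label_shift t recode_def tail flag_shift,
      simp add: shift_def right_def)
qed

abbreviation near where "near x \<equiv> nhdsin (full_shift cells) x"

lemma near_label: "eventually (\<lambda>x'. label x' p = label x p) (near x)"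
  by (rule eventually_mono[OF eventually_coordinate[of "fst p"]]) (simp add: label_def)

lemma near_flag: "eventually (\<lambda>x'. flag x' e j = flag x e j) (near x)"
  by (rule eventually_mono[OF eventually_coordinate[of j]]) (simp add: flag_def)

lemma near_wall: "eventually (\<lambda>x'. wall x' j = wall x j) (near x)"
proof -
  have "eventually (\<lambda>x'. (label x' (j, True) = label x (j, True) \<and> label x' (j, False) = label x (j, False)) \<and>
      (\<forall>e. flag x' e j = flag x e j \<and> flag x' e (j + dir e) = flag x e (j + dir e))) (near x)"
    by (intro eventually_conj near_label near_flag eventually_all_finite)
  then show ?thesis by (rule eventually_mono) (simp add: wall_def blank_at_iff)
qed

lemma near_walk: "eventually (\<lambda>x'. walk (wall x') i p = walk (wall x) i p) (near x)"
proof -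
  have step: "eventually (\<lambda>x'. step (wall x') q = step (wall x) q) (near x)" for q
    using near_wall[of "fst q" x] near_wall[of "fst q + dir (snd q)" x]
    by eventually_elim (simp add: step_def)
  have "eventually (\<lambda>x'. (step (wall x') ^^ n) q = (step (wall x) ^^ n) q) (near x)" for n q
  proof (induction n)
    case (Suc n)
    then show ?case using step[of "(step (wall x) ^^ n) q"] by eventually_elim simp
  qed simp
  from this[of "nat \<bar>i\<bar>" "if 0 \<le> i then p else flip p"] show ?thesis
    by eventually_elim (auto simp: walk_def split: if_splits)
qed

lemma tail_blank_split:
  assumes "\<forall>k<n. \<not> W (j + dir e * int k)"
  shows "tail_blank W l e j \<longleftrightarrow>
    (\<forall>k<n. blank_at l (j + dir e * int k)) \<and> tail_blank W l e (j + dir e * int n)"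
  using assms
proof (induction n)
  case (Suc n)
  then show ?case using tail_blank_step[of W "j + dir e * int n" l e]
    by (auto simp: less_Suc_eq algebra_simps)
qed simp

lemma capped_split:
  assumes "x \<in> configs cells" "\<forall>k<n. \<not> wall x (j + dir e * int k)"
  shows "capped x e j \<longleftrightarrow> capped x e (j + dir e * int n)"
  using assms(2)
proof (induction n)
  case (Suc n)
  then show ?case using capped_step[OF assms(1), of "j + dir e * int n" e]
    by (auto simp: less_Suc_eq algebra_simps)
qed simp

text \<open>
Flags speak about unboundedly many columns, but their new values are locally constant. If the belt has
an end in direction \<open>e\<close>, a window reaching this end decides. Otherwise let \<open>r\<close> be a radius of blankness for \<open>T\<close> and
for its inverse. If some flag is set further out, then the new labels are blank from \<open>r\<close> columns beyond
it, for all configurations in a neighbourhood, so only finitely many columns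
remain to be inspected. If no flag is set, a new flag in column \<open>j\<close> would, by the inverse, force an old flag in column
\<open>j + dir e * r\<close>, which is seen to be absent.
\<close>
lemma near_flag_lift:
  assumes T: "local_op T" "local_op T'" "inverse_ops T T'" and x: "x \<in> configs cells"
  shows "eventually (\<lambda>x'. flag (lift T x') e j = flag (lift T x) e j) (near x)"
proof -
  let ?T = "\<lambda>x. T (wall x) (capped x) (label x)"
  have fl: "flag (lift T x') e j = (if wall x' j then flag x' e j
      else capped x' e j \<and> tail_blank (wall x') (?T x') e j)" for x'
    by (simp add: lift_def recode_def flag_def)
  have T_near: "eventually (\<lambda>x'. \<forall>k<n. \<forall>s. ?T x' (j + dir e * int k, s) = ?T x (j + dir e * int k, s)) (near x)" for n
    using T(1) x by (intro eventually_all_finite eventually_ball_finite[of "{..<n}", simplified lessThan_iff Ball_def])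
      (auto simp: local_op_def intro!: eventually_all_finite)
  have W_near: "eventually (\<lambda>x'. \<forall>k\<le>n. wall x' (j + dir e * int k) = wall x (j + dir e * int k)) (near x)" for n
  proof -
    have "eventually (\<lambda>x'. \<forall>k\<in>{..n}. wall x' (j + dir e * int k) = wall x (j + dir e * int k)) (near x)"
      by (intro eventually_ball_finite ballI near_wall) simp
    then show ?thesis by (rule eventually_mono) simp
  qed
  obtain r where r: "\<And>x'. x' \<in> configs cells \<Longrightarrow>
      controls r (wall x') (label x') (?T x') \<and> controls r (wall x') (?T x') (label x')"
  proof -
    obtain r1 where r1: "\<And>W C l. range l \<subseteq> L \<Longrightarrow> controls r1 W l (T W C l)"
      using local_op_controls[OF T(1)] by blast
    obtain r2 where r2: "\<And>W C l. range l \<subseteq> L \<Longrightarrow> controls r2 W l (T' W C l)"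
      using local_op_controls[OF T(2)] by blast
    note r = r1 r2
    have "controls r1 (wall x') (label x') (?T x')" "controls r2 (wall x') (?T x') (label x')"
      if "x' \<in> configs cells" for x'
    proof -
      have l: "range (label x') \<subseteq> L" "range (?T x') \<subseteq> L" using range_label[OF that] T(1) by (auto simp: local_op_def)
      show "controls r1 (wall x') (label x') (?T x')" using r(1) l by blast
      show "controls r2 (wall x') (?T x') (label x')"
        using r(2)[of "?T x'" "wall x'" "capped x'"] l T(3) by (simp add: inverse_ops_def)
    qed
    then show ?thesis using that[of "max r1 r2"] controls_mono by (meson max.cobounded1 max.cobounded2)
  qed
  show ?thesis
  proof (cases "\<exists>n. wall x (j + dir e * int n)")
    case True
    define n where "n = (LEAST n. wall x (j + dir e * int n))"
    have n: "wall x (j + dir e * int n)" "\<And>k. k < n \<Longrightarrow> \<not> wall x (j + dir e * int k)"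
      unfolding n_def using True by (metis LeastI, metis not_less_Least)
    have *: "flag (lift T x') e j = (flag x' e (j + dir e * int n) \<and> (\<forall>k<n. blank_at (?T x') (j + dir e * int k)))"
      if x': "x' \<in> configs cells" "\<forall>k\<le>n. wall x' (j + dir e * int k) = wall x (j + dir e * int k)" for x'
    proof (cases "n = 0")
      case True
      then show ?thesis using n that by (auto simp: fl)
    next
      case False
      then have "\<not> wall x' j" using that n(2)[of 0] by auto
      moreover have "\<forall>k<n. \<not> wall x' (j + dir e * int k)" "wall x' (j + dir e * int n)" using n that by auto
      ultimately show ?thesis
        using capped_split[OF x'(1), of n j e] tail_blank_split[of n "wall x'" j e "?T x'"]
          capped_wall[of x' "j + dir e * int n" e] tail_blank_wall[of "wall x'" "j + dir e * int n" "?T x'" e]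
        by (auto simp: fl)
    qed
    show ?thesis
      using W_near[of n] T_near[of n] near_flag[of e "j + dir e * int n" x] eventually_in_configs[of cells x]
      by eventually_elim (simp add: * x blank_at_def)
  next
    case False
    show ?thesis
    proof (cases "capped x e j")
      case True
      then obtain n where n: "flag x e (j + dir e * int n)" by (auto simp: capped_def)
      have *: "flag (lift T x') e j = (\<forall>k<n+r. blank_at (?T x') (j + dir e * int k))"
        if x': "x' \<in> configs cells" "\<forall>k\<le>n+r. wall x' (j + dir e * int k) = wall x (j + dir e * int k)"
          "flag x' e (j + dir e * int n) = flag x e (j + dir e * int n)" for x'
      proof -
        have W: "\<not> wall x' (j + dir e * int k)" if "k \<le> n + r" for k using x' False that by auto
        have c: "clear (wall x') e (j + dir e * int n) r"
          using clear_shift[of "wall x'" e j n r] W by (simp add: clear_def)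
        have f: "flag x' e (j + dir e * int n)" using n x' by simp
        have "tail_blank (wall x') (label x') e (j + dir e * int n)"
          using flag_iff_capped_tail[OF x'(1) W[of n], of e] f by simp
        then have "tail_blank (wall x') (?T x') e (j + dir e * int (n + r))"
          using controls_tail_later[OF conjunct1[OF r[OF x'(1)]] c] by (simp add: algebra_simps)
        moreover have "capped x' e j" using capped_extend[of n x' j e] W flag_imp_capped[OF f] by auto
        ultimately show ?thesis using tail_blank_split[of "n + r" "wall x'" j e "?T x'"] W W[of 0] by (auto simp: fl)
      qed
      show ?thesis
        using W_near[of "n + r"] T_near[of "n + r"] near_flag[of e "j + dir e * int n" x] eventually_in_configs[of cells x]
        by eventually_elim (simp add: * x blank_at_def)
    next
      case nc: False
      have nw: "\<not> wall x (j + dir e * int k)" for k using False by blast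
      have *: "\<not> flag (lift T x') e j"
        if x': "x' \<in> configs cells" "\<forall>k\<le>r. wall x' (j + dir e * int k) = wall x (j + dir e * int k)"
          "flag x' e (j + dir e * int r) = flag x e (j + dir e * int r)" for x'
      proof
        assume f: "flag (lift T x') e j"
        have W: "\<not> wall x' (j + dir e * int k)" if "k \<le> r" for k using x' nw that by auto
        then have c: "clear (wall x') e j r" by (simp add: clear_def)
        have f: "capped x' e j" "tail_blank (wall x') (?T x') e j" using f W[of 0] by (auto simp: fl)
        have "tail_blank (wall x') (label x') e (j + dir e * int r)"
          using controls_tail_later[OF conjunct2[OF r[OF x'(1)]] c] f(2) by simp
        moreover have "capped x' e (j + dir e * int r)" using capped_split[OF x'(1), of r j e] W f(1) by auto
        ultimately have "flag x' e (j + dir e * int r)" using flag_iff_capped_tail[OF x'(1) W[of r]] by simp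
        then have "flag x e (j + dir e * int r)" using x' by simp
        then have "capped x e j" using nw unfolding capped_def by blast
        then show False using nc by simp
      qed
      have "\<not> flag (lift T x) e j" using nc nw[of 0] by (auto simp: fl)
      then show ?thesis
        using eventually_conj[OF W_near[of r] eventually_conj[OF near_flag[of e "j + dir e * int r" x] eventually_in_configs[of cells x]]]
        by (elim eventually_mono) (use * in simp)
    qed
  qed
qed

lemma continuous_lift:
  assumes T: "local_op T" "local_op T'" "inverse_ops T T'"
  shows "continuous_map (full_shift cells) (full_shift cells) (lift T)"
  unfolding continuous_map_full_shift_iff
proof (intro conjI ballI allI)
  show "lift T \<in> configs cells \<rightarrow> configs cells" using lift_in_configs[OF T] by blast
  fix x j assume x: "x \<in> configs cells"
  have fst: "fst (lift T x' j) = (\<lambda>e. T (wall x') (capped x') (label x') (j, e))" for x'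
    by (simp add: lift_def recode_def)
  have "eventually (\<lambda>x'. (\<forall>e. T (wall x') (capped x') (label x') (j, e) = T (wall x) (capped x) (label x) (j, e)) \<and>
      (\<forall>e. flag (lift T x') e j = flag (lift T x) e j)) (near x)"
    using T(1) x near_flag_lift[OF T x] by (intro eventually_conj eventually_all_finite) (auto simp: local_op_def)
  then show "eventually (\<lambda>x'. lift T x' j = lift T x j) (near x)"
    by (rule eventually_mono) (simp add: prod_eq_iff fst, simp add: flag_def fun_eq_iff)
qed

lemma lift_Aut:
  assumes T: "local_op T" "local_op T'" "inverse_ops T T'"
  shows "restrict (lift T) (configs cells) \<in> carrier (shift_Aut cells)"
proof -
  note T' = T(2,1) inverse_ops_sym[OF T(3)]
  have h: "homeomorphic_maps (full_shift cells) (full_shift cells) (lift T) (lift T')"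
    using continuous_lift[OF T] continuous_lift[OF T'] lift_inverse[OF T] lift_inverse[OF T']
    by (auto simp: homeomorphic_maps_def)
  then have "homeomorphic_map (full_shift cells) (full_shift cells) (lift T)"
    using homeomorphic_maps_map by blast
  then have hm: "homeomorphic_map (full_shift cells) (full_shift cells) (restrict (lift T) (configs cells))"
    by (rule homeomorphic_map_eq) auto
  moreover have "restrict (lift T) (configs cells) \<in> Bij (configs cells)"
    using hm unfolding Bij_def homeomorphic_eq_everything_map by (auto simp: bij_betw_def)
  ultimately show ?thesis
    using lift_shift[OF T(1)] lift_in_configs[OF T] shift_configs[of _ cells]
    by (simp add: shift_Aut_def)
qed

end

section \<open>Automorphism groups of full shifts\<close>

lemma BijGroup_mult: "f \<in> Bij S \<Longrightarrow> g \<in> Bij S \<Longrightarrow> f \<otimes>\<^bsub>BijGroup S\<^esub> g = compose S f g"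
  by (simp add: BijGroup_def)

lemma shift_Aut_iff: "f \<in> carrier (shift_Aut S) \<longleftrightarrow> f \<in> Bij (configs S) \<and>
    homeomorphic_map (full_shift S) (full_shift S) f \<and> (\<forall>x \<in> configs S. f (shift x) = shift (f x))"
  by (simp add: shift_Aut_def)

lemma subgroup_shift_Aut: "subgroup (carrier (shift_Aut S)) (BijGroup (configs S))"
proof -
  interpret B: group "BijGroup (configs S)" by (rule group_BijGroup)
  show ?thesis
  proof (rule B.subgroupI)
    show "carrier (shift_Aut S) \<subseteq> carrier (BijGroup (configs S))" by (auto simp: shift_Aut_iff BijGroup_def)
    have "homeomorphic_map (full_shift S) (full_shift S) (\<lambda>x\<in>configs S. x)"
      by (rule homeomorphic_map_eq[of _ _ id]) auto
    then have "(\<lambda>x\<in>configs S. x) \<in> carrier (shift_Aut S)"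
      using id_Bij by (auto simp: shift_Aut_iff shift_configs)
    then show "carrier (shift_Aut S) \<noteq> {}" by blast
  next
    fix f assume f: "f \<in> carrier (shift_Aut S)"
    define g where "g = restrict (inv_into (configs S) f) (configs S)"
    have fB: "f \<in> Bij (configs S)" and bij: "bij_betw f (configs S) (configs S)"
      using f by (auto simp: shift_Aut_iff Bij_def)
    have i: "inv\<^bsub>BijGroup (configs S)\<^esub> f = g"
      using inv_BijGroup[OF fB] by (simp add: g_def)
    have gB: "g \<in> Bij (configs S)" unfolding g_def by (rule restrict_inv_into_Bij[OF fB])
    have gf: "g (f x) = x" "f (g x) = x" if "x \<in> configs S" for x
      using bij that unfolding g_def by (auto simp: bij_betw_def f_inv_into_f)
    have fin: "f x \<in> configs S" "g x \<in> configs S" if "x \<in> configs S" for x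
      using that Bij_imp_funcset[OF fB] Bij_imp_funcset[OF gB] by auto
    obtain g' where g': "homeomorphic_maps (full_shift S) (full_shift S) f g'"
      using f homeomorphic_map_maps unfolding shift_Aut_iff by blast
    have "g' x = g x" if "x \<in> configs S" for x
      using g' gf(2)[OF that] fin(2)[OF that] unfolding homeomorphic_maps_def by metis
    moreover have "homeomorphic_map (full_shift S) (full_shift S) g'"
      using g' homeomorphic_maps_map homeomorphic_maps_sym by blast
    ultimately have "homeomorphic_map (full_shift S) (full_shift S) g"
      by (rule homeomorphic_map_eq[rotated]) auto
    moreover have "g (shift x) = shift (g x)" if "x \<in> configs S" for x
    proof -
      have "f (shift (g x)) = shift x" using f fin(2)[OF that] gf(2)[OF that] by (auto simp: shift_Aut_iff)
      then show ?thesis using gf(1)[OF shift_configs[OF fin(2)[OF that]]] by simp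
    qed
    ultimately show "inv\<^bsub>BijGroup (configs S)\<^esub> f \<in> carrier (shift_Aut S)"
      using gB i by (simp add: shift_Aut_iff)
  next
    fix f g assume f: "f \<in> carrier (shift_Aut S)" and g: "g \<in> carrier (shift_Aut S)"
    have B: "f \<in> Bij (configs S)" "g \<in> Bij (configs S)" using f g by (auto simp: shift_Aut_iff)
    have "homeomorphic_map (full_shift S) (full_shift S) (f \<circ> g)"
      using f g homeomorphic_map_compose unfolding shift_Aut_iff by blast
    then have "homeomorphic_map (full_shift S) (full_shift S) (compose (configs S) f g)"
      by (rule homeomorphic_map_eq) (simp add: compose_def)
    moreover have "g x \<in> configs S" if "x \<in> configs S" for x using Bij_imp_funcset[OF B(2)] that by auto
    ultimately show "f \<otimes>\<^bsub>BijGroup (configs S)\<^esub> g \<in> carrier (shift_Aut S)"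
      using B f g compose_Bij[OF B] by (simp add: BijGroup_mult shift_Aut_iff) (simp add: compose_def shift_configs)
  qed
qed

lemma group_shift_Aut: "group (shift_Aut S)"
proof -
  have "shift_Aut S = BijGroup (configs S)\<lparr>carrier := carrier (shift_Aut S)\<rparr>"
    by (simp add: shift_Aut_def)
  then show ?thesis
    using subgroup.subgroup_is_group[OF subgroup_shift_Aut group_BijGroup] by metis
qed

lemma shift_Aut_mult:
  "f \<in> carrier (shift_Aut S) \<Longrightarrow> g \<in> carrier (shift_Aut S) \<Longrightarrow> f \<otimes>\<^bsub>shift_Aut S\<^esub> g = compose (configs S) f g"
  by (auto simp: shift_Aut_def BijGroup_mult)

lemma shift_Aut_one: "\<one>\<^bsub>shift_Aut S\<^esub> = (\<lambda>x\<in>configs S. x)"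
  by (simp add: shift_Aut_def BijGroup_def)

lemma shift_Aut_in_configs: "f \<in> carrier (shift_Aut S) \<Longrightarrow> x \<in> configs S \<Longrightarrow> f x \<in> configs S"
  using Bij_imp_funcset by (fastforce simp: shift_Aut_iff)

lemma subgroup_shift_Aut0:
  assumes "a0 \<in> S"
  shows "subgroup (carrier (shift_Aut0 S a0)) (shift_Aut S)"
proof -
  interpret group "shift_Aut S" by (rule group_shift_Aut)
  have c: "(\<lambda>_. a0) \<in> configs S" using assms by (simp add: configs_iff)
  show ?thesis
  proof (rule subgroupI)
    show "carrier (shift_Aut0 S a0) \<noteq> {}"
      using one_closed c by (auto simp: shift_Aut0_def stabilizer_def shift_Aut_one)
  next
    fix f assume "f \<in> carrier (shift_Aut0 S a0)"
    then have f: "f \<in> carrier (shift_Aut S)" "f (\<lambda>_. a0) = (\<lambda>_. a0)" by (auto simp: shift_Aut0_def stabilizer_def)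
    have "compose (configs S) (inv\<^bsub>shift_Aut S\<^esub> f) f = (\<lambda>x\<in>configs S. x)"
      using f l_inv[OF f(1)] shift_Aut_mult[of "inv\<^bsub>shift_Aut S\<^esub> f" S f] by (simp add: shift_Aut_one)
    from fun_cong[OF this, of "\<lambda>_. a0"] show "inv\<^bsub>shift_Aut S\<^esub> f \<in> carrier (shift_Aut0 S a0)"
      using f c by (simp add: shift_Aut0_def stabilizer_def compose_def)
  next
    fix f g assume "f \<in> carrier (shift_Aut0 S a0)" "g \<in> carrier (shift_Aut0 S a0)"
    then show "f \<otimes>\<^bsub>shift_Aut S\<^esub> g \<in> carrier (shift_Aut0 S a0)"
      using c m_closed[of f g] shift_Aut_mult[of f S g] by (auto simp: shift_Aut0_def stabilizer_def compose_def)
  qed (auto simp: shift_Aut0_def stabilizer_def)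
qed

lemma Aut_translate:
  assumes f: "f \<in> carrier (shift_Aut S)" and x: "x \<in> configs S"
  shows "f (\<lambda>i. x (i + t)) = (\<lambda>i. f x (i + t))"
proof -
  have c: "(\<lambda>i. x (i + t)) \<in> configs S" for t using x by (simp add: configs_iff)
  have s: "f (\<lambda>i. x (i + (t + 1))) = (\<lambda>i. f (\<lambda>i. x (i + t)) (i + 1))" for t
  proof -
    have "f (shift (\<lambda>i. x (i + t))) = shift (f (\<lambda>i. x (i + t)))" using f c by (simp add: shift_Aut_iff)
    then show ?thesis by (simp add: shift_def add_ac)
  qed
  show ?thesis
  proof (induction t rule: int_induct[of _ 0])
    case base then show ?case by simp
  next
    case (step1 t) then show ?case using s[of t] by (simp add: add_ac)
  next
    case (step2 t)
    have "f (\<lambda>i. x (i + (t - 1))) (i + 1) = f x (i + t)" for i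
      using fun_cong[OF s[of "t - 1"], of i] step2 by simp
    from this[of "_ - 1"] show ?case by (intro ext) (simp add: algebra_simps)
  qed
qed

section \<open>Periodic versions of the orbit of the special point\<close>

text \<open>
The data of a weakly pointy group, with the position \<open>k\<close> of the word in the special point and an explicit
bound \<open>n0\<close> for the admissible periods.
\<close>
locale pointed_automorphisms =
  fixes \<Sigma> :: "'a set" and a0 :: 'a and H :: "((int \<Rightarrow> 'a) \<Rightarrow> int \<Rightarrow> 'a) set"
    and u :: "'a list" and k :: int and n0 :: nat
  assumes finite_alphabet: "finite \<Sigma>" and a0: "a0 \<in> \<Sigma>"
    and H: "subgroup H (shift_Aut0 \<Sigma> a0)"
    and u: "set u \<subseteq> \<Sigma>" and n0: "0 < n0" "length u \<le> n0"
    and stab: "\<And>n. n0 \<le> n \<Longrightarrow>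
      stabilizer (shift_Aut \<Sigma>\<lparr>carrier := H\<rparr>) (\<lambda>h. h) (finite_point a0 u k) \<subseteq>
      stabilizer (shift_Aut \<Sigma>\<lparr>carrier := H\<rparr>) word_act (u @ replicate (n - length u) a0)"
begin

abbreviation "HH \<equiv> shift_Aut \<Sigma>\<lparr>carrier := H\<rparr>"

abbreviation "x0 \<equiv> finite_point a0 u k"

abbreviation "\<Omega> \<equiv> orbit HH (\<lambda>h. h) x0"

lemma H_Aut: "h \<in> H \<Longrightarrow> h \<in> carrier (shift_Aut \<Sigma>)"
  using subgroup.mem_carrier[OF H] by (auto simp: shift_Aut0_def stabilizer_def)

lemma H_fixes_zero: "h \<in> H \<Longrightarrow> h (\<lambda>_. a0) = (\<lambda>_. a0)"
  using subgroup.mem_carrier[OF H] by (auto simp: shift_Aut0_def stabilizer_def)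

lemma group_HH: "group HH"
proof -
  have "group (shift_Aut0 \<Sigma> a0)"
    using subgroup.subgroup_is_group[OF subgroup_shift_Aut0[OF a0] group_shift_Aut] by (simp add: shift_Aut0_def)
  from subgroup.subgroup_is_group[OF H this] show ?thesis by (simp add: shift_Aut0_def)
qed

lemma H_mult: "g \<in> H \<Longrightarrow> h \<in> H \<Longrightarrow> g \<otimes>\<^bsub>HH\<^esub> h = compose (configs \<Sigma>) g h"
  using shift_Aut_mult[OF H_Aut H_Aut] by simp

lemma H_compose: "g \<in> H \<Longrightarrow> h \<in> H \<Longrightarrow> compose (configs \<Sigma>) g h \<in> H"
  using monoid.m_closed[OF group.is_monoid[OF group_HH], of g h] H_mult by simp

lemma H_one: "\<one>\<^bsub>HH\<^esub> = (\<lambda>x\<in>configs \<Sigma>. x)"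
  by (simp add: shift_Aut_one)

lemma H_id: "(\<lambda>x\<in>configs \<Sigma>. x) \<in> H"
  using monoid.one_closed[OF group.is_monoid[OF group_HH]] H_one by simp

lemma H_inv_closed: "h \<in> H \<Longrightarrow> inv\<^bsub>HH\<^esub> h \<in> H"
  using group.inv_closed[OF group_HH] by simp

lemma H_inv:
  assumes "h \<in> H" "x \<in> configs \<Sigma>"
  shows "(inv\<^bsub>HH\<^esub> h) (h x) = x" "h ((inv\<^bsub>HH\<^esub> h) x) = x"
proof -
  have "compose (configs \<Sigma>) (inv\<^bsub>HH\<^esub> h) h = (\<lambda>x\<in>configs \<Sigma>. x)" "compose (configs \<Sigma>) h (inv\<^bsub>HH\<^esub> h) = (\<lambda>x\<in>configs \<Sigma>. x)"
    using group.l_inv[OF group_HH, of h] group.r_inv[OF group_HH, of h] assms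
      H_mult[OF H_inv_closed[OF assms(1)] assms(1)] H_mult[OF assms(1) H_inv_closed[OF assms(1)]] H_one by simp_all
  from fun_cong[OF this(1), of x] fun_cong[OF this(2), of x] show
    "(inv\<^bsub>HH\<^esub> h) (h x) = x" "h ((inv\<^bsub>HH\<^esub> h) x) = x" using assms(2) by (simp_all add: compose_def)
qed

lemma H_configs: "h \<in> H \<Longrightarrow> x \<in> configs \<Sigma> \<Longrightarrow> h x \<in> configs \<Sigma>"
  using shift_Aut_in_configs[OF H_Aut] .

lemma H_translate: "h \<in> H \<Longrightarrow> x \<in> configs \<Sigma> \<Longrightarrow> h (\<lambda>i. x (i + t)) = (\<lambda>i. h x (i + t))"
  using Aut_translate[OF H_Aut] .

lemma H_near:
  assumes "h \<in> H" "x \<in> configs \<Sigma>"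
  shows "eventually (\<lambda>x'. h x' j = h x j) (nhdsin (full_shift \<Sigma>) x)"
  using H_Aut[OF assms(1)] assms(2) homeomorphic_imp_continuous_map continuous_map_full_shift_iff
  unfolding shift_Aut_iff by metis

lemma H_window:
  assumes "h \<in> H" "x \<in> configs \<Sigma>"
  obtains r :: nat where "\<And>x'. x' \<in> configs \<Sigma> \<Longrightarrow> (\<And>i. \<bar>i\<bar> \<le> int r \<Longrightarrow> x' i = x i) \<Longrightarrow> h x' j = h x j"
proof -
  obtain I where I: "finite I" "\<forall>x'\<in>configs \<Sigma>. (\<forall>i\<in>I. x' i = x i) \<longrightarrow> h x' j = h x j"
    using H_near[OF assms, of j] unfolding eventually_nhdsin_full_shift[OF assms(2)] by (elim exE conjE) 
  have "\<exists>r::nat. \<forall>i\<in>I. \<bar>i\<bar> \<le> int r"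
  proof (intro exI ballI)
    fix i assume "i \<in> I"
    then have "\<bar>i\<bar> \<le> Max (insert 0 (abs ` I))" using I(1) by (intro Max_ge) auto
    then show "\<bar>i\<bar> \<le> int (nat (Max (insert 0 (abs ` I))))" by linarith
  qed
  then obtain r :: nat where r: "\<forall>i\<in>I. \<bar>i\<bar> \<le> int r" ..
  have "h x' j = h x j" if "x' \<in> configs \<Sigma>" "\<And>i. \<bar>i\<bar> \<le> int r \<Longrightarrow> x' i = x i" for x'
    using bspec[OF I(2) that(1)] that(2) r by simp
  then show ?thesis by (rule that)
qed

lemma zero_configs: "(\<lambda>_. a0) \<in> configs \<Sigma>"
  using a0 by (simp add: configs_iff)

text \<open>
Continuity at the constant point yields a radius that is uniform in \<open>x\<close>.
\<close>
lemma H_zero_radius: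
  assumes "h \<in> H"
  obtains r :: nat where "\<And>x j. x \<in> configs \<Sigma> \<Longrightarrow> (\<And>i. \<bar>i - j\<bar> \<le> int r \<Longrightarrow> x i = a0) \<Longrightarrow> h x j = a0"
proof -
  obtain r :: nat where r: "\<And>x'. x' \<in> configs \<Sigma> \<Longrightarrow> (\<And>i. \<bar>i\<bar> \<le> int r \<Longrightarrow> x' i = a0) \<Longrightarrow> h x' 0 = h (\<lambda>_. a0) 0"
    using H_window[OF assms zero_configs, of 0] by blast
  have "h x j = a0" if x: "x \<in> configs \<Sigma>" "\<And>i. \<bar>i - j\<bar> \<le> int r \<Longrightarrow> x i = a0" for x j
  proof -
    have "h (\<lambda>i. x (i + j)) 0 = h (\<lambda>_. a0) 0"
      using x by (intro r) (auto simp: configs_iff)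
    then show ?thesis using H_translate[OF assms x(1), of j] H_fixes_zero[OF assms] by simp
  qed
  then show ?thesis by (rule that)
qed

text \<open>
The convention of period \<open>0\<close> for infinite tapes is extended to the special point: its
version of period \<open>0\<close> is the special point itself.
\<close>
definition period_ok :: "nat \<Rightarrow> bool" where
  "period_ok n \<longleftrightarrow> n = 0 \<or> n0 \<le> n"

definition special :: "nat \<Rightarrow> int \<Rightarrow> 'a" where
  "special n = (if n = 0 then x0 else (\<lambda>i. periodic_point (u @ replicate (n - length u) a0) (i - k)))"

lemma special_0 [simp]: "special 0 = x0" by (simp add: special_def)

lemma special_periodic:
  assumes "n \<noteq> 0" "length u \<le> n"
  shows "special n i = (let m = nat ((i - k) mod int n) in if m < length u then u ! m else a0)"
proof -
  have "nat ((i - k) mod int n) < n" using assms(1) by (simp add: nat_less_iff)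
  then show ?thesis using assms by (auto simp: special_def periodic_point_def Let_def nth_append)
qed

lemma special_configs: "period_ok n \<Longrightarrow> special n \<in> configs \<Sigma>"
proof (cases "n = 0")
  case True
  then show ?thesis using u a0 by (auto simp: configs_iff finite_point_def subset_iff)
next
  case False
  assume "period_ok n"
  then have "length u \<le> n" using n0 False by (auto simp: period_ok_def)
  then show ?thesis using special_periodic[OF False] u a0 by (auto simp: configs_iff Let_def subset_iff)
qed

lemma special_zero:
  assumes "period_ok n" "\<And>t. \<bar>k\<bar> + int (length u) \<le> \<bar>i + t * int n\<bar>"
  shows "special n i = a0"
proof (cases "n = 0")
  case True
  then show ?thesis using assms(2)[of 0] by (auto simp: finite_point_def)
next
  case False
  have l: "length u \<le> n" using assms(1) n0 False by (auto simp: period_ok_def)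
  show ?thesis
  proof (rule ccontr)
    assume "special n i \<noteq> a0"
    then have "nat ((i - k) mod int n) < length u" using special_periodic[OF False l] by (auto simp: Let_def split: if_splits)
    moreover have "(i - k) mod int n = i - k - int n * ((i - k) div int n)" by (simp add: minus_mult_div_eq_mod)
    moreover have "0 \<le> (i - k) mod int n" using False by simp
    ultimately have "\<bar>i - int n * ((i - k) div int n)\<bar> < \<bar>k\<bar> + int (length u)" by linarith
    then have "\<bar>i + (- ((i - k) div int n)) * int n\<bar> < \<bar>k\<bar> + int (length u)" by (simp add: algebra_simps)
    then show False using assms(2)[of "- ((i - k) div int n)"] by linarith
  qed
qed

lemma special_limit:
  assumes "\<bar>i\<bar> \<le> int r" "int n \<ge> int r + \<bar>k\<bar> + int (length u) + 1"
  shows "special n i = x0 i"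
proof -
  have n: "n \<noteq> 0" "length u \<le> n" using assms by auto
  show ?thesis
  proof (cases "k \<le> i")
    case True
    then have "(i - k) mod int n = i - k" using assms by (intro mod_pos_pos_trivial) auto
    then show ?thesis using True special_periodic[OF n, of i] by (auto simp: finite_point_def Let_def nat_less_iff)
  next
    case False
    have "(i - k) mod int n = (i - k + int n) mod int n" by simp
    also have "\<dots> = i - k + int n" using False assms by (intro mod_pos_pos_trivial) auto
    finally show ?thesis using False assms special_periodic[OF n, of i] by (auto simp: finite_point_def Let_def)
  qed
qed

text \<open>
This is the place where weak pointiness is used. A word is fixed if and only if the periodic
point is, because automorphisms commute with powers of the shift.
\<close>
lemma stabilizer_fixes_special:
  assumes s: "s \<in> H" "s x0 = x0" and n: "period_ok n"
  shows "s (special n) = special n"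
proof (cases "n = 0")
  case True then show ?thesis using s by simp
next
  case False
  define w where "w = u @ replicate (n - length u) a0"
  define P where "P = periodic_point w"
  have n': "n0 \<le> n" using n False by (auto simp: period_ok_def)
  have w: "length w = n" using n0 n' by (simp add: w_def)
  have "s \<in> stabilizer HH (\<lambda>h. h) x0" using s by (simp add: stabilizer_def)
  then have "word_act s w = w" using stab[OF n'] by (auto simp: stabilizer_def w_def)
  then have sP: "s P (int i) = w ! i" if "i < n" for i
    using that w unfolding word_act_def P_def by (metis (no_types, lifting) add.left_neutral diff_zero length_upt nth_map nth_upt)
  have Pc: "P \<in> configs \<Sigma>"
  proof -
    have "set w \<subseteq> \<Sigma>" using u a0 by (auto simp: w_def)
    moreover have "w ! nat (i mod int n) \<in> set w" for i
      using False w by (intro nth_mem) (simp add: nat_less_iff)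
    ultimately show ?thesis using w by (auto simp: configs_iff P_def periodic_point_def)
  qed
  have per: "s P (i + t * int n) = s P i" for i t
  proof -
    have "(\<lambda>i. P (i + t * int n)) = P" using w by (auto simp: P_def periodic_point_def)
    then show ?thesis using H_translate[OF s(1) Pc, of "t * int n"] by (metis)
  qed
  have "s P i = P i" for i
  proof -
    define m where "m = nat (i mod int n)"
    have m: "int m = i mod int n" "m < n" using False by (auto simp: m_def nat_less_iff)
    have "i = int m + (i div int n) * int n" using m by simp
    then have "s P i = s P (int m)" using per by metis
    also have "\<dots> = w ! m" by (rule sP[OF m(2)])
    also have "\<dots> = P i" using w by (simp add: P_def periodic_point_def m_def)
    finally show ?thesis .
  qed
  then have "s P = P" by blast
  then show ?thesis using H_translate[OF s(1) Pc, of "- k"] False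
    by (simp add: special_def P_def[symmetric] w_def[symmetric])
qed

text \<open>
The version of period \<open>n\<close> of a point of the orbit.
\<close>
definition wrapped :: "nat \<Rightarrow> (int \<Rightarrow> 'a) \<Rightarrow> int \<Rightarrow> 'a" where
  "wrapped n \<omega> = (SOME h. h \<in> H \<and> h x0 = \<omega>) (special n)"

text \<open>
Two elements that agree on the special point differ by an element of its stabilizer, which
fixes the periodic versions as well. So the choice in the definition is irrelevant.
\<close>
lemma wrapped_eq:
  assumes "h \<in> H" "period_ok n"
  shows "wrapped n (h x0) = h (special n)"
proof -
  define g where "g = (SOME g. g \<in> H \<and> g x0 = h x0)"
  have g: "g \<in> H" "g x0 = h x0" using someI[of "\<lambda>g. g \<in> H \<and> g x0 = h x0" h] assms by (auto simp: g_def)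
  have x0: "x0 \<in> configs \<Sigma>" using special_configs[of 0] by (simp add: period_ok_def)
  define s where "s = compose (configs \<Sigma>) (inv\<^bsub>HH\<^esub> h) g"
  have "s \<in> H" unfolding s_def using H_compose H_inv_closed assms g by blast
  moreover have "s x0 = x0" using x0 g H_inv(1)[OF assms(1) x0] by (simp add: s_def compose_def)
  ultimately have "s (special n) = special n" using stabilizer_fixes_special assms(2) by blast
  then have "(inv\<^bsub>HH\<^esub> h) (g (special n)) = special n" using special_configs[OF assms(2)] by (simp add: s_def compose_def)
  then have "g (special n) = h (special n)"
    using H_inv(2)[OF assms(1) H_configs[OF g(1) special_configs[OF assms(2)]]] by simp
  then show ?thesis by (simp add: wrapped_def g_def)
qed

lemma orbit_iff: "\<omega> \<in> \<Omega> \<longleftrightarrow> (\<exists>h\<in>H. \<omega> = h x0)"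
  by (auto simp: orbit_def)

lemma x0_configs: "x0 \<in> configs \<Sigma>"
  using special_configs[of 0] by (simp add: period_ok_def)

lemma orbit_configs: "\<omega> \<in> \<Omega> \<Longrightarrow> \<omega> \<in> configs \<Sigma>"
  using H_configs x0_configs by (auto simp: orbit_iff)

lemma orbit_closed: "h \<in> H \<Longrightarrow> \<omega> \<in> \<Omega> \<Longrightarrow> h \<omega> \<in> \<Omega>"
  unfolding orbit_iff using H_compose x0_configs by (auto simp: compose_def intro!: bexI[of _ "compose (configs \<Sigma>) h _"])

lemma wrapped_0: "\<omega> \<in> \<Omega> \<Longrightarrow> wrapped 0 \<omega> = \<omega>"
  using wrapped_eq[of _ 0] by (auto simp: orbit_iff period_ok_def)

lemma wrapped_configs: "\<omega> \<in> \<Omega> \<Longrightarrow> period_ok n \<Longrightarrow> wrapped n \<omega> \<in> configs \<Sigma>"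
  using wrapped_eq H_configs special_configs by (auto simp: orbit_iff)

lemma wrapped_equivariant:
  assumes "h \<in> H" "\<omega> \<in> \<Omega>" "period_ok n"
  shows "wrapped n (h \<omega>) = h (wrapped n \<omega>)"
proof -
  obtain g where g: "g \<in> H" "\<omega> = g x0" using assms(2) by (auto simp: orbit_iff)
  have "h \<omega> = compose (configs \<Sigma>) h g x0" using g x0_configs by (simp add: compose_def)
  then show ?thesis
    using wrapped_eq[OF H_compose[OF assms(1) g(1)] assms(3)] wrapped_eq[OF g(1) assms(3)] g special_configs[OF assms(3)]
    by (simp add: compose_def)
qed

text \<open>
A nonblank letter of the image comes from a nonblank letter of the special point within the radius
from \<open>H_zero_radius\<close>; the bound does not depend on the period.
\<close>
lemma wrapped_support:
  assumes "\<omega> \<in> \<Omega>"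
  obtains K :: nat where "\<And>n i. period_ok n \<Longrightarrow> (\<And>t. int K \<le> \<bar>i + t * int n\<bar>) \<Longrightarrow> wrapped n \<omega> i = a0"
proof -
  obtain h where h: "h \<in> H" "\<omega> = h x0" using assms by (auto simp: orbit_iff)
  obtain r where r: "\<And>x j. x \<in> configs \<Sigma> \<Longrightarrow> (\<And>i. \<bar>i - j\<bar> \<le> int r \<Longrightarrow> x i = a0) \<Longrightarrow> h x j = a0"
    using H_zero_radius[OF h(1)] by blast
  define K where "K = r + nat \<bar>k\<bar> + length u"
  have "wrapped n \<omega> i = a0" if n: "period_ok n" and K: "\<And>t. int K \<le> \<bar>i + t * int n\<bar>" for n i
  proof -
    have "special n j = a0" if j: "\<bar>j - i\<bar> \<le> int r" for j
    proof (rule special_zero[OF n])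
      fix t show "\<bar>k\<bar> + int (length u) \<le> \<bar>j + t * int n\<bar>" using K[of t] j by (auto simp: K_def)
    qed
    then show ?thesis using r[OF special_configs[OF n]] wrapped_eq[OF h(1) n] h by simp
  qed
  then show ?thesis by (rule that)
qed

lemma wrapped_limit:
  assumes "\<omega> \<in> \<Omega>"
  obtains N where "\<And>n. N \<le> n \<Longrightarrow> period_ok n \<Longrightarrow> wrapped n \<omega> i = \<omega> i"
proof -
  obtain h where h: "h \<in> H" "\<omega> = h x0" using assms by (auto simp: orbit_iff)
  obtain r :: nat where r: "\<And>x'. x' \<in> configs \<Sigma> \<Longrightarrow> (\<And>i. \<bar>i\<bar> \<le> int r \<Longrightarrow> x' i = x0 i) \<Longrightarrow> h x' i = h x0 i"
    using H_window[OF h(1) x0_configs, of i] by blast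
  have "wrapped n \<omega> i = \<omega> i" if "nat (int r + \<bar>k\<bar> + int (length u) + 1) \<le> n" "period_ok n" for n
  proof -
    have "int n \<ge> int r + \<bar>k\<bar> + int (length u) + 1" using that by linarith
    then show ?thesis
      using r[OF special_configs[OF that(2)]] special_limit wrapped_eq[OF h(1) that(2)] h by simp
  qed
  then show ?thesis by (rule that)
qed

end

section \<open>Lamps and moving tapes\<close>

text \<open>
Marks take values in \<open>M\<close>. The group \<open>A\<close> acts on \<open>M\<close>, and each \<open>rot c\<close> is a homomorphism from \<open>A\<close> to the
integers that is constant on the orbits of this action, so that it is not affected when a mark changes.
\<close>
locale lamps = pointed_automorphisms \<Sigma> a0 H u k n0 + A: comm_group A
  for \<Sigma> :: "'a set" and a0 H u k n0 and A :: "('b, 'p) monoid_scheme" +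
  fixes M :: "'c set" and act :: "'b \<Rightarrow> 'c \<Rightarrow> 'c" and rot :: "'c \<Rightarrow> 'b \<Rightarrow> int"
  assumes finite_marks: "finite M"
    and act_closed: "\<And>a c. a \<in> carrier A \<Longrightarrow> c \<in> M \<Longrightarrow> act a c \<in> M"
    and act_mult: "\<And>a a' c. a \<in> carrier A \<Longrightarrow> a' \<in> carrier A \<Longrightarrow> c \<in> M \<Longrightarrow> act (a \<otimes>\<^bsub>A\<^esub> a') c = act a (act a' c)"
    and act_one: "\<And>c. c \<in> M \<Longrightarrow> act \<one>\<^bsub>A\<^esub> c = c"
    and rot_mult: "\<And>a a' c. a \<in> carrier A \<Longrightarrow> a' \<in> carrier A \<Longrightarrow> rot c (a \<otimes>\<^bsub>A\<^esub> a') = rot c a + rot c a'"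
    and rot_act: "\<And>a c. rot (act a c) = rot c"
begin

abbreviation "letters \<equiv> \<Sigma> \<times> insert None (Some ` M)"

sublocale belts "(a0, None)" "letters"
  by unfold_locales (use a0 finite_alphabet finite_marks in auto)

definition tape :: "(int \<Rightarrow> bool) \<Rightarrow> (int \<times> bool \<Rightarrow> 'a \<times> 'c option) \<Rightarrow> int \<times> bool \<Rightarrow> int \<Rightarrow> 'a" where
  "tape W l p = (\<lambda>i. fst (l (walk W i p)))"

definition simulate :: "((int \<Rightarrow> 'a) \<Rightarrow> int \<Rightarrow> 'a) \<Rightarrow> (int \<Rightarrow> bool) \<Rightarrow> (bool \<Rightarrow> int \<Rightarrow> bool) \<Rightarrow>
    (int \<times> bool \<Rightarrow> 'a \<times> 'c option) \<Rightarrow> int \<times> bool \<Rightarrow> 'a \<times> 'c option" where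
  "simulate h W C l = (\<lambda>p. (h (tape W l p) 0, snd (l p)))"

lemma tape_configs: "range l \<subseteq> letters \<Longrightarrow> tape W l p \<in> configs \<Sigma>"
  unfolding configs_iff tape_def by (metis SigmaD1 prod.collapse range_subsetD)

lemma tape_walk: "tape W l (walk W t p) = (\<lambda>i. tape W l p (i + t))"
  by (simp add: tape_def walk_add)

text \<open>
Walking along the belt is shifting the tape, so the automorphism is applied to all positions of the
belt consistently. This is why \<open>simulate\<close> is an action.
\<close>
lemma tape_simulate:
  assumes "h \<in> H" "range l \<subseteq> letters"
  shows "tape W (simulate h W C l) p = h (tape W l p)"
proof
  fix i
  have "tape W (simulate h W C l) p i = fst (simulate h W C l (walk W i p))"
    by (simp only: tape_def)
  also have "\<dots> = h (tape W l (walk W i p)) 0"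
    by (simp only: simulate_def fst_conv)
  also have "\<dots> = h (tape W l p) i"
    using H_translate[OF assms(1) tape_configs[OF assms(2)], of W p i] by (simp add: tape_walk)
  finally show "tape W (simulate h W C l) p i = h (tape W l p) i" .
qed

lemma simulate_range:
  assumes "h \<in> H" "range l \<subseteq> letters"
  shows "range (simulate h W C l) \<subseteq> letters"
proof -
  have "h (tape W l p) 0 \<in> \<Sigma>" for p
    using H_configs[OF assms(1) tape_configs[OF assms(2)], of W p] by (simp add: configs_iff)
  moreover have "snd (l p) \<in> insert None (Some ` M)" for p
    using assms(2) by (metis SigmaD2 prod.collapse range_subsetD)
  ultimately show ?thesis by (auto simp: simulate_def image_subset_iff)
qed

lemma simulate_compose:
  assumes "g \<in> H" "h \<in> H" "range l \<subseteq> letters"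
  shows "simulate g W C (simulate h W C l) = simulate (compose (configs \<Sigma>) g h) W C l"
proof -
  have "snd (simulate h W C l p) = snd (l p)" for p by (simp only: simulate_def snd_conv)
  then show ?thesis
    unfolding simulate_def[of g] simulate_def[of "compose (configs \<Sigma>) g h"]
    using tape_configs[OF assms(3)] tape_simulate[OF assms(2,3)] by (simp add: compose_def)
qed

lemma simulate_id:
  assumes "range l \<subseteq> letters"
  shows "simulate (\<lambda>x\<in>configs \<Sigma>. x) W C l = l"
  using tape_configs[OF assms] by (simp add: simulate_def tape_def)

lemma simulate_inverse:
  assumes "h \<in> H"
  shows "inverse_ops (simulate h) (simulate (inv\<^bsub>HH\<^esub> h))"
proof -
  note i = H_inv_closed[OF assms]
  have "compose (configs \<Sigma>) (inv\<^bsub>HH\<^esub> h) h = (\<lambda>x\<in>configs \<Sigma>. x)" "compose (configs \<Sigma>) h (inv\<^bsub>HH\<^esub> h) = (\<lambda>x\<in>configs \<Sigma>. x)"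
    using H_inv[OF assms] by (auto simp: compose_def restrict_def)
  then show ?thesis
    using simulate_compose[OF assms i] simulate_compose[OF i assms] simulate_id by (simp add: inverse_ops_def)
qed

lemma local_op_simulate:
  assumes h: "h \<in> H"
  shows "local_op (simulate h)"
  unfolding local_op_def
proof (intro conjI)
  show "\<forall>W C l. range l \<subseteq> letters \<longrightarrow> range (simulate h W C l) \<subseteq> letters"
    using simulate_range[OF h] by blast
  obtain r where r: "\<And>x j. x \<in> configs \<Sigma> \<Longrightarrow> (\<And>i. \<bar>i - j\<bar> \<le> int r \<Longrightarrow> x i = a0) \<Longrightarrow> h x j = a0"
    using H_zero_radius[OF h] by blast
  have "controls r W l (simulate h W C l)" if l: "range l \<subseteq> letters" for W C l
    unfolding controls_def
  proof (intro allI impI)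
    fix p assume b: "\<forall>i. \<bar>i\<bar> \<le> int r \<longrightarrow> blank_at l (fst (walk W i p))"
    have lb: "l (walk W i p) = (a0, None)" if "\<bar>i\<bar> \<le> int r" for i
      using b that unfolding blank_at_def by (metis prod.collapse)
    have "h (tape W l p) 0 = a0"
      using lb by (intro r tape_configs[OF l]) (simp add: tape_def)
    then show "simulate h W C l p = (a0, None)" using lb[of 0] by (simp add: simulate_def)
  qed
  then show "\<exists>r. \<forall>W C l. range l \<subseteq> letters \<longrightarrow> controls r W l (simulate h W C l)" by blast
  show "\<forall>W C l p. simulate h (\<lambda>j. W (j + 1)) (\<lambda>e j. C e (j + 1)) (l \<circ> right) p = simulate h W C l (right p)"
    by (simp add: simulate_def tape_def right_def walk_right[unfolded right_def])
  show "\<forall>x\<in>configs cells. \<forall>p. \<forall>\<^sub>F x' in near x. simulate h (wall x') (capped x') (label x') p =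
      simulate h (wall x) (capped x) (label x) p"
  proof (intro ballI allI)
    fix x p assume x: "x \<in> configs cells"
    let ?c = "\<lambda>x. tape (wall x) (label x) p"
    have c: "?c x' \<in> configs \<Sigma>" if "x' \<in> configs cells" for x'
      using tape_configs[OF range_label[OF that]] .
    obtain r :: nat where r: "\<And>z. z \<in> configs \<Sigma> \<Longrightarrow> (\<And>i. \<bar>i\<bar> \<le> int r \<Longrightarrow> z i = ?c x i) \<Longrightarrow> h z 0 = h (?c x) 0"
      using H_window[OF h c[OF x], of 0] by blast
    have "eventually (\<lambda>x'. ?c x' i = ?c x i) (near x)" for i
      using near_walk[of i p x] near_label[of "walk (wall x) i p" x] by eventually_elim (simp add: tape_def)
    then have "eventually (\<lambda>x'. \<forall>i\<in>{- int r..int r}. ?c x' i = ?c x i) (near x)"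
      by (intro eventually_ball_finite) auto
    then show "\<forall>\<^sub>F x' in near x. simulate h (wall x') (capped x') (label x') p =
      simulate h (wall x) (capped x) (label x) p"
      using near_label[of p x] eventually_in_configs[of cells x]
    proof eventually_elim
      case (elim x')
      have "h (?c x') 0 = h (?c x) 0" using elim by (intro r c) (auto simp: abs_le_iff)
      then show ?case using elim by (simp add: simulate_def)
    qed
  qed
qed

end

context lamps
begin

text \<open>
The last clause matters for belts without walls, where the walk from \<open>o'\<close> misses the other track, which is
required to be blank as well. All flags have to be true up to the ends, as otherwise blankness of the rest of the belt
could not be confirmed locally.
\<close>
definition lit :: "(int \<Rightarrow> bool) \<Rightarrow> (bool \<Rightarrow> int \<Rightarrow> bool) \<Rightarrow> (int \<times> bool \<Rightarrow> 'a \<times> 'c option) \<Rightarrow>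
    (int \<Rightarrow> 'a) \<Rightarrow> int \<times> bool \<Rightarrow> bool" where
  "lit W C l \<omega> o' \<longleftrightarrow> snd (l o') \<noteq> None \<and> (\<forall>e i. C e (fst (walk W i o'))) \<and> period_ok (period W o') \<and>
     tape W l o' = wrapped (period W o') \<omega> \<and> (\<forall>q. assoc W o' q \<longrightarrow> q \<noteq> o' \<longrightarrow> snd (l q) = None) \<and>
     ((\<exists>t. flip o' = walk W t o') \<or> (\<forall>i. fst (l (flip (walk W i o'))) = a0))"

definition lit_lamps where
  "lit_lamps y W C l p = {\<omega> \<in> \<Omega>. y \<omega> \<noteq> \<one>\<^bsub>A\<^esub> \<and> (\<exists>o'. assoc W p o' \<and> lit W C l \<omega> o')}"

definition lamp_value where
  "lamp_value y W C l p = finprod A y (lit_lamps y W C l p)"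

text \<open>
The value of the mark is chosen rather than its position, so that the definition commutes with the shift even
for belts with several marks.
\<close>
definition mark :: "(int \<Rightarrow> bool) \<Rightarrow> (int \<times> bool \<Rightarrow> 'a \<times> 'c option) \<Rightarrow> int \<times> bool \<Rightarrow> 'c" where
  "mark W l p = (SOME c. \<exists>o'. assoc W p o' \<and> snd (l o') = Some c)"

definition amount where
  "amount y W C l p = rot (mark W l p) (lamp_value y W C l p)"

definition act_letter :: "'b \<Rightarrow> 'a \<times> 'c option \<Rightarrow> 'a \<times> 'c option" where
  "act_letter a s = (fst s, map_option (act a) (snd s))"

definition switch where
  "switch y W C l = (\<lambda>p. act_letter (lamp_value y W C l p) (l (walk W (- amount y W C l p) p)))"

definition lampset where
  "lampset = carrier (sum_group \<Omega> (\<lambda>_. A))"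

lemma lampset_iff: "y \<in> lampset \<longleftrightarrow> y \<in> (\<Pi>\<^sub>E \<omega>\<in>\<Omega>. carrier A) \<and> finite {\<omega> \<in> \<Omega>. y \<omega> \<noteq> \<one>\<^bsub>A\<^esub>}"
  by (simp add: lampset_def carrier_sum_group)

lemma lampset_carrier: "y \<in> lampset \<Longrightarrow> \<omega> \<in> \<Omega> \<Longrightarrow> y \<omega> \<in> carrier A"
  by (auto simp: lampset_iff)

lemma lit_lamps_finite: "y \<in> lampset \<Longrightarrow> finite (lit_lamps y W C l p)"
  by (rule finite_subset[of _ "{\<omega> \<in> \<Omega>. y \<omega> \<noteq> \<one>\<^bsub>A\<^esub>}"]) (auto simp: lit_lamps_def lampset_iff)

lemma lit_lamps_Omega: "lit_lamps y W C l p \<subseteq> \<Omega>"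
  by (auto simp: lit_lamps_def)

lemma lamp_value_closed [simp]: "y \<in> lampset \<Longrightarrow> lamp_value y W C l p \<in> carrier A"
  unfolding lamp_value_def using lit_lamps_Omega lampset_carrier by (intro A.finprod_closed) blast

lemma rot_one [simp]: "rot c \<one>\<^bsub>A\<^esub> = 0"
  using rot_mult[of "\<one>\<^bsub>A\<^esub>" "\<one>\<^bsub>A\<^esub>" c] by simp

lemma
  assumes "assoc W p q"
  shows lit_lamps_assoc: "lit_lamps y W C l q = lit_lamps y W C l p"
    and lamp_value_assoc: "lamp_value y W C l q = lamp_value y W C l p"
    and mark_assoc: "mark W l q = mark W l p"
    and amount_assoc: "amount y W C l q = amount y W C l p"
  using assoc_cong[OF assms] by (simp_all add: lit_lamps_def lamp_value_def mark_def amount_def)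

lemma lit_unique:
  assumes "lit W C l \<omega> o'" "assoc W o' q" "snd (l q) \<noteq> None"
  shows "q = o'"
  using assms by (auto simp: lit_def simp del: split_paired_All)

lemma mark_lit:
  assumes "lit W C l \<omega> o'" "assoc W p o'"
  shows "snd (l o') = Some (mark W l p)"
proof -
  obtain c where c: "snd (l o') = Some c" using assms(1) by (auto simp: lit_def)
  have "\<exists>q. assoc W p q \<and> snd (l q) = Some (mark W l p)"
    unfolding mark_def by (rule someI[of _ c]) (use c assms(2) in blast)
  then obtain q where q: "assoc W p q" "snd (l q) = Some (mark W l p)" by blast
  then have "q = o'" using lit_unique[OF assms(1), of q] assms(2) assoc_cong by blast
  then show ?thesis using q by simp
qed

lemma act_letter_blank [simp]: "act_letter a (a0, None) = (a0, None)"
  by (simp add: act_letter_def)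

lemma fst_act_letter [simp]: "fst (act_letter a s) = fst s"
  and snd_act_letter: "snd (act_letter a s) = map_option (act a) (snd s)"
  by (simp_all add: act_letter_def)

lemma act_letter_one: "s \<in> letters \<Longrightarrow> act_letter \<one>\<^bsub>A\<^esub> s = s"
  by (auto simp: act_letter_def act_one)

lemma act_letter_mult:
  "s \<in> letters \<Longrightarrow> a \<in> carrier A \<Longrightarrow> a' \<in> carrier A \<Longrightarrow> act_letter a (act_letter a' s) = act_letter (a \<otimes>\<^bsub>A\<^esub> a') s"
  by (auto simp: act_letter_def act_mult)

lemma act_letter_closed: "s \<in> letters \<Longrightarrow> a \<in> carrier A \<Longrightarrow> act_letter a s \<in> letters"
  by (auto simp: act_letter_def act_closed)

lemma switch_range:
  assumes "y \<in> lampset" "range l \<subseteq> letters"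
  shows "range (switch y W C l) \<subseteq> letters"
proof -
  have "l q \<in> letters" for q using assms(2) by blast
  then have "switch y W C l p \<in> letters" for p
    unfolding switch_def using act_letter_closed lamp_value_closed[OF assms(1)] by blast
  then show ?thesis by blast
qed

text \<open>
Rotating all labels of a belt moves the origin and the tape together, so the same points are lit.
\<close>
lemma lit_rotate:
  assumes l': "\<And>q. assoc W o' q \<Longrightarrow> l' q = act_letter a (l (walk W (- m) q))"
  shows "lit W C l' \<omega> (walk W m o') \<longleftrightarrow> lit W C l \<omega> o'"
proof -
  have w: "walk W i (walk W m o') = walk W (i + m) o'" for i by (simp add: walk_add)
  have l'w: "l' (walk W i o') = act_letter a (l (walk W (i - m) o'))" for i
    using l'[of "walk W i o'"] walk_add[of W "- m" i o'] by simp
  have fw: "flip (walk W i o') = walk W (- i) (flip o')" for i by (simp add: walk_flip)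
  have l'f: "l' (flip (walk W i o')) = act_letter a (l (flip (walk W (i + m) o')))" for i
  proof -
    have "assoc W o' (flip (walk W i o'))" by (meson assoc_flip assoc_trans assoc_walk)
    moreover have "walk W (- (i + m)) (flip o') = walk W (- m) (walk W (- i) (flip o'))"
      using walk_add[of W "- m" "- i" "flip o'"] by (simp add: algebra_simps)
    ultimately show ?thesis using l' by (simp only: fw)
  qed
  have "(\<forall>e i. C e (fst (walk W i (walk W m o')))) = (\<forall>e i. C e (fst (walk W i o')))"
    unfolding w by (metis diff_add_cancel)
  moreover have "tape W l' (walk W m o') = tape W l o'"
    by (simp add: tape_def w l'w)
  moreover have "(\<forall>q. assoc W (walk W m o') q \<longrightarrow> q \<noteq> walk W m o' \<longrightarrow> snd (l' q) = None) \<longleftrightarrow>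
      (\<forall>q. assoc W o' q \<longrightarrow> q \<noteq> o' \<longrightarrow> snd (l q) = None)" (is "?L \<longleftrightarrow> ?R")
  proof
    assume L: ?L
    show ?R
    proof (intro allI impI)
      fix q assume q: "assoc W o' q" "q \<noteq> o'"
      have q': "assoc W o' (walk W m q)" using q(1) assoc_trans assoc_walk by blast
      then have "assoc W (walk W m o') (walk W m q)" using assoc_cong assoc_walk by blast
      moreover have "walk W m q \<noteq> walk W m o'" using q(2) by (metis walk_uminus(1))
      ultimately have "snd (l' (walk W m q)) = None" using L by blast
      then show "snd (l q) = None" using l'[OF q'] by (simp add: snd_act_letter)
    qed
  next
    assume R: ?R
    show ?L
    proof (intro allI impI)
      fix q assume q: "assoc W (walk W m o') q" "q \<noteq> walk W m o'"
      have q1: "assoc W o' q" using q(1) assoc_cong assoc_walk by blast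
      then have q': "assoc W o' (walk W (- m) q)" using assoc_trans assoc_walk by blast
      have "walk W (- m) q \<noteq> o'" using q(2) by (metis walk_uminus(2))
      then have "snd (l (walk W (- m) q)) = None" using R q' by blast
      then show "snd (l' q) = None" using l'[OF q1] by (simp add: snd_act_letter)
    qed
  qed
  moreover have "(\<exists>t. flip (walk W m o') = walk W t (walk W m o')) = (\<exists>t. flip o' = walk W t o')"
  proof -
    have "flip (walk W m o') = walk W t (walk W m o') \<longleftrightarrow> flip o' = walk W (t + 2 * m) o'" for t
      using walk_add[of W m "- m" "flip o'"] walk_add[of W m "t + m" o']
      by (simp add: w fw) (metis walk_uminus(1) walk_uminus(2) mult_2 add.assoc add.commute)
    then show ?thesis by (metis diff_add_cancel)
  qed
  moreover have "(\<forall>i. fst (l' (flip (walk W i (walk W m o')))) = a0) = (\<forall>i. fst (l (flip (walk W i o'))) = a0)"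
    unfolding w l'f fst_act_letter by (metis diff_add_cancel add.assoc)
  ultimately show ?thesis
    by (simp add: lit_def l'w snd_act_letter)
qed

context
  fixes y y' and W :: "int \<Rightarrow> bool" and C :: "bool \<Rightarrow> int \<Rightarrow> bool" and l :: "int \<times> bool \<Rightarrow> 'a \<times> 'c option"
  assumes y: "y \<in> lampset" and y': "y' \<in> lampset" and l: "range l \<subseteq> letters"
begin

lemma switch_rotates:
  assumes "assoc W p q"
  shows "switch y W C l q = act_letter (lamp_value y W C l p) (l (walk W (- amount y W C l p) q))"
  by (simp add: switch_def lamp_value_assoc[OF assms] amount_assoc[OF assms])

lemma lit_switch:
  assumes "assoc W p o'"
  shows "lit W C (switch y W C l) \<omega> (walk W (amount y W C l p) o') \<longleftrightarrow> lit W C l \<omega> o'"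
  by (rule lit_rotate[where a = "lamp_value y W C l p"]) (use assms switch_rotates assoc_trans in blast)

lemma lit_lamps_switch: "lit_lamps y' W C (switch y W C l) p = lit_lamps y' W C l p"
proof -
  have "(\<exists>o'. assoc W p o' \<and> lit W C (switch y W C l) \<omega> o') \<longleftrightarrow> (\<exists>o'. assoc W p o' \<and> lit W C l \<omega> o')" for \<omega>
  proof
    assume "\<exists>o'. assoc W p o' \<and> lit W C (switch y W C l) \<omega> o'"
    then obtain o' where o': "assoc W p o'" "lit W C (switch y W C l) \<omega> o'" by blast
    define q where "q = walk W (- amount y W C l p) o'"
    have "assoc W p q" using o'(1) assoc_trans assoc_walk unfolding q_def by blast
    moreover have "lit W C l \<omega> q" using lit_switch[OF calculation] o'(2) by (simp add: q_def)
    ultimately show "\<exists>o'. assoc W p o' \<and> lit W C l \<omega> o'" by blast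
  next
    assume "\<exists>o'. assoc W p o' \<and> lit W C l \<omega> o'"
    then show "\<exists>o'. assoc W p o' \<and> lit W C (switch y W C l) \<omega> o'"
      using lit_switch assoc_trans assoc_walk by blast
  qed
  then show ?thesis by (simp add: lit_lamps_def)
qed

lemma lamp_value_switch: "lamp_value y' W C (switch y W C l) p = lamp_value y' W C l p"
  by (simp add: lamp_value_def lit_lamps_switch)

lemma amount_trivial: "lit_lamps z W C l' p = {} \<Longrightarrow> lamp_value z W C l' p = \<one>\<^bsub>A\<^esub> \<and> amount z W C l' p = 0"
  by (simp add: amount_def lamp_value_def)

lemma amount_switch: "amount y' W C (switch y W C l) p = amount y' W C l p"
proof (cases "lit_lamps y' W C l p = {}")
  case True
  then show ?thesis using amount_trivial lit_lamps_switch by metis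
next
  case False
  then obtain \<omega> o' where o': "assoc W p o'" "lit W C l \<omega> o'" by (auto simp: lit_lamps_def)
  let ?o = "walk W (amount y W C l p) o'"
  have a: "assoc W p ?o" using o'(1) assoc_trans assoc_walk by blast
  have "Some (mark W (switch y W C l) p) = snd (switch y W C l ?o)"
    using mark_lit[OF _ a] lit_switch[OF o'(1)] o'(2) by metis
  also have "\<dots> = map_option (act (lamp_value y W C l p)) (snd (l o'))"
    by (simp add: switch_rotates[OF a] snd_act_letter)
  also have "\<dots> = Some (act (lamp_value y W C l p) (mark W l p))"
    using mark_lit[OF o'(2,1)] by simp
  finally show ?thesis by (simp add: amount_def lamp_value_switch rot_act)
qed

lemma lamp_value_mult:
  "lamp_value (\<lambda>\<omega>\<in>\<Omega>. y' \<omega> \<otimes>\<^bsub>A\<^esub> y \<omega>) W C l p = lamp_value y' W C l p \<otimes>\<^bsub>A\<^esub> lamp_value y W C l p"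
proof -
  let ?z = "\<lambda>\<omega>\<in>\<Omega>. y' \<omega> \<otimes>\<^bsub>A\<^esub> y \<omega>"
  define F where "F = lit_lamps y W C l p \<union> lit_lamps y' W C l p"
  have F: "finite F" "F \<subseteq> \<Omega>" using lit_lamps_finite y y' lit_lamps_Omega by (auto simp: F_def)
  have yF: "y \<in> F \<rightarrow> carrier A" "y' \<in> F \<rightarrow> carrier A" using F(2) lampset_carrier y y' by blast+
  have "lamp_value y W C l p = finprod A y F" unfolding lamp_value_def
    by (rule A.finprod_mono_neutral_cong_left) (use F yF in \<open>auto simp: F_def lit_lamps_def\<close>)
  moreover have "lamp_value y' W C l p = finprod A y' F" unfolding lamp_value_def
    by (rule A.finprod_mono_neutral_cong_left) (use F yF in \<open>auto simp: F_def lit_lamps_def\<close>)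
  moreover have "lamp_value ?z W C l p = finprod A (\<lambda>\<omega>. y' \<omega> \<otimes>\<^bsub>A\<^esub> y \<omega>) F" unfolding lamp_value_def
  proof (rule A.finprod_mono_neutral_cong_left)
    show "lit_lamps ?z W C l p \<subseteq> F" by (auto simp: F_def lit_lamps_def)
    show "y' \<omega> \<otimes>\<^bsub>A\<^esub> y \<omega> = \<one>\<^bsub>A\<^esub>" if "\<omega> \<in> F - lit_lamps ?z W C l p" for \<omega>
      using that F(2) by (auto simp: F_def lit_lamps_def)
    show "?z \<omega> = y' \<omega> \<otimes>\<^bsub>A\<^esub> y \<omega>" if "\<omega> \<in> lit_lamps ?z W C l p" for \<omega>
      using subsetD[OF lit_lamps_Omega that] by simp
  qed (use F yF in auto)
  ultimately show ?thesis using A.finprod_multf yF by auto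
qed

text \<open>
After switching, the same lamps are lit, and the mark has changed only within its orbit. So the second
switch uses the same values as it would have used before the first one, and the effects add up.
\<close>
lemma switch_switch: "switch y' W C (switch y W C l) = switch (\<lambda>\<omega>\<in>\<Omega>. y' \<omega> \<otimes>\<^bsub>A\<^esub> y \<omega>) W C l"
proof
  fix p
  define v v' m m' where "v = lamp_value y W C l p" and "v' = lamp_value y' W C l p"
    and "m = amount y W C l p" and "m' = amount y' W C l p"
  note d = v_def m_def v'_def m'_def
  have "switch y' W C (switch y W C l) p = act_letter v' (switch y W C l (walk W (- m') p))"
    by (simp add: switch_def[of y'] lamp_value_switch amount_switch d)
  also have "\<dots> = act_letter v' (act_letter v (l (walk W (- m) (walk W (- m') p))))"
    using switch_rotates[OF assoc_walk[of W p]] by (simp add: d)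
  also have "\<dots> = act_letter (v' \<otimes>\<^bsub>A\<^esub> v) (l (walk W (- (m' + m)) p))"
  proof -
    have "l q \<in> letters" for q using l by blast
    then show ?thesis
      using act_letter_mult[of _ v' v] y y' walk_add[of W "- m" "- m'" p] by (simp add: d add.commute)
  qed
  also have "\<dots> = switch (\<lambda>\<omega>\<in>\<Omega>. y' \<omega> \<otimes>\<^bsub>A\<^esub> y \<omega>) W C l p"
    using rot_mult[of v' v] y y' by (simp add: switch_def amount_def lamp_value_mult d)
  finally show "switch y' W C (switch y W C l) p = switch (\<lambda>\<omega>\<in>\<Omega>. y' \<omega> \<otimes>\<^bsub>A\<^esub> y \<omega>) W C l p" .
qed

end

lemma switch_one:
  assumes "range l \<subseteq> letters"
  shows "switch (\<lambda>\<omega>\<in>\<Omega>. \<one>\<^bsub>A\<^esub>) W C l = l"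
proof
  fix p
  have "lit_lamps (\<lambda>\<omega>\<in>\<Omega>. \<one>\<^bsub>A\<^esub>) W C l p = {}" by (auto simp: lit_lamps_def)
  then have "lamp_value (\<lambda>\<omega>\<in>\<Omega>. \<one>\<^bsub>A\<^esub>) W C l p = \<one>\<^bsub>A\<^esub>" "amount (\<lambda>\<omega>\<in>\<Omega>. \<one>\<^bsub>A\<^esub>) W C l p = 0"
    by (simp_all add: lamp_value_def amount_def)
  moreover have "l p \<in> letters" using assms by blast
  ultimately show "switch (\<lambda>\<omega>\<in>\<Omega>. \<one>\<^bsub>A\<^esub>) W C l p = l p"
    by (simp add: switch_def act_letter_one)
qed

text \<open>
Applying \<open>h\<close> to all tapes turns the lamp \<open>\<omega>\<close> into the lamp \<open>h \<omega>\<close>: automorphisms are injective, and \<open>wrapped\<close>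
is equivariant.
\<close>
lemma lit_simulate:
  assumes h: "h \<in> H" and \<omega>: "\<omega> \<in> \<Omega>" and l: "range l \<subseteq> letters"
  shows "lit W C (simulate h W C l) (h \<omega>) o' \<longleftrightarrow> lit W C l \<omega> o'"
proof -
  have s: "snd (simulate h W C l q) = snd (l q)" for q by (simp only: simulate_def snd_conv)
  have inj: "h z = h z' \<longleftrightarrow> z = z'" if "z \<in> configs \<Sigma>" "z' \<in> configs \<Sigma>" for z z'
    using H_inv(1)[OF h] that by metis
  have "tape W (simulate h W C l) o' = wrapped (period W o') (h \<omega>) \<longleftrightarrow> tape W l o' = wrapped (period W o') \<omega>"
    if "period_ok (period W o')"
    using that inj tape_configs[OF l] wrapped_configs[OF \<omega> that] wrapped_equivariant[OF h \<omega> that] tape_simulate[OF h l]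
    by simp
  moreover have "(\<forall>i. fst (l (flip (walk W i o'))) = a0) \<longleftrightarrow> tape W l (flip o') = (\<lambda>_. a0)" for l
    by (auto simp: tape_def fun_eq_iff walk_flip) (metis minus_minus)
  moreover have "tape W (simulate h W C l) (flip o') = (\<lambda>_. a0) \<longleftrightarrow> tape W l (flip o') = (\<lambda>_. a0)"
    using inj[OF tape_configs[OF l] zero_configs] H_fixes_zero[OF h] tape_simulate[OF h l] by simp
  ultimately show ?thesis unfolding lit_def s by blast
qed

lemma orbit_inv:
  assumes "h \<in> H" "\<omega> \<in> \<Omega>"
  shows "(inv\<^bsub>HH\<^esub> h) (h \<omega>) = \<omega>" "h ((inv\<^bsub>HH\<^esub> h) \<omega>) = \<omega>" "(inv\<^bsub>HH\<^esub> h) \<omega> \<in> \<Omega>"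
  using H_inv[OF assms(1) orbit_configs[OF assms(2)]] orbit_closed[OF H_inv_closed[OF assms(1)] assms(2)] by auto

text \<open>
The relation of the wreath product: conjugating with \<open>h\<close> moves the lamp configuration by \<open>h\<close>.
\<close>
lemma switch_simulate:
  assumes h: "h \<in> H" and y: "y \<in> lampset" and l: "range l \<subseteq> letters"
  shows "switch (\<lambda>\<omega>\<in>\<Omega>. y ((inv\<^bsub>HH\<^esub> h) \<omega>)) W C (simulate h W C l) = simulate h W C (switch y W C l)"
proof
  fix p
  let ?y = "\<lambda>\<omega>\<in>\<Omega>. y ((inv\<^bsub>HH\<^esub> h) \<omega>)" and ?l = "simulate h W C l"
  have s: "snd (simulate h W C l q) = snd (l q)" for q by (simp only: simulate_def snd_conv)
  have "lit_lamps ?y W C ?l p = h ` lit_lamps y W C l p"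
  proof
    show "h ` lit_lamps y W C l p \<subseteq> lit_lamps ?y W C ?l p"
      using lit_simulate[OF h _ l] orbit_closed[OF h] orbit_inv[OF h] by (fastforce simp: lit_lamps_def)
    show "lit_lamps ?y W C ?l p \<subseteq> h ` lit_lamps y W C l p"
    proof
      fix \<omega> assume w: "\<omega> \<in> lit_lamps ?y W C ?l p"
      then have "\<omega> \<in> \<Omega>" by (simp add: lit_lamps_def)
      note o = orbit_inv[OF h this]
      have "(inv\<^bsub>HH\<^esub> h) \<omega> \<in> lit_lamps y W C l p"
        using w lit_simulate[OF h o(3) l] o by (auto simp: lit_lamps_def)
      then show "\<omega> \<in> h ` lit_lamps y W C l p" using o(2) by (metis imageI)
    qed
  qed
  moreover have yh: "?y (h \<omega>) = y \<omega>" "y \<omega> \<in> carrier A" if "\<omega> \<in> lit_lamps y W C l p" for \<omega>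
  proof -
    have "\<omega> \<in> \<Omega>" using that lit_lamps_Omega by (rule subsetD[rotated])
    then show "?y (h \<omega>) = y \<omega>" "y \<omega> \<in> carrier A"
      using orbit_inv(1)[OF h] orbit_closed[OF h] lampset_carrier[OF y] by simp_all
  qed
  have "finprod A ?y (h ` lit_lamps y W C l p) = finprod A (\<lambda>\<omega>. ?y (h \<omega>)) (lit_lamps y W C l p)"
  proof (rule A.finprod_reindex)
    show "inj_on h (lit_lamps y W C l p)"
      by (rule inj_on_inverseI[of _ "inv\<^bsub>HH\<^esub> h"]) (rule orbit_inv(1)[OF h subsetD[OF lit_lamps_Omega]])
    show "?y \<in> h ` lit_lamps y W C l p \<rightarrow> carrier A"
    proof
      fix z assume "z \<in> h ` lit_lamps y W C l p"
      then obtain \<omega> where "z = h \<omega>" "\<omega> \<in> lit_lamps y W C l p" by blast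
      then show "?y z \<in> carrier A" using yh by (simp only:)
    qed
  qed
  moreover have "finprod A (\<lambda>\<omega>. ?y (h \<omega>)) (lit_lamps y W C l p) = finprod A y (lit_lamps y W C l p)"
    by (rule A.finprod_cong'[OF refl]) (use yh in \<open>simp_all only: Pi_iff\<close>, blast)
  ultimately have v: "lamp_value ?y W C ?l p = lamp_value y W C l p" by (simp add: lamp_value_def)
  then have m: "amount ?y W C ?l p = amount y W C l p" by (simp add: amount_def mark_def s)
  define a t where "a = lamp_value y W C l p" and "t = - amount y W C l p"
  have "tape W (switch y W C l) p = tape W l (walk W t p)"
  proof
    fix i
    have "tape W (switch y W C l) p i = fst (l (walk W t (walk W i p)))"
      unfolding tape_def using switch_rotates[OF y y l assoc_walk[of W p i]] by (simp add: t_def)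
    then show "tape W (switch y W C l) p i = tape W l (walk W t p) i"
      using walk_add[of W i t p] walk_add[of W t i p] by (simp add: tape_def add.commute)
  qed
  then show "switch ?y W C ?l p = simulate h W C (switch y W C l) p"
    unfolding switch_def[of ?y] v m simulate_def[of h W C "switch y W C l"]
    by (simp add: act_letter_def simulate_def[of h W C l] t_def[symmetric] a_def[symmetric])
       (simp add: switch_def act_letter_def t_def a_def)
qed

end

section \<open>Lit lamps are visible locally\<close>

lemma walk_straight:
  assumes "clear W e j n"
  shows "walk W (int n) (j, e) = (j + dir e * int n, e)"
  using assms
proof (induction n)
  case (Suc n)
  have "\<not> W (j + dir e * int n)" "\<not> W (j + dir e * int n + dir e)"
    using Suc.prems[unfolded clear_def, rule_format, of n] Suc.prems[unfolded clear_def, rule_format, of "Suc n"]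
    by (simp_all add: algebra_simps)
  then show ?case
    using Suc.IH[OF clear_mono[OF Suc.prems]] walk_step[of W "int n" "(j, e)"]
    by (simp add: step_def algebra_simps)
qed simp

lemma clear_assoc:
  assumes "clear W e (fst p) n"
  shows "assoc W p (fst p + dir e * int n, s)"
proof -
  have "assoc W p (fst p, e)"
  proof -
    have "(fst p, e) = p \<or> (fst p, e) = flip p" by (cases p) (auto simp: flip_def)
    then show ?thesis using assoc_refl assoc_flip by metis
  qed
  moreover have "assoc W (fst p, e) (fst p + dir e * int n, e)"
    using assoc_walk[of W "(fst p, e)" "int n"] walk_straight[OF assms] by simp
  moreover have "assoc W (fst p + dir e * int n, e) (fst p + dir e * int n, s)"
    using assoc_refl[of W] assoc_flip[of W "(fst p + dir e * int n, e)"] by (cases "s = e") (auto simp: flip_def)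
  ultimately show ?thesis using assoc_trans by blast
qed

lemma assoc_column:
  assumes "assoc W p q" "\<not> W (fst p)"
  obtains e n where "clear W e (fst p) n" "fst q = fst p + dir e * int n"
proof -
  let ?P = "\<lambda>c. \<exists>e n. clear W e (fst p) n \<and> c = fst p + dir e * int n"
  have step: "?P (fst (step W q))" if P: "?P (fst q)" for q
  proof -
    obtain e n where en: "clear W e (fst p) n" "fst q = fst p + dir e * int n" using P by blast
    show ?thesis
    proof (cases "n = 0")
      case False
      then show ?thesis using step_in_ray[OF en] by blast
    next
      case True
      show ?thesis
      proof (cases "fst (step W q) = fst q")
        case False
        then have "fst (step W q) = fst p + dir (snd q)" "\<not> W (fst p + dir (snd q))"
          using en True by (auto simp: step_def split: if_splits)
        then have "clear W (snd q) (fst p) 1" "fst (step W q) = fst p + dir (snd q) * int 1"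
          using assms(2) by (auto simp: clear_def le_Suc_eq)
        then show ?thesis by blast
      qed (use P in simp)
    qed
  qed
  have "?P (fst p)" using assms(2) by (intro exI[of _ 0] exI) (simp add: clear_def)
  then have "?P (fst (walk W i p))" for i by (rule fst_walk_induct) (rule step)
  then have "?P (fst q)" using assms(1) unfolding assoc_def by (metis fst_flip)
  then show ?thesis using that by blast
qed

lemma period_eqI:
  assumes "\<And>i. 0 < i \<Longrightarrow> i < N \<Longrightarrow> walk W' (int i) p = p \<longleftrightarrow> walk W (int i) p = p"
    and "0 < period W p" "period W p < N"
  shows "period W' p = period W p"
proof -
  have "walk W' (int (period W p)) p = p" using assms by simp
  then have d: "period W' p dvd period W p" by (simp add: walk_fixes_iff)
  then have "0 < period W' p" "period W' p < N" using assms(2,3) by (auto dest: dvd_imp_le intro: gr0I)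
  then have "walk W (int (period W' p)) p = p" using assms(1) walk_period[of W' p] by blast
  then have "period W p dvd period W' p" by (simp add: walk_fixes_iff)
  then show ?thesis using d by (rule dvd_antisym[rotated])
qed

text \<open>
Periods of at least \<open>N\<close> cannot be seen in a bounded window; there they are treated as infinite.
\<close>
definition truncate :: "nat \<Rightarrow> nat \<Rightarrow> nat" where
  "truncate N n = (if N \<le> n then 0 else n)"

lemma truncate_period:
  assumes "\<And>i. 0 < i \<Longrightarrow> i < N \<Longrightarrow> walk W' (int i) p = p \<longleftrightarrow> walk W (int i) p = p"
  shows "truncate N (period W' p) = truncate N (period W p)"
proof -
  have 0: "truncate N n = 0" if "\<not> (0 < n \<and> n < N)" for n using that by (auto simp: truncate_def)
  show ?thesis
  proof (cases "0 < period W p \<and> period W p < N")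
    case True
    then have "period W' p = period W p" by (intro period_eqI[of N]) (simp_all only: assms)
    then show ?thesis by simp
  next
    case False
    have "\<not> (0 < period W' p \<and> period W' p < N)"
    proof
      assume "0 < period W' p \<and> period W' p < N"
      moreover from this have "period W p = period W' p" by (intro period_eqI[of N]) (simp_all only: assms)
      ultimately show False using False by simp
    qed
    then show ?thesis using 0 False by metis
  qed
qed

context lamps
begin

lemma special_dvd:
  assumes "period_ok n" "int n dvd d"
  shows "special n (i + d) = special n i"
proof (cases "n = 0")
  case False
  have l: "length u \<le> n" using assms n0 False by (auto simp: period_ok_def)
  have "(i + d - k) mod int n = (i - k + d) mod int n" by (simp add: algebra_simps)
  also have "\<dots> = (i - k) mod int n" using assms(2) by (metis add.right_neutral dvd_imp_mod_0 mod_add_right_eq)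
  finally show ?thesis using special_periodic[OF False l] by simp
qed (use assms in simp)

lemma wrapped_dvd:
  assumes "\<omega> \<in> \<Omega>" "period_ok n" "int n dvd d"
  shows "wrapped n \<omega> (i + d) = wrapped n \<omega> i"
proof -
  obtain h where h: "h \<in> H" "\<omega> = h x0" using assms by (auto simp: orbit_iff)
  have "(\<lambda>i. special n (i + d)) = special n" using special_dvd[OF assms(2,3)] by blast
  then have "(\<lambda>i. h (special n) (i + d)) = h (special n)"
    using H_translate[OF h(1) special_configs[OF assms(2)], of d] by simp
  then show ?thesis using wrapped_eq[OF h(1) assms(2)] h by (metis)
qed

lemma common_support:
  assumes "finite S" "S \<subseteq> \<Omega>"
  obtains K :: nat where "\<And>\<omega> n i. \<omega> \<in> S \<Longrightarrow> period_ok n \<Longrightarrow> (\<And>t. int K \<le> \<bar>i + t * int n\<bar>) \<Longrightarrow> wrapped n \<omega> i = a0"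
proof -
  have "\<exists>K::nat. \<forall>\<omega>\<in>S. \<forall>n i. period_ok n \<longrightarrow> (\<forall>t. int K \<le> \<bar>i + t * int n\<bar>) \<longrightarrow> wrapped n \<omega> i = a0"
    using assms
  proof (induction S)
    case (insert \<omega> S)
    then obtain K where K: "\<forall>\<omega>\<in>S. \<forall>n i. period_ok n \<longrightarrow> (\<forall>t. int K \<le> \<bar>i + t * int n\<bar>) \<longrightarrow> wrapped n \<omega> i = a0" by auto
    have "\<omega> \<in> \<Omega>" using insert by blast
    then obtain K' where K': "\<And>n i. period_ok n \<Longrightarrow> (\<And>t. int K' \<le> \<bar>i + t * int n\<bar>) \<Longrightarrow> wrapped n \<omega> i = a0"
      using wrapped_support by blast
    have "int (max K K') \<le> z \<longleftrightarrow> int K \<le> z \<and> int K' \<le> z" for z by auto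
    then show ?case using K K' by (intro exI[of _ "max K K'"]) auto
  qed simp
  then show ?thesis using that by blast
qed

lemma common_limit:
  assumes "finite S" "S \<subseteq> \<Omega>"
  obtains N where "n0 \<le> N" "\<And>\<omega> n i. \<omega> \<in> S \<Longrightarrow> \<bar>i\<bar> \<le> int K \<Longrightarrow> N \<le> n \<Longrightarrow> period_ok n \<Longrightarrow> wrapped n \<omega> i = \<omega> i"
proof -
  have "\<exists>N. \<forall>n. N \<le> n \<longrightarrow> period_ok n \<longrightarrow> wrapped n (fst z) (snd z) = fst z (snd z)" if "z \<in> S \<times> {- int K..int K}" for z
    using that assms(2) wrapped_limit[of "fst z" "snd z"] by (metis SigmaE2 prod.collapse subsetD)
  then obtain f where f: "\<And>z n. z \<in> S \<times> {- int K..int K} \<Longrightarrow> f z \<le> n \<Longrightarrow> period_ok n \<Longrightarrow> wrapped n (fst z) (snd z) = fst z (snd z)"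
    by metis
  define N where "N = Max (insert n0 (f ` (S \<times> {- int K..int K})))"
  have fin: "finite (insert n0 (f ` (S \<times> {- int K..int K})))" using assms by simp
  then have "n0 \<le> N" unfolding N_def by (rule Max_ge) simp
  moreover have "wrapped n \<omega> i = \<omega> i" if "\<omega> \<in> S" "\<bar>i\<bar> \<le> int K" "N \<le> n" "period_ok n" for \<omega> n i
  proof -
    have z: "(\<omega>, i) \<in> S \<times> {- int K..int K}" using that by auto
    then have "f (\<omega>, i) \<le> N" unfolding N_def by (intro Max_ge[OF fin]) blast
    then show ?thesis using f[OF z] that by simp
  qed
  ultimately show ?thesis by (rule that)
qed

text \<open>
A letter of the tape away from the origin is read at several times that differ by multiples of the
period. It is blank if all of these are far from zero.
\<close>
lemma lit_far:
  assumes f: "lit W C l \<omega> p" and q: "assoc W p q" "\<And>i. \<bar>i\<bar> \<le> int K \<Longrightarrow> q \<noteq> walk W i p"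
    and K: "\<And>n i. period_ok n \<Longrightarrow> (\<And>t. int K \<le> \<bar>i + t * int n\<bar>) \<Longrightarrow> wrapped n \<omega> i = a0"
  shows "fst (l q) = a0"
proof -
  have on: "fst (l q) = a0" if "q = walk W i p" for i
  proof -
    have "int K \<le> \<bar>i + t * int (period W p)\<bar>" for t
      using q(2)[of "i + t * int (period W p)"] that walk_add_period[of W i t p] by force
    then have "wrapped (period W p) \<omega> i = a0" using f K by (simp add: lit_def)
    moreover have "tape W l p i = wrapped (period W p) \<omega> i" using f by (simp add: lit_def)
    ultimately show ?thesis using that by (simp add: tape_def)
  qed
  obtain i where i: "q = walk W i p \<or> q = flip (walk W i p)" using q(1) by (auto simp: assoc_def)
  then show ?thesis
  proof
    assume fl: "q = flip (walk W i p)"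
    have "(\<exists>t. flip p = walk W t p) \<or> (\<forall>i. fst (l (flip (walk W i p))) = a0)" using f by (simp add: lit_def)
    then show ?thesis
    proof
      assume "\<exists>t. flip p = walk W t p"
      then obtain t where "flip p = walk W t p" by blast
      then have "q = walk W (- i + t) p" using fl walk_flip[of W "- i" p] walk_add[of W "- i" t p] by simp
      then show ?thesis by (rule on)
    qed (use fl in simp)
  qed (rule on)
qed

text \<open>
The local description of \<open>lit\<close>: a window of radius \<open>K + 1\<close>, where \<open>K\<close> bounds the support of \<open>\<omega>\<close>,
together with the period. The flags found inside the window vouch for the columns outside of it.
\<close>
definition lit_window :: "nat \<Rightarrow> ('a \<times> 'c option) configuration \<Rightarrow> (int \<Rightarrow> 'a) \<Rightarrow> int \<times> bool \<Rightarrow> bool" where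
  "lit_window K x \<omega> p \<longleftrightarrow> snd (label x p) \<noteq> None \<and>
     (period_ok (period (wall x) p) \<and>
       (\<forall>i. \<bar>i\<bar> \<le> int K \<longrightarrow> fst (label x (walk (wall x) i p)) = wrapped (period (wall x) p) \<omega> i)) \<and>
     (\<forall>e. \<exists>n\<le>K + 1. (\<forall>m<n. \<not> wall x (fst p + dir e * int m)) \<and> flag x e (fst p + dir e * int n)) \<and>
     (\<forall>e s. \<forall>n\<le>K + 1. (\<forall>m\<le>n. \<not> wall x (fst p + dir e * int m)) \<longrightarrow>
       ((fst p + dir e * int n, s) \<noteq> p \<longrightarrow> snd (label x (fst p + dir e * int n, s)) = None) \<and>
       ((\<forall>i. \<bar>i\<bar> \<le> int K \<longrightarrow> (fst p + dir e * int n, s) \<noteq> walk (wall x) i p) \<longrightarrow>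
          fst (label x (fst p + dir e * int n, s)) = a0))"

lemma mark_no_wall: "snd (label x p) \<noteq> None \<Longrightarrow> \<not> wall x (fst p)"
  unfolding wall_def blank_at_def by (metis prod.collapse snd_conv)

lemma lit_imp_window:
  assumes x: "x \<in> configs cells" and f: "lit (wall x) (capped x) (label x) \<omega> p"
    and K: "\<And>n i. period_ok n \<Longrightarrow> (\<And>t. int K \<le> \<bar>i + t * int n\<bar>) \<Longrightarrow> wrapped n \<omega> i = a0"
  shows "lit_window K x \<omega> p"
proof -
  let ?W = "wall x"
  have far: "fst (label x q) = a0" if "assoc ?W p q" "\<And>i. \<bar>i\<bar> \<le> int K \<Longrightarrow> q \<noteq> walk ?W i p" for q
    using lit_far[OF f that K] .
  have none: "snd (label x q) = None" if "assoc ?W p q" "q \<noteq> p" for q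
    using f that unfolding lit_def by blast
  have mk: "snd (label x p) \<noteq> None" using f by (simp add: lit_def)
  note nw = mark_no_wall[OF mk]
  have cap: "\<exists>n\<le>K + 1. (\<forall>m<n. \<not> wall x (fst p + dir e * int m)) \<and> flag x e (fst p + dir e * int n)" for e
  proof -
    have "capped x e (fst (walk ?W 0 p))" using f unfolding lit_def by blast
    then obtain n where n: "\<forall>m<n. \<not> wall x (fst p + dir e * int m)" "flag x e (fst p + dir e * int n)"
      by (auto simp: capped_def)
    show ?thesis
    proof (cases "n \<le> K + 1")
      case False
      \<comment> \<open>The whole belt from distance \<open>K + 1\<close> on is blank, so the flag there is already set.\<close>
      let ?j = "fst p + dir e * int (K + 1)"
      have c: "clear ?W e (fst p) (K + 1)" using n(1) False by (auto simp: clear_def)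
      have "capped x e (fst p)" unfolding capped_def using n by blast
      then have "capped x e ?j" using capped_split[OF x, of "K + 1" "fst p" e] n(1) False by auto
      moreover have "tail_blank ?W (label x) e ?j" unfolding tail_blank_def
      proof (intro allI impI)
        fix m assume "clear ?W e ?j m"
        then have c': "clear ?W e (fst p) (K + 1 + m)" using clear_shift[OF c] by simp
        have "label x (fst p + dir e * int (K + 1 + m), s) = (a0, None)" for s
        proof -
          let ?q = "(fst p + dir e * int (K + 1 + m), s)"
          have a: "assoc ?W p ?q" by (rule clear_assoc[OF c'])
          have d: "\<bar>fst ?q - fst p\<bar> = int (K + 1 + m)" by (simp add: abs_mult)
          have "?q \<noteq> walk ?W i p" if "\<bar>i\<bar> \<le> int K" for i
          proof
            assume "?q = walk ?W i p"
            then have "\<bar>fst ?q - fst p\<bar> \<le> \<bar>i\<bar>" using fst_walk_dist[of ?W i p] by simp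
            then show False using d that by linarith
          qed
          moreover have "?q \<noteq> p"
          proof
            assume "?q = p"
            then have "fst ?q = fst p" by metis
            then show False using d by simp
          qed
          ultimately show ?thesis using far[OF a] none[OF a] by (metis prod.collapse)
        qed
        then show "blank_at (label x) (?j + dir e * int m)" by (simp add: blank_at_def algebra_simps)
      qed
      moreover have "\<not> wall x ?j" using c unfolding clear_def by blast
      ultimately have "flag x e ?j" using flag_iff_capped_tail[OF x] by blast
      then show ?thesis using c by (intro exI[of _ "K + 1"]) (auto simp: clear_def)
    qed (use n in blast)
  qed
  have a: "assoc ?W p (fst p + dir e * int n, s)" if "\<forall>m\<le>n. \<not> wall x (fst p + dir e * int m)" for e n s
    using clear_assoc[of ?W e p n s] that by (simp add: clear_def)
  have ok: "period_ok (period ?W p)" and tp: "tape ?W (label x) p = wrapped (period ?W p) \<omega>"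
    using f by (simp_all add: lit_def)
  show ?thesis unfolding lit_window_def
  proof (intro conjI allI impI)
    fix i show "fst (label x (walk ?W i p)) = wrapped (period ?W p) \<omega> i"
      using fun_cong[OF tp, of i] by (simp add: tape_def)
  next
    fix e n s
    assume "\<forall>m\<le>n. \<not> wall x (fst p + dir e * int m)"
    note a = a[OF this]
    show "snd (label x (fst p + dir e * int n, s)) = None" if "(fst p + dir e * int n, s) \<noteq> p"
      using none[OF a that] .
    show "fst (label x (fst p + dir e * int n, s)) = a0"
      if "\<forall>i. \<bar>i\<bar> \<le> int K \<longrightarrow> (fst p + dir e * int n, s) \<noteq> walk ?W i p"
      using far[OF a] that by blast
  qed (fact mk ok cap)+
qed

text \<open>
Beyond the window, the flags in it imply that all columns of the belt are blank. Two times at which the walk visits the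
same position differ by a multiple of the period, so the labels in the window determine the tape.
\<close>
lemma window_imp_lit:
  assumes x: "x \<in> configs cells" and f: "lit_window K x \<omega> p" and \<omega>: "\<omega> \<in> \<Omega>"
    and K: "\<And>n i. period_ok n \<Longrightarrow> (\<And>t. int K \<le> \<bar>i + t * int n\<bar>) \<Longrightarrow> wrapped n \<omega> i = a0"
  shows "lit (wall x) (capped x) (label x) \<omega> p"
proof -
  let ?W = "wall x" and ?N = "period (wall x) p"
  have mk: "snd (label x p) \<noteq> None" and ok: "period_ok ?N" using f by (auto simp: lit_window_def)
  note nw = mark_no_wall[OF mk]
  have cap: "\<exists>n\<le>K + 1. (\<forall>m<n. \<not> wall x (fst p + dir e * int m)) \<and> flag x e (fst p + dir e * int n)" for e
    using f unfolding lit_window_def by blast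
  have near_q: "((fst p + dir e * int n, s) \<noteq> p \<longrightarrow> snd (label x (fst p + dir e * int n, s)) = None) \<and>
       ((\<forall>i. \<bar>i\<bar> \<le> int K \<longrightarrow> (fst p + dir e * int n, s) \<noteq> walk ?W i p) \<longrightarrow>
          fst (label x (fst p + dir e * int n, s)) = a0)"
    if "n \<le> K + 1" "clear ?W e (fst p) n" for e n s
    using f that unfolding lit_window_def clear_def by blast
  have labels: "(q \<noteq> p \<longrightarrow> snd (label x q) = None) \<and>
      ((\<forall>i. \<bar>i\<bar> \<le> int K \<longrightarrow> q \<noteq> walk ?W i p) \<longrightarrow> fst (label x q) = a0)" if a: "assoc ?W p q" for q
  proof -
    obtain e n where en: "clear ?W e (fst p) n" "fst q = fst p + dir e * int n" using assoc_column[OF a nw] .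
    show ?thesis
    proof (cases "n \<le> K + 1")
      case True
      then show ?thesis using near_q[OF True en(1), of "snd q"] en(2) by (metis prod.collapse)
    next
      case False
      obtain m where m: "m \<le> K + 1" "flag x e (fst p + dir e * int m)" using cap by blast
      have c: "clear ?W e (fst p + dir e * int m) (n - m)"
        using clear_shift[of ?W e "fst p" m "n - m"] clear_mono[OF en(1), of m] en(1) m(1) False by auto
      have "flag x e (fst p + dir e * int m + dir e * int (n - m))"
        by (rule flag_along[OF x m(2)]) (use c in \<open>simp add: clear_def\<close>)
      moreover have "fst p + dir e * int m + dir e * int (n - m) = fst q"
        using en(2) m(1) False by (simp add: of_nat_diff algebra_simps)
      ultimately have "blank_at (label x) (fst q)" using flag_imp_blank[OF x] by metis
      then have "label x q = (a0, None)" unfolding blank_at_def by (metis prod.collapse)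
      then show ?thesis by simp
    qed
  qed
  have "tape ?W (label x) p i = wrapped ?N \<omega> i" for i
  proof (cases "\<exists>i'. \<bar>i'\<bar> \<le> int K \<and> walk ?W i p = walk ?W i' p")
    case True
    then obtain i' where i': "\<bar>i'\<bar> \<le> int K" "walk ?W i p = walk ?W i' p" by blast
    have "walk ?W (i - i') p = p" using i'(2) walk_add[of ?W "- i'" i p] by simp
    then have "int ?N dvd i - i'" by (simp add: walk_fixes_iff)
    then have "wrapped ?N \<omega> (i' + (i - i')) = wrapped ?N \<omega> i'" by (rule wrapped_dvd[OF \<omega> ok])
    moreover have "fst (label x (walk ?W i' p)) = wrapped ?N \<omega> i'" using f i'(1) unfolding lit_window_def by blast
    ultimately show ?thesis using i'(2) by (simp add: tape_def)
  next
    case False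
    then have "fst (label x (walk ?W i p)) = a0" using labels[OF assoc_walk] by metis
    moreover have "int K \<le> \<bar>i + t * int ?N\<bar>" for t
      using False walk_add_period[of ?W i t p] by (metis nle_le)
    then have "wrapped ?N \<omega> i = a0" using K[OF ok] by blast
    ultimately show ?thesis by (simp add: tape_def)
  qed
  then have "tape ?W (label x) p = wrapped ?N \<omega>" by blast
  moreover have "capped x e (fst (walk ?W i p))" for e i
  proof -
    let ?P = "\<lambda>c. \<not> ?W c \<and> (\<forall>e. capped x e c)"
    have "?P (fst (walk ?W i p))"
    proof (rule fst_walk_induct[where P = ?P])
      have "capped x e (fst p)" for e using cap unfolding capped_def by blast
      then show "?P (fst p)" using nw by blast
      fix q :: "int \<times> bool" assume q: "?P (fst q)"
      show "?P (fst (step ?W q))"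
      proof (cases "fst (step ?W q) = fst q")
        case False
        let ?c = "fst q + dir (snd q)"
        have st: "fst (step ?W q) = ?c" "\<not> ?W ?c" using False by (auto simp: step_def split: if_splits)
        have "capped x e ?c" for e
        proof (cases "e = snd q")
          case True
          then show ?thesis using capped_step[OF x, of "fst q" e] q by simp
        next
          case False
          then have d: "dir e = - dir (snd q)" by (cases e; cases "snd q") (simp_all add: dir_def)
          show ?thesis using capped_step[OF x st(2), of e] q by (simp add: d)
        qed
        then show ?thesis using st by simp
      qed (use q in simp)
    qed
    then show ?thesis by blast
  qed
  moreover have "(\<exists>t. flip p = walk ?W t p) \<or> (\<forall>i. fst (label x (flip (walk ?W i p))) = a0)"
  proof (rule disjCI)
    assume not0: "\<not> (\<forall>i. fst (label x (flip (walk ?W i p))) = a0)"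
    then obtain i where i: "fst (label x (flip (walk ?W i p))) \<noteq> a0" by blast
    have "assoc ?W p (flip (walk ?W i p))" unfolding assoc_def by blast
    then obtain i' where "flip (walk ?W i p) = walk ?W i' p" using labels i by blast
    then have "walk ?W (- i) (flip p) = walk ?W i' p" by (simp add: walk_flip)
    then have "flip p = walk ?W (i + i') p" by (simp add: walk_add walk_eq_iff)
    then show "\<exists>t. flip p = walk ?W t p" by blast
  qed
  ultimately show ?thesis using mk ok labels unfolding lit_def by blast
qed

text \<open>
Being lit is locally constant. The window \<open>lit_window\<close> is finite except for the period, and periods from \<open>N\<close> on are
indistinguishable from infinite ones, since the periodic versions of the finitely many points involved
converge to these points.
\<close>
lemma near_lit:
  assumes x: "x \<in> configs cells" and S: "finite S" "S \<subseteq> \<Omega>"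
  shows "eventually (\<lambda>x'. \<forall>\<omega>\<in>S. lit (wall x') (capped x') (label x') \<omega> p =
    lit (wall x) (capped x) (label x) \<omega> p) (near x)"
proof -
  obtain K :: nat where K: "\<And>\<omega> n i. \<omega> \<in> S \<Longrightarrow> period_ok n \<Longrightarrow> (\<And>t. int K \<le> \<bar>i + t * int n\<bar>) \<Longrightarrow> wrapped n \<omega> i = a0"
    using common_support[OF S] by blast
  obtain N where N: "n0 \<le> N" "\<And>\<omega> n i. \<omega> \<in> S \<Longrightarrow> \<bar>i\<bar> \<le> int K \<Longrightarrow> N \<le> n \<Longrightarrow> period_ok n \<Longrightarrow> wrapped n \<omega> i = \<omega> i"
    using common_limit[OF S] by blast
  have window: "lit (wall z) (capped z) (label z) \<omega> p \<longleftrightarrow> lit_window K z \<omega> p" if "z \<in> configs cells" "\<omega> \<in> S" for z \<omega>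
    using lit_imp_window[OF that(1) _ K[OF that(2)]] window_imp_lit[OF that(1) _ _ K[OF that(2)]] that(2) S(2) by blast
  have ok_trunc: "period_ok (truncate N n) \<longleftrightarrow> period_ok n" for n
    using N(1) by (auto simp: truncate_def period_ok_def)
  have trunc: "wrapped (truncate N n) \<omega> i = wrapped n \<omega> i" if "\<omega> \<in> S" "\<bar>i\<bar> \<le> int K" "period_ok n" for \<omega> i n
    using N(2)[OF that(1,2) _ that(3)] wrapped_0[of \<omega>] that(1) S(2) by (auto simp: truncate_def)
  let ?same = "\<lambda>x'. (\<forall>n\<in>{..K + 1}. \<forall>e. wall x' (fst p + dir e * int n) = wall x (fst p + dir e * int n) \<and>
      flag x' e (fst p + dir e * int n) = flag x e (fst p + dir e * int n) \<and>
      (\<forall>s. label x' (fst p + dir e * int n, s) = label x (fst p + dir e * int n, s))) \<and>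
      (\<forall>i\<in>{- int (max K N)..int (max K N)}. walk (wall x') i p = walk (wall x) i p \<and>
         label x' (walk (wall x) i p) = label x (walk (wall x) i p)) \<and> label x' p = label x p"
  have "eventually ?same (near x)"
    by (intro eventually_conj eventually_ball_finite ballI eventually_all_finite near_wall near_flag near_label near_walk) auto
  then show ?thesis using eventually_in_configs[of cells x]
  proof eventually_elim
    case (elim x')
    have walks: "walk (wall x') i p = walk (wall x) i p" "label x' (walk (wall x) i p) = label x (walk (wall x) i p)"
      if "\<bar>i\<bar> \<le> int K \<or> (0 \<le> i \<and> i < int N)" for i
    proof -
      have "i \<in> {- int (max K N)..int (max K N)}" using that by auto
      then show "walk (wall x') i p = walk (wall x) i p" "label x' (walk (wall x) i p) = label x (walk (wall x) i p)"
        using elim(1) by blast+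
    qed
    have per: "truncate N (period (wall x') p) = truncate N (period (wall x) p)"
      by (rule truncate_period) (use walks in auto)
    show ?case
    proof
      fix \<omega> assume w: "\<omega> \<in> S"
      have "(period_ok (period W p) \<and> (\<forall>i. \<bar>i\<bar> \<le> int K \<longrightarrow> f i = wrapped (period W p) \<omega> i)) \<longleftrightarrow>
          (period_ok (truncate N (period W p)) \<and> (\<forall>i. \<bar>i\<bar> \<le> int K \<longrightarrow> f i = wrapped (truncate N (period W p)) \<omega> i))" for W f
        using ok_trunc trunc[OF w] by auto
      then have "(period_ok (period (wall x') p) \<and>
           (\<forall>i. \<bar>i\<bar> \<le> int K \<longrightarrow> fst (label x' (walk (wall x') i p)) = wrapped (period (wall x') p) \<omega> i)) \<longleftrightarrow>
         (period_ok (period (wall x) p) \<and>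
           (\<forall>i. \<bar>i\<bar> \<le> int K \<longrightarrow> fst (label x (walk (wall x) i p)) = wrapped (period (wall x) p) \<omega> i))"
        using per walks by simp
      moreover have "wall x' (fst p + dir e * int n) = wall x (fst p + dir e * int n)"
          "flag x' e (fst p + dir e * int n) = flag x e (fst p + dir e * int n)"
          "label x' (fst p + dir e * int n, s) = label x (fst p + dir e * int n, s)" if "n \<le> K + 1" for e n s
        using elim(1) that by auto
      ultimately have "lit_window K x' \<omega> p = lit_window K x \<omega> p"
        using elim(1) walks(1) unfolding lit_window_def by (simp cong: conj_cong)
      then show "lit (wall x') (capped x') (label x') \<omega> p = lit (wall x) (capped x) (label x) \<omega> p"
        using window[OF _ w] elim(2) x by simp
    qed
  qed
qed

end

context lamps
begin

lemma lit_right: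
  "lit (\<lambda>j. W (j + 1)) (\<lambda>e j. C e (j + 1)) (l \<circ> right) \<omega> p \<longleftrightarrow> lit W C l \<omega> (right p)"
proof -
  have "(\<forall>q. assoc W (right p) q \<longrightarrow> q \<noteq> right p \<longrightarrow> snd (l q) = None) \<longleftrightarrow>
      (\<forall>q. assoc (\<lambda>j. W (j + 1)) p q \<longrightarrow> q \<noteq> p \<longrightarrow> snd (l (right q)) = None)"
    by (metis assoc_right right_inject right_surj)
  moreover have "fst (right q) = fst q + 1" for q by (simp add: right_def)
  moreover have "tape W l (right p) = tape (\<lambda>j. W (j + 1)) (l \<circ> right) p"
    by (simp add: tape_def walk_right)
  ultimately show ?thesis
    unfolding lit_def by (simp only: walk_right period_right flip_right right_inject comp_def)
qed

lemma switch_right: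
  "switch y (\<lambda>j. W (j + 1)) (\<lambda>e j. C e (j + 1)) (l \<circ> right) p = switch y W C l (right p)"
proof -
  have ex: "(\<exists>q. assoc W (right p) q \<and> P q) \<longleftrightarrow> (\<exists>q. assoc (\<lambda>j. W (j + 1)) p q \<and> P (right q))" for P
    by (metis assoc_right right_surj)
  have "lit_lamps y (\<lambda>j. W (j + 1)) (\<lambda>e j. C e (j + 1)) (l \<circ> right) p = lit_lamps y W C l (right p)"
    unfolding lit_lamps_def ex lit_right ..
  moreover have "mark (\<lambda>j. W (j + 1)) (l \<circ> right) p = mark W l (right p)"
    unfolding mark_def ex by simp
  ultimately show ?thesis by (simp add: switch_def amount_def lamp_value_def walk_right)
qed

lemma amount_bounded:
  assumes y: "y \<in> lampset"
  obtains r :: nat where "\<And>W C l p. range l \<subseteq> letters \<Longrightarrow> \<bar>amount y W C l p\<bar> \<le> int r"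
proof -
  let ?S = "{\<omega> \<in> \<Omega>. y \<omega> \<noteq> \<one>\<^bsub>A\<^esub>}"
  define B where "B = insert 0 ((\<lambda>(c, T). \<bar>rot c (finprod A y T)\<bar>) ` (M \<times> Pow ?S))"
  have B: "finite B" using y finite_marks by (auto simp: B_def lampset_iff)
  have "\<bar>amount y W C l p\<bar> \<in> B" if l: "range l \<subseteq> letters" for W C l p
  proof (cases "lit_lamps y W C l p = {}")
    case True
    then show ?thesis using amount_trivial[OF y y l True] by (simp add: B_def)
  next
    case False
    then obtain \<omega> o' where "assoc W p o'" "lit W C l \<omega> o'" by (auto simp: lit_lamps_def)
    then have "snd (l o') = Some (mark W l p)" using mark_lit by blast
    moreover have "l o' \<in> letters" using l by blast
    ultimately have "mark W l p \<in> M" by (cases "l o'") auto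
    moreover have "lit_lamps y W C l p \<in> Pow ?S" by (auto simp: lit_lamps_def)
    ultimately show ?thesis unfolding B_def amount_def lamp_value_def by (intro insertI2 image_eqI[of _ _ "(mark W l p, lit_lamps y W C l p)"]) auto
  qed
  then have "\<bar>amount y W C l p\<bar> \<le> Max B" if "range l \<subseteq> letters" for W C l p
    using B that by (intro Max_ge)
  then have "\<bar>amount y W C l p\<bar> \<le> int (nat (Max B))" if "range l \<subseteq> letters" for W C l p
    using that by (smt (verit) nat_0_le)
  then show ?thesis by (rule that)
qed

text \<open>
If the belt is switched but no mark is visible from \<open>p\<close>, then \<open>p\<close> is far from the support of the tape, and the rotation
only moves blanks there.
\<close>
lemma switch_without_mark:
  assumes x: "x \<in> configs cells" and y: "y \<in> lampset"
    and K: "\<And>\<omega> n i. \<omega> \<in> \<Omega> \<Longrightarrow> y \<omega> \<noteq> \<one>\<^bsub>A\<^esub> \<Longrightarrow> period_ok n \<Longrightarrow> (\<And>t. int K \<le> \<bar>i + t * int n\<bar>) \<Longrightarrow> wrapped n \<omega> i = a0"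
    and r: "\<bar>amount y W C (label x) p\<bar> \<le> int r"
    and none: "\<And>i. \<bar>i\<bar> \<le> int (K + r) \<Longrightarrow> snd (label x (walk W i p)) = None"
  shows "switch y W C (label x) p = label x p"
proof (cases "lit_lamps y W C (label x) p = {}")
  case True
  then show ?thesis
    using amount_trivial[OF y y range_label[OF x] True] act_letter_one[OF label_in[OF x]] by (simp add: switch_def)
next
  case False
  then obtain \<omega> q where w: "\<omega> \<in> \<Omega>" "y \<omega> \<noteq> \<one>\<^bsub>A\<^esub>" and q: "assoc W p q" "lit W C (label x) \<omega> q"
    by (auto simp: lit_lamps_def)
  define m where "m = - amount y W C (label x) p"
  have blank: "label x (walk W j p) = (a0, None)" if j: "\<bar>j\<bar> \<le> int r" for j
  proof -
    have a: "assoc W q (walk W j p)" using q(1) assoc_trans assoc_walk assoc_sym by blast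
    have mk: "snd (label x q) \<noteq> None" using q(2) by (simp add: lit_def)
    have ne: "walk W j p \<noteq> walk W i q" if "\<bar>i\<bar> \<le> int K" for i
    proof
      assume "walk W j p = walk W i q"
      then have wq: "walk W (- i + j) p = q" using walk_add[of W "- i" j p] by simp
      have "\<bar>- i + j\<bar> \<le> int (K + r)" using that j by linarith
      from none[OF this] show False using mk unfolding wq by (rule notE[rotated])
    qed
    have "fst (label x (walk W j p)) = a0" using lit_far[OF q(2) a ne K[OF w]] .
    moreover have "snd (label x (walk W j p)) = None" using none j by simp
    ultimately show ?thesis by (simp add: prod_eq_iff)
  qed
  have "\<bar>m\<bar> \<le> int r" using r by (simp add: m_def)
  then show ?thesis using blank[of m] blank[of 0] by (simp add: switch_def m_def)
qed

text \<open>
If there is no mark near \<open>p\<close>, then \<open>switch_without_mark\<close> applies in a whole neighbourhood of \<open>x\<close>. Otherwise the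
mark seen near \<open>p\<close> is the only candidate for an origin, and \<open>near_lit\<close> applies to it.
\<close>
lemma near_switch:
  assumes x: "x \<in> configs cells" and y: "y \<in> lampset"
  shows "eventually (\<lambda>x'. switch y (wall x') (capped x') (label x') p =
    switch y (wall x) (capped x) (label x) p) (near x)"
proof -
  define S where "S = {\<omega> \<in> \<Omega>. y \<omega> \<noteq> \<one>\<^bsub>A\<^esub>}"
  have S: "finite S" "S \<subseteq> \<Omega>" using y by (auto simp: S_def lampset_iff)
  obtain K :: nat where K: "\<And>\<omega> n i. \<omega> \<in> S \<Longrightarrow> period_ok n \<Longrightarrow> (\<And>t. int K \<le> \<bar>i + t * int n\<bar>) \<Longrightarrow> wrapped n \<omega> i = a0"
    using common_support[OF S] by blast
  obtain r :: nat where r: "\<And>W C l p. range l \<subseteq> letters \<Longrightarrow> \<bar>amount y W C l p\<bar> \<le> int r"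
    using amount_bounded[OF y] by blast
  show ?thesis
  proof (cases "\<exists>i. \<bar>i\<bar> \<le> int (K + r) \<and> snd (label x (walk (wall x) i p)) \<noteq> None")
    case False
    have *: "switch y (wall z) (capped z) (label z) p = label z p"
      if "z \<in> configs cells" "\<And>i. \<bar>i\<bar> \<le> int (K + r) \<Longrightarrow> snd (label z (walk (wall z) i p)) = None" for z
      using switch_without_mark[OF that(1) y _ r[OF range_label[OF that(1)]] that(2), of K] K by (simp add: S_def)
    have "eventually (\<lambda>x'. (\<forall>i\<in>{- int (K + r)..int (K + r)}. walk (wall x') i p = walk (wall x) i p \<and>
        label x' (walk (wall x) i p) = label x (walk (wall x) i p)) \<and> label x' p = label x p) (near x)"
      by (intro eventually_conj eventually_ball_finite ballI near_label near_walk) auto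
    then show ?thesis using eventually_in_configs[of cells x]
    proof eventually_elim
      case (elim x')
      have "snd (label x' (walk (wall x') i p)) = None" if "\<bar>i\<bar> \<le> int (K + r)" for i
      proof -
        have "i \<in> {- int (K + r)..int (K + r)}" using that by auto
        then have "label x' (walk (wall x') i p) = label x (walk (wall x) i p)" using elim by metis
        then show ?thesis using False that by simp
      qed
      then show ?case using *[OF elim(2)] *[OF x] elim(1) False by metis
    qed
  next
    case True
    then obtain i where i: "snd (label x (walk (wall x) i p)) \<noteq> None" by blast
    define q where "q = walk (wall x) i p"
    obtain c where c: "snd (label x q) = Some c" using i by (auto simp: q_def)
    define v where "v = (\<lambda>z. finprod A y {\<omega> \<in> S. lit (wall z) (capped z) (label z) \<omega> q})"
    have *: "switch y (wall z) (capped z) (label z) p =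
        act_letter (v z) (label z (walk (wall z) (- rot c (v z)) p))"
      if z: "z \<in> configs cells" "walk (wall z) i p = q" "snd (label z q) = Some c" for z
    proof -
      have a: "assoc (wall z) p q" using z(2) assoc_walk by metis
      have "lit_lamps y (wall z) (capped z) (label z) p = {\<omega> \<in> S. lit (wall z) (capped z) (label z) \<omega> q}"
      proof -
        have "o' = q" if "assoc (wall z) p o'" "lit (wall z) (capped z) (label z) \<omega> o'" for \<omega> o'
          using lit_unique[OF that(2), of q] that(1) a z(3) assoc_cong assoc_sym by (metis option.distinct(1))
        then show ?thesis using a unfolding lit_lamps_def S_def by blast
      qed
      then have v: "lamp_value y (wall z) (capped z) (label z) p = v z" by (simp add: lamp_value_def v_def)
      have "amount y (wall z) (capped z) (label z) p = rot c (v z)"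
      proof (cases "{\<omega> \<in> S. lit (wall z) (capped z) (label z) \<omega> q} = {}")
        case True
        then have "v z = \<one>\<^bsub>A\<^esub>" unfolding v_def by (simp only: A.finprod_empty)
        then show ?thesis using v by (simp add: amount_def)
      next
        case False
        then obtain \<omega> where "lit (wall z) (capped z) (label z) \<omega> q" by blast
        then have "mark (wall z) (label z) p = c" using mark_lit[OF _ a] z(3) by simp
        then show ?thesis using v by (simp add: amount_def)
      qed
      then show ?thesis using v by (simp add: switch_def)
    qed
    let ?q' = "walk (wall x) (- rot c (v x)) p"
    have "eventually (\<lambda>x'. (walk (wall x') i p = q \<and> label x' q = label x q) \<and>
        (walk (wall x') (- rot c (v x)) p = ?q' \<and> label x' ?q' = label x ?q')) (near x)"
      using near_walk[of i p x] unfolding q_def[symmetric] by (intro eventually_conj near_label near_walk)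
    then show ?thesis using near_lit[OF x S, of q] eventually_in_configs[of cells x]
    proof eventually_elim
      case (elim x')
      have "{\<omega> \<in> S. lit (wall x') (capped x') (label x') \<omega> q} = {\<omega> \<in> S. lit (wall x) (capped x) (label x) \<omega> q}"
        using elim(2) by blast
      then have "v x' = v x" by (simp only: v_def)
      then show ?case using *[OF elim(3)] *[OF x] elim(1) c q_def by simp
    qed
  qed
qed

lemma local_op_switch:
  assumes y: "y \<in> lampset"
  shows "local_op (switch y)"
  unfolding local_op_def
proof (intro conjI)
  show "\<forall>W C l. range l \<subseteq> letters \<longrightarrow> range (switch y W C l) \<subseteq> letters"
    using switch_range[OF y] by blast
  show "\<forall>x\<in>configs cells. \<forall>p. \<forall>\<^sub>F x' in near x. switch y (wall x') (capped x') (label x') p =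
      switch y (wall x) (capped x) (label x) p"
    using near_switch[OF _ y] by blast
  show "\<forall>W C l p. switch y (\<lambda>j. W (j + 1)) (\<lambda>e j. C e (j + 1)) (l \<circ> right) p = switch y W C l (right p)"
    using switch_right by blast
  obtain r :: nat where r: "\<And>W C l p. range l \<subseteq> letters \<Longrightarrow> \<bar>amount y W C l p\<bar> \<le> int r"
    using amount_bounded[OF y] by blast
  have "controls r W l (switch y W C l)" if l: "range l \<subseteq> letters" for W C l
    unfolding controls_def
  proof (intro allI impI)
    fix p assume b: "\<forall>i. \<bar>i\<bar> \<le> int r \<longrightarrow> blank_at l (fst (walk W i p))"
    have "l (walk W i p) = (a0, None)" if "\<bar>i\<bar> \<le> int r" for i
      using b that unfolding blank_at_def by (metis prod.collapse)
    then show "switch y W C l p = (a0, None)" using r[OF l, of W C p] by (simp add: switch_def)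
  qed
  then show "\<exists>r. \<forall>W C l. range l \<subseteq> letters \<longrightarrow> controls r W l (switch y W C l)" by blast
qed

end

section \<open>Embedding the wreath product\<close>

locale separating_lamps = lamps \<Sigma> a0 H u k n0 A M act rot
  for \<Sigma> :: "'a set" and a0 H u k n0 and A :: "('b, 'p) monoid_scheme" and M :: "'c set" and act rot +
  assumes separating: "\<And>a a'. a \<in> carrier A \<Longrightarrow> a' \<in> carrier A \<Longrightarrow>
    (\<And>c. c \<in> M \<Longrightarrow> rot c a = rot c a' \<and> act a c = act a' c) \<Longrightarrow> a = a'"
begin

lemma inverse_lamps:
  assumes "y \<in> lampset"
  shows "(\<lambda>\<omega>\<in>\<Omega>. inv\<^bsub>A\<^esub> (y \<omega>)) \<in> lampset"
proof -
  have "{\<omega> \<in> \<Omega>. (\<lambda>\<omega>\<in>\<Omega>. inv\<^bsub>A\<^esub> (y \<omega>)) \<omega> \<noteq> \<one>\<^bsub>A\<^esub>} \<subseteq> {\<omega> \<in> \<Omega>. y \<omega> \<noteq> \<one>\<^bsub>A\<^esub>}"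
    using lampset_carrier[OF assms] by auto
  then have "finite {\<omega> \<in> \<Omega>. (\<lambda>\<omega>\<in>\<Omega>. inv\<^bsub>A\<^esub> (y \<omega>)) \<omega> \<noteq> \<one>\<^bsub>A\<^esub>}"
    by (rule finite_subset) (use assms in \<open>simp add: lampset_iff\<close>)
  moreover have "(\<lambda>\<omega>\<in>\<Omega>. inv\<^bsub>A\<^esub> (y \<omega>)) \<in> (\<Pi>\<^sub>E \<omega>\<in>\<Omega>. carrier A)"
    using lampset_carrier[OF assms] by (intro PiE_I) simp_all
  ultimately show ?thesis unfolding lampset_iff by blast
qed

lemma switch_inverse:
  assumes y: "y \<in> lampset"
  shows "inverse_ops (switch y) (switch (\<lambda>\<omega>\<in>\<Omega>. inv\<^bsub>A\<^esub> (y \<omega>)))"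
proof -
  let ?y = "\<lambda>\<omega>\<in>\<Omega>. inv\<^bsub>A\<^esub> (y \<omega>)"
  have "(\<lambda>\<omega>\<in>\<Omega>. ?y \<omega> \<otimes>\<^bsub>A\<^esub> y \<omega>) = (\<lambda>\<omega>\<in>\<Omega>. \<one>\<^bsub>A\<^esub>)" "(\<lambda>\<omega>\<in>\<Omega>. y \<omega> \<otimes>\<^bsub>A\<^esub> ?y \<omega>) = (\<lambda>\<omega>\<in>\<Omega>. \<one>\<^bsub>A\<^esub>)"
    using lampset_carrier[OF y] by (intro restrict_ext, simp)+
  then show ?thesis
    using switch_switch[OF y inverse_lamps[OF y]] switch_switch[OF inverse_lamps[OF y] y]
    unfolding inverse_ops_def by (intro allI impI) (simp only: switch_one simp_thms)
qed

definition move_lamps where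
  "move_lamps h y = (\<lambda>\<omega>\<in>\<Omega>. y ((inv\<^bsub>HH\<^esub> h) \<omega>))"

lemma move_lamps_closed:
  assumes h: "h \<in> H" and y: "y \<in> lampset"
  shows "move_lamps h y \<in> lampset"
proof -
  have "{\<omega> \<in> \<Omega>. move_lamps h y \<omega> \<noteq> \<one>\<^bsub>A\<^esub>} \<subseteq> h ` {\<omega> \<in> \<Omega>. y \<omega> \<noteq> \<one>\<^bsub>A\<^esub>}"
  proof
    fix \<omega> assume "\<omega> \<in> {\<omega> \<in> \<Omega>. move_lamps h y \<omega> \<noteq> \<one>\<^bsub>A\<^esub>}"
    then have w: "\<omega> \<in> \<Omega>" "y ((inv\<^bsub>HH\<^esub> h) \<omega>) \<noteq> \<one>\<^bsub>A\<^esub>"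
      by (auto simp: move_lamps_def)
    then show "\<omega> \<in> h ` {\<omega> \<in> \<Omega>. y \<omega> \<noteq> \<one>\<^bsub>A\<^esub>}"
      using orbit_inv[OF h w(1)] by (intro image_eqI[of _ _ "(inv\<^bsub>HH\<^esub> h) \<omega>"]) simp_all
  qed
  moreover have "finite {\<omega> \<in> \<Omega>. y \<omega> \<noteq> \<one>\<^bsub>A\<^esub>}" using y by (simp add: lampset_iff)
  ultimately have "finite {\<omega> \<in> \<Omega>. move_lamps h y \<omega> \<noteq> \<one>\<^bsub>A\<^esub>}" using finite_surj by blast
  moreover have "move_lamps h y \<in> (\<Pi>\<^sub>E \<omega>\<in>\<Omega>. carrier A)"
    unfolding move_lamps_def using lampset_carrier[OF y] orbit_inv(3)[OF h] by (intro PiE_I) simp_all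
  ultimately show ?thesis by (simp add: lampset_iff)
qed

abbreviation "wreath \<equiv> orbit_wreath_product A \<Sigma> H x0"

lemma wreath_carrier: "carrier wreath = lampset \<times> H"
  by (simp add: orbit_wreath_product_def wreath_product_def semidirect_product_def lampset_def Let_def)

lemma wreath_mult: "(y, h) \<otimes>\<^bsub>wreath\<^esub> (y', h') = (\<lambda>\<omega>\<in>\<Omega>. y \<omega> \<otimes>\<^bsub>A\<^esub> move_lamps h y' \<omega>, h \<otimes>\<^bsub>HH\<^esub> h')"
  by (simp add: orbit_wreath_product_def wreath_product_def semidirect_product_def Let_def move_lamps_def)

lemma wreath_one: "\<one>\<^bsub>wreath\<^esub> = (\<lambda>\<omega>\<in>\<Omega>. \<one>\<^bsub>A\<^esub>, \<lambda>x\<in>configs \<Sigma>. x)"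
  using H_one by (simp add: orbit_wreath_product_def wreath_product_def semidirect_product_def Let_def)

lemma product_lamps:
  assumes "y \<in> lampset" "y' \<in> lampset"
  shows "(\<lambda>\<omega>\<in>\<Omega>. y \<omega> \<otimes>\<^bsub>A\<^esub> y' \<omega>) \<in> lampset"
proof -
  have "{\<omega> \<in> \<Omega>. (\<lambda>\<omega>\<in>\<Omega>. y \<omega> \<otimes>\<^bsub>A\<^esub> y' \<omega>) \<omega> \<noteq> \<one>\<^bsub>A\<^esub>} \<subseteq> {\<omega> \<in> \<Omega>. y \<omega> \<noteq> \<one>\<^bsub>A\<^esub>} \<union> {\<omega> \<in> \<Omega>. y' \<omega> \<noteq> \<one>\<^bsub>A\<^esub>}" by auto
  then have "finite {\<omega> \<in> \<Omega>. (\<lambda>\<omega>\<in>\<Omega>. y \<omega> \<otimes>\<^bsub>A\<^esub> y' \<omega>) \<omega> \<noteq> \<one>\<^bsub>A\<^esub>}"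
    by (rule finite_subset) (use assms in \<open>simp add: lampset_iff\<close>)
  moreover have "(\<lambda>\<omega>\<in>\<Omega>. y \<omega> \<otimes>\<^bsub>A\<^esub> y' \<omega>) \<in> (\<Pi>\<^sub>E \<omega>\<in>\<Omega>. carrier A)"
    using assms lampset_carrier by (intro PiE_I) simp_all
  ultimately show ?thesis unfolding lampset_iff by blast
qed

lemma one_lamps: "(\<lambda>\<omega>\<in>\<Omega>. \<one>\<^bsub>A\<^esub>) \<in> lampset"
  by (auto simp: lampset_iff)

definition embed where
  "embed g = restrict (\<lambda>x. lift (switch (fst g)) (lift (simulate (snd g)) x)) (configs cells)"

text \<open>
The premises of the lemmas about \<open>lift\<close>, for the two kinds of operations.
\<close>
lemmas simulate_op = local_op_simulate local_op_simulate[OF H_inv_closed] simulate_inverse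
lemmas switch_op = local_op_switch local_op_switch[OF inverse_lamps] switch_inverse

lemma embed_Aut:
  assumes y: "y \<in> lampset" and h: "h \<in> H"
  shows "embed (y, h) \<in> carrier (shift_Aut cells)"
proof -
  note S = lift_Aut[OF simulate_op[OF h]] and T = lift_Aut[OF switch_op[OF y]]
  have "embed (y, h) = compose (configs cells) (restrict (lift (switch y)) (configs cells)) (restrict (lift (simulate h)) (configs cells))"
    using lift_in_configs[OF simulate_op[OF h]] by (auto simp: embed_def compose_def)
  then show ?thesis
    using shift_Aut_mult[OF T S] monoid.m_closed[OF group.is_monoid[OF group_shift_Aut] T S] by simp
qed

lemma embed_mult:
  assumes y: "y \<in> lampset" "y' \<in> lampset" and h: "h \<in> H" "h' \<in> H"
  shows "embed ((y, h) \<otimes>\<^bsub>wreath\<^esub> (y', h')) = embed (y, h) \<otimes>\<^bsub>shift_Aut cells\<^esub> embed (y', h')"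
proof -
  let ?m = "move_lamps h y'"
  note m = move_lamps_closed[OF h(1) y(2)]
  have "lift (switch (\<lambda>\<omega>\<in>\<Omega>. y \<omega> \<otimes>\<^bsub>A\<^esub> ?m \<omega>)) (lift (simulate (compose (configs \<Sigma>) h h')) x) =
      lift (switch y) (lift (simulate h) (lift (switch y') (lift (simulate h') x)))" if x: "x \<in> configs cells" for x
  proof -
    define z where "z = lift (simulate h') x"
    have z: "z \<in> configs cells" unfolding z_def using lift_in_configs[OF simulate_op[OF h(2)] x] .
    have w: "lift (simulate h) z \<in> configs cells" using lift_in_configs[OF simulate_op[OF h(1)] z] .
    have 1: "lift (simulate h) z = lift (simulate (compose (configs \<Sigma>) h h')) x"
      unfolding z_def lift_lift[OF simulate_op[OF h(2)] x]
      using simulate_compose[OF h] by (rule lift_cong[OF x])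
    have "lift (simulate h) (lift (switch y') z) = lift (\<lambda>W C l. simulate h W C (switch y' W C l)) z"
      by (rule lift_lift[OF switch_op[OF y(2)] z])
    also have "\<dots> = lift (\<lambda>W C l. switch ?m W C (simulate h W C l)) z"
      using switch_simulate[OF h(1) y(2)] unfolding move_lamps_def by (intro lift_cong[OF z]) simp
    also have "\<dots> = lift (switch ?m) (lift (simulate h) z)"
      by (rule lift_lift[OF simulate_op[OF h(1)] z, symmetric])
    finally have 2: "lift (simulate h) (lift (switch y') z) = lift (switch ?m) (lift (simulate h) z)" .
    have "lift (switch y) (lift (switch ?m) (lift (simulate h) z)) =
        lift (switch (\<lambda>\<omega>\<in>\<Omega>. y \<omega> \<otimes>\<^bsub>A\<^esub> ?m \<omega>)) (lift (simulate h) z)"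
      unfolding lift_lift[OF switch_op[OF m] w] using switch_switch[OF m y(1)] by (rule lift_cong[OF w])
    then show ?thesis using 1 2 by (simp add: z_def)
  qed
  moreover have "lift (switch y') (lift (simulate h') x) \<in> configs cells" if "x \<in> configs cells" for x
    using lift_in_configs[OF switch_op[OF y(2)] lift_in_configs[OF simulate_op[OF h(2)] that]] .
  ultimately show ?thesis
    unfolding shift_Aut_mult[OF embed_Aut[OF y(1) h(1)] embed_Aut[OF y(2) h(2)]] wreath_mult
    using H_mult[OF h] by (auto simp: embed_def compose_def intro!: restrict_ext)
qed

lemma label_embed:
  assumes y: "y \<in> lampset" and h: "h \<in> H" and x: "x \<in> configs cells"
  shows "label (embed (y, h) x) = switch y (wall x) (capped x) (simulate h (wall x) (capped x) (label x))"
proof -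
  note c = local_op_compatible[OF simulate_op[OF h] x]
  have x': "lift (simulate h) x \<in> configs cells" by (rule lift_in_configs[OF simulate_op[OF h] x])
  have "label (embed (y, h) x) = switch y (wall (lift (simulate h) x)) (capped (lift (simulate h) x)) (label (lift (simulate h) x))"
    using x label_recode[OF x' local_op_compatible[OF switch_op[OF y] x']] by (simp add: embed_def lift_def[of "switch y"])
  then show ?thesis using c x by (simp add: lift_def[of "simulate h"])
qed

lemma walk_free: "walk (\<lambda>_. False) i p = (fst p + dir (snd p) * i, snd p)"
proof -
  have "(step (\<lambda>_. False) ^^ n) q = (fst q + dir (snd q) * int n, snd q)" for n q
    by (induction n) (simp_all add: step_def algebra_simps)
  then show ?thesis by (simp add: walk_def flip_def)
qed

lemma switch_unmarked:
  assumes "y \<in> lampset" "range l \<subseteq> letters" "\<And>p. snd (l p) = None"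
  shows "switch y W C l = l"
proof
  fix p
  have "lit_lamps y W C l p = {}" using assms(3) by (simp add: lit_lamps_def lit_def)
  moreover have "l p \<in> letters" using assms(2) by blast
  ultimately show "switch y W C l p = l p"
    using amount_trivial[OF assms(1,1,2)] by (simp add: switch_def act_letter_one)
qed

text \<open>
If no flag is set there are no walls, and the track \<open>True\<close> is an infinite tape with arbitrary contents.
\<close>
lemma embed_determines_automorphism:
  assumes y: "y \<in> lampset" "y' \<in> lampset" and h: "h \<in> H" "h' \<in> H" and eq: "embed (y, h) = embed (y', h')"
  shows "h = h'"
proof -
  have "h z j = h' z j" if z: "z \<in> configs \<Sigma>" for z j
  proof -
    define x :: "('a \<times> 'c option) configuration"
      where "x = (\<lambda>j. (\<lambda>e. (if e then z j else a0, None), \<lambda>e. False))"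
    have x: "x \<in> configs cells" using z a0 by (auto simp: configs_iff cells_def x_def)
    have W: "wall x = (\<lambda>_. False)" by (simp add: fun_eq_iff wall_def flag_def x_def)
    have lx: "label x p = (if snd p then z (fst p) else a0, None)" for p by (simp add: label_def x_def)
    have "fst (label (embed (y, h) x) (j, True)) = h z j" if "y \<in> lampset" "h \<in> H" for y h
    proof -
      have "snd (simulate h (wall x) (capped x) (label x) p) = None" for p
        by (simp add: simulate_def lx)
      then have "label (embed (y, h) x) = simulate h (wall x) (capped x) (label x)"
        using label_embed[OF that x] switch_unmarked[OF that(1) simulate_range[OF that(2) range_label[OF x]]] by simp
      moreover have "tape (wall x) (label x) (j, True) = (\<lambda>i. z (i + j))"
        by (simp add: tape_def W walk_free lx dir_def add.commute)
      ultimately show ?thesis using H_translate[OF that(2) z, of j] by (simp add: simulate_def)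
    qed
    then show ?thesis using eq y h by metis
  qed
  then have "h z = h' z" if "z \<in> configs \<Sigma>" for z using that by blast
  moreover have "h \<in> extensional (configs \<Sigma>)" "h' \<in> extensional (configs \<Sigma>)"
    using h H_Aut Bij_imp_extensional unfolding shift_Aut_iff by blast+
  ultimately show ?thesis by (rule extensionalityI[rotated 2])
qed

text \<open>
If all flags are truthful there are no walls, so the track \<open>True\<close> is a single infinite tape, on which \<open>\<omega>\<close> can be
written without being wrapped.
\<close>
lemma lit_configuration:
  assumes \<omega>: "\<omega> \<in> \<Omega>" and c: "c \<in> M"
  obtains x where "x \<in> configs cells" "wall x = (\<lambda>_. False)" "label x (0, True) = (\<omega> 0, Some c)"
    "\<And>\<omega>'. \<omega>' \<in> \<Omega> \<Longrightarrow> lit (wall x) (capped x) (label x) \<omega>' (0, True) \<longleftrightarrow> \<omega>' = \<omega>"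
proof -
  define l :: "int \<times> bool \<Rightarrow> 'a \<times> 'c option" where
    "l = (\<lambda>(j, e). (if e then \<omega> j else a0, if j = 0 \<and> e then Some c else None))"
  define x where "x = (\<lambda>j. (\<lambda>e. l (j, e), \<lambda>e. \<forall>n. blank_at l (j + dir e * int n)))"
  have lx: "label x = l" by (simp add: fun_eq_iff label_def x_def)
  have fx: "flag x e j \<longleftrightarrow> (\<forall>n. blank_at l (j + dir e * int n))" for e j by (simp add: flag_def x_def)
  have "l p \<in> letters" for p
    using orbit_configs[OF \<omega>] a0 c by (cases p) (auto simp: l_def configs_iff)
  then have lr: "range (\<lambda>e. l (j, e)) \<subseteq> letters" for j by blast
  have nf: "\<not> (\<forall>n. blank_at l (j + dir e * int n))" if "l (j, e') \<noteq> (a0, None)" for j e e'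
  proof
    assume "\<forall>n. blank_at l (j + dir e * int n)"
    from spec[OF this, of 0] show False using that by (simp add: blank_at_def)
  qed
  have x: "x \<in> configs cells"
    unfolding configs_iff cells_def x_def using lr nf by (simp only: mem_Collect_eq fst_conv snd_conv) blast
  have "flag x e j \<longleftrightarrow> flag x e (j + dir e)" if b: "blank_at l j" for e j
  proof -
    have "(\<forall>n. P n) \<longleftrightarrow> P 0 \<and> (\<forall>n. P (Suc n))" for P by (metis not0_implies_Suc)
    from this[of "\<lambda>n. blank_at l (j + dir e * int n)"] show ?thesis using b by (simp add: fx algebra_simps)
  qed
  then have W: "wall x = (\<lambda>_. False)" by (auto simp: fun_eq_iff wall_def lx)
  let ?o = "(0 :: int, True)"
  have per: "period (wall x) ?o = 0"
    unfolding period_def W walk_free by (simp add: dir_def)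
  obtain K :: nat where K: "\<And>n i. period_ok n \<Longrightarrow> (\<And>t. int K \<le> \<bar>i + t * int n\<bar>) \<Longrightarrow> wrapped n \<omega> i = a0"
    using wrapped_support[OF \<omega>] by blast
  have far: "\<omega> i = a0" if "int K \<le> \<bar>i\<bar>" for i
    using K[of 0 i] that wrapped_0[OF \<omega>] by (simp add: period_ok_def)
  have cap: "capped x e j" for e j
  proof -
    have "blank_at l (j + dir e * int (nat \<bar>j\<bar> + K + 1) + dir e * int n)" for n
    proof -
      have "int K < \<bar>j + dir e * int (nat \<bar>j\<bar> + K + 1) + dir e * int n\<bar>" by (auto simp: dir_def)
      then show ?thesis using far by (auto simp: blank_at_def l_def)
    qed
    then have "flag x e (j + dir e * int (nat \<bar>j\<bar> + K + 1))" unfolding fx by blast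
    then show ?thesis unfolding capped_def W by blast
  qed
  have tp: "tape (wall x) (label x) ?o = \<omega>"
    by (simp add: fun_eq_iff tape_def W walk_free lx l_def dir_def)
  have "lit (wall x) (capped x) (label x) \<omega>' ?o \<longleftrightarrow> \<omega>' = \<omega>" if w: "\<omega>' \<in> \<Omega>" for \<omega>'
  proof -
    have "snd (l ?o) \<noteq> None" "\<And>q. q \<noteq> ?o \<Longrightarrow> snd (l q) = None" "\<And>i. fst (l (flip (walk (wall x) i ?o))) = a0"
      by (auto simp: l_def W walk_free flip_def split: if_splits)
    then show ?thesis unfolding lit_def per tp using cap wrapped_0[OF w] by (auto simp: period_ok_def lx)
  qed
  then show ?thesis using that[of x] x W by (simp add: lx l_def)
qed

text \<open>
On the belt of \<open>lit_configuration\<close>, the new position of the only mark reveals the rotation, and its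
new value reveals the action on marks.
\<close>
lemma switch_determines_lamps:
  assumes y: "y \<in> lampset" "y' \<in> lampset"
    and eq: "\<And>x. x \<in> configs cells \<Longrightarrow> switch y (wall x) (capped x) (label x) = switch y' (wall x) (capped x) (label x)"
  shows "y = y'"
proof -
  have "y \<omega> = y' \<omega>" if \<omega>: "\<omega> \<in> \<Omega>" for \<omega>
  proof (rule separating)
    show "y \<omega> \<in> carrier A" "y' \<omega> \<in> carrier A" using y lampset_carrier \<omega> by blast+
    fix c assume c: "c \<in> M"
    obtain x where x: "x \<in> configs cells" "wall x = (\<lambda>_. False)" "label x (0, True) = (\<omega> 0, Some c)"
      and lit: "\<And>\<omega>'. \<omega>' \<in> \<Omega> \<Longrightarrow> lit (wall x) (capped x) (label x) \<omega>' (0, True) \<longleftrightarrow> \<omega>' = \<omega>"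
      using lit_configuration[OF \<omega> c] by blast
    let ?o = "(0 :: int, True)"
    have lw: "lit (wall x) (capped x) (label x) \<omega> ?o" using lit \<omega> by blast
    have only: "o' = ?o" if "assoc (wall x) ?o o'" "lit (wall x) (capped x) (label x) \<omega>' o'" for \<omega>' o'
      using lit_unique[OF lw that(1)] that(2) by (simp add: lit_def)
    have val: "lamp_value y (wall x) (capped x) (label x) ?o = y \<omega>" if y: "y \<in> lampset" for y
    proof -
      have "lit_lamps y (wall x) (capped x) (label x) ?o = {\<omega>' \<in> \<Omega>. y \<omega>' \<noteq> \<one>\<^bsub>A\<^esub> \<and> \<omega>' = \<omega>}"
        unfolding lit_lamps_def using only lit assoc_refl by blast
      then have "lit_lamps y (wall x) (capped x) (label x) ?o = (if y \<omega> = \<one>\<^bsub>A\<^esub> then {} else {\<omega>})" using \<omega> by auto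
      then show ?thesis using lampset_carrier[OF y \<omega>] by (simp add: lamp_value_def)
    qed
    have "mark (wall x) (label x) ?o = c" using mark_lit[OF lw assoc_refl] x(3) by simp
    then have am: "amount y (wall x) (capped x) (label x) ?o = rot c (y \<omega>)" if "y \<in> lampset" for y
      using val[OF that] by (simp add: amount_def)
    have sw: "switch y (wall x) (capped x) (label x) (walk (wall x) i ?o) =
        act_letter (y \<omega>) (label x (walk (wall x) (i - rot c (y \<omega>)) ?o))" if "y \<in> lampset" for y i
      using switch_rotates[OF that that range_label[OF x(1)] assoc_walk[of "wall x" ?o i]] val[OF that] am[OF that]
        walk_add[of "wall x" "- rot c (y \<omega>)" i ?o] by simp
    let ?i = "rot c (y \<omega>)"
    have e: "act_letter (y \<omega>) (label x ?o) = act_letter (y' \<omega>) (label x (walk (wall x) (?i - rot c (y' \<omega>)) ?o))"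
      using sw[OF y(1), of ?i] sw[OF y(2), of ?i] eq[OF x(1)] by simp
    then have "map_option (act (y' \<omega>)) (snd (label x (walk (wall x) (?i - rot c (y' \<omega>)) ?o))) = Some (act (y \<omega>) c)"
      using arg_cong[OF e, of snd] unfolding snd_act_letter by (simp only: x(3) snd_conv option.map)
    then have "snd (label x (walk (wall x) (?i - rot c (y' \<omega>)) ?o)) \<noteq> None" by auto
    then have "walk (wall x) (?i - rot c (y' \<omega>)) ?o = ?o" using lit_unique[OF lw assoc_walk] by blast
    then have r: "?i = rot c (y' \<omega>)" by (simp add: x(2) walk_free dir_def)
    then show "rot c (y \<omega>) = rot c (y' \<omega>) \<and> act (y \<omega>) c = act (y' \<omega>) c"
      using e x(3) by (simp add: act_letter_def)
  qed
  moreover have "y \<in> extensional \<Omega>" "y' \<in> extensional \<Omega>" using y by (auto simp: lampset_iff PiE_iff)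
  ultimately show ?thesis by (rule extensionalityI[rotated 2])
qed

lemma embed_inj: "inj_on embed (carrier wreath)"
proof (rule inj_onI)
  fix g g' assume g: "g \<in> carrier wreath" "g' \<in> carrier wreath" and eq: "embed g = embed g'"
  obtain y h y' h' where d: "g = (y, h)" "g' = (y', h')" by (cases g; cases g')
  have y: "y \<in> lampset" "y' \<in> lampset" and h: "h \<in> H" "h' \<in> H" using g by (auto simp: d wreath_carrier)
  have hh: "h' = h" using embed_determines_automorphism[OF y h] eq by (simp add: d)
  note i = H_inv_closed[OF h(1)]
  have "switch y (wall x) (capped x) (label x) = switch y' (wall x) (capped x) (label x)" if x: "x \<in> configs cells" for x
  proof -
    define z where "z = lift (simulate (inv\<^bsub>HH\<^esub> h)) x"
    note op = simulate_op(2,1)[OF h(1)] inverse_ops_sym[OF simulate_inverse[OF h(1)]]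
    note op' = op(2,1) simulate_inverse[OF h(1)]
    have z: "z \<in> configs cells" unfolding z_def by (rule lift_in_configs[OF op x])
    have xz: "lift (simulate h) z = x" unfolding z_def by (rule lift_inverse[OF op x])
    have "label (lift (switch y) x) = switch y (wall x) (capped x) (label x)" if "y \<in> lampset" for y
      using label_recode[OF x local_op_compatible[OF switch_op[OF that] x]] by (simp add: lift_def)
    moreover have "lift (switch y) x = lift (switch y') x"
      using fun_cong[OF eq, of z] z xz by (simp add: d hh embed_def)
    ultimately show ?thesis using y by metis
  qed
  then have "y = y'" by (rule switch_determines_lamps[OF y])
  then show "g = g'" by (simp add: d hh)
qed

end

text \<open>
A multiplicative injection into a group makes associativity and the unit law automatic.
\<close>
lemma groupI_embedding:
  assumes K: "group K" and f: "\<And>x y. x \<in> carrier G \<Longrightarrow> y \<in> carrier G \<Longrightarrow> f (x \<otimes>\<^bsub>G\<^esub> y) = f x \<otimes>\<^bsub>K\<^esub> f y"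
    "\<And>x. x \<in> carrier G \<Longrightarrow> f x \<in> carrier K" "inj_on f (carrier G)"
    and closed: "\<And>x y. x \<in> carrier G \<Longrightarrow> y \<in> carrier G \<Longrightarrow> x \<otimes>\<^bsub>G\<^esub> y \<in> carrier G"
    and one: "\<one>\<^bsub>G\<^esub> \<in> carrier G" "f \<one>\<^bsub>G\<^esub> = \<one>\<^bsub>K\<^esub>"
    and inv: "\<And>x. x \<in> carrier G \<Longrightarrow> \<exists>y\<in>carrier G. y \<otimes>\<^bsub>G\<^esub> x = \<one>\<^bsub>G\<^esub>"
  shows "group G"
proof -
  interpret K: group K by (rule K)
  show ?thesis
  proof (rule groupI)
    fix x y z assume x: "x \<in> carrier G" "y \<in> carrier G" "z \<in> carrier G"
    show "x \<otimes>\<^bsub>G\<^esub> y \<otimes>\<^bsub>G\<^esub> z = x \<otimes>\<^bsub>G\<^esub> (y \<otimes>\<^bsub>G\<^esub> z)"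
      by (rule inj_onD[OF f(3)]) (use x in \<open>simp_all add: f closed K.m_assoc\<close>)
  next
    fix x assume x: "x \<in> carrier G"
    show "\<one>\<^bsub>G\<^esub> \<otimes>\<^bsub>G\<^esub> x = x"
      by (rule inj_onD[OF f(3)]) (use x in \<open>simp_all add: f closed one\<close>)
  qed (use closed one inv in auto)
qed

context separating_lamps
begin

lemma embed_one: "embed \<one>\<^bsub>wreath\<^esub> = \<one>\<^bsub>shift_Aut cells\<^esub>"
proof -
  have "lift (switch (\<lambda>\<omega>\<in>\<Omega>. \<one>\<^bsub>A\<^esub>)) (lift (simulate (\<lambda>x\<in>configs \<Sigma>. x)) x) = x" if x: "x \<in> configs cells" for x
  proof -
    have "lift (simulate (\<lambda>x\<in>configs \<Sigma>. x)) x = x"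
      using lift_cong[OF x, of "simulate (\<lambda>x\<in>configs \<Sigma>. x)" "\<lambda>W C l. l"] simulate_id lift_id[OF x] by simp
    moreover have "lift (switch (\<lambda>\<omega>\<in>\<Omega>. \<one>\<^bsub>A\<^esub>)) x = x"
      using lift_cong[OF x, of "switch (\<lambda>\<omega>\<in>\<Omega>. \<one>\<^bsub>A\<^esub>)" "\<lambda>W C l. l"] switch_one lift_id[OF x] by simp
    ultimately show ?thesis by simp
  qed
  then show ?thesis unfolding wreath_one shift_Aut_one embed_def by (auto intro!: restrict_ext)
qed

lemma wreath_closed:
  assumes "g \<in> carrier wreath" "g' \<in> carrier wreath"
  shows "g \<otimes>\<^bsub>wreath\<^esub> g' \<in> carrier wreath"
proof -
  obtain y h y' h' where d: "g = (y, h)" "g' = (y', h')" by (cases g; cases g')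
  have y: "y \<in> lampset" "y' \<in> lampset" and h: "h \<in> H" "h' \<in> H" using assms by (auto simp: d wreath_carrier)
  show ?thesis unfolding d wreath_mult wreath_carrier
    using product_lamps[OF y(1) move_lamps_closed[OF h(1) y(2)]] H_compose[OF h] H_mult[OF h] by simp
qed

lemma wreath_left_inverse:
  assumes "g \<in> carrier wreath"
  shows "\<exists>g'\<in>carrier wreath. g' \<otimes>\<^bsub>wreath\<^esub> g = \<one>\<^bsub>wreath\<^esub>"
proof -
  obtain y h where d: "g = (y, h)" by (cases g)
  have y: "y \<in> lampset" and h: "h \<in> H" using assms by (auto simp: d wreath_carrier)
  note i = H_inv_closed[OF h]
  define m where "m = move_lamps (inv\<^bsub>HH\<^esub> h) y"
  have m: "m \<in> lampset" unfolding m_def by (rule move_lamps_closed[OF i y])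
  have "(\<lambda>\<omega>\<in>\<Omega>. (\<lambda>\<omega>\<in>\<Omega>. inv\<^bsub>A\<^esub> (m \<omega>)) \<omega> \<otimes>\<^bsub>A\<^esub> m \<omega>) = (\<lambda>\<omega>\<in>\<Omega>. \<one>\<^bsub>A\<^esub>)"
    using lampset_carrier[OF m] by (intro restrict_ext) simp
  moreover have "inv\<^bsub>HH\<^esub> h \<otimes>\<^bsub>HH\<^esub> h = (\<lambda>x\<in>configs \<Sigma>. x)"
    using group.l_inv[OF group_HH, of h] h H_one by simp
  ultimately have "(\<lambda>\<omega>\<in>\<Omega>. inv\<^bsub>A\<^esub> (m \<omega>), inv\<^bsub>HH\<^esub> h) \<otimes>\<^bsub>wreath\<^esub> g = \<one>\<^bsub>wreath\<^esub>"
    unfolding d wreath_mult wreath_one m_def[symmetric] by simp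
  moreover have "(\<lambda>\<omega>\<in>\<Omega>. inv\<^bsub>A\<^esub> (m \<omega>), inv\<^bsub>HH\<^esub> h) \<in> carrier wreath"
    using inverse_lamps[OF m] i by (simp add: wreath_carrier)
  ultimately show ?thesis by blast
qed

lemma group_wreath: "group wreath"
proof (rule groupI_embedding[OF group_shift_Aut[of cells], of _ embed])
  show "embed (g \<otimes>\<^bsub>wreath\<^esub> g') = embed g \<otimes>\<^bsub>shift_Aut cells\<^esub> embed g'"
    if "g \<in> carrier wreath" "g' \<in> carrier wreath" for g g'
    using that embed_mult by (cases g; cases g') (auto simp: wreath_carrier)
  show "embed g \<in> carrier (shift_Aut cells)" if "g \<in> carrier wreath" for g
    using that embed_Aut by (cases g) (auto simp: wreath_carrier)
  show "\<one>\<^bsub>wreath\<^esub> \<in> carrier wreath" using one_lamps H_id by (simp add: wreath_carrier wreath_one)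
qed (fact embed_inj wreath_closed embed_one wreath_left_inverse)+

lemma embed_mon: "embed \<in> mon wreath (shift_Aut cells)"
  unfolding mon_def hom_def using embed_inj embed_mult embed_Aut by (auto simp: wreath_carrier)

lemma two_cells: "2 \<le> card cells"
proof -
  let ?c = "\<lambda>v. (\<lambda>_::bool. (a0, None :: 'c option), \<lambda>_::bool. v)"
  have "{?c True, ?c False} \<subseteq> cells" using a0 by (auto simp: cells_def)
  then have "card {?c True, ?c False} \<le> card cells" by (rule card_mono[OF finite_cells])
  moreover have "?c True \<noteq> ?c False" by (simp add: fun_eq_iff)
  ultimately show ?thesis by simp
qed

end

section \<open>Finitely generated abelian groups\<close>

definition (in comm_group) adjoin where
  "adjoin C s = {c \<otimes> s [^] k | c (k :: int). c \<in> C}"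

text \<open>
Finitely many homomorphisms from \<open>C\<close> to the integers and a subgroup \<open>N\<close> of finite index, with representatives \<open>R\<close>, that
together separate the elements of \<open>C\<close>. For finitely generated groups this
replaces the classification theorem, and it can be established one generator at a time.
\<close>
definition (in comm_group) separated :: "'a set \<Rightarrow> bool" where
  "separated C \<longleftrightarrow> (\<exists>F :: ('a \<Rightarrow> int) set. \<exists>N R. finite F \<and>
     (\<forall>f\<in>F. \<forall>x\<in>C. \<forall>y\<in>C. f (x \<otimes> y) = f x + f y) \<and>
     subgroup N G \<and> N \<subseteq> C \<and> finite R \<and> R \<subseteq> C \<and> (\<forall>x\<in>C. \<exists>r\<in>R. \<exists>n\<in>N. x = r \<otimes> n) \<and>
     (\<forall>x\<in>N. (\<forall>f\<in>F. f x = 0) \<longrightarrow> x = \<one>))"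

context comm_group
begin

lemma adjoin_mult:
  assumes "c \<in> carrier G" "d \<in> carrier G" "s \<in> carrier G"
  shows "(c \<otimes> s [^] (k :: int)) \<otimes> (d \<otimes> s [^] (m :: int)) = (c \<otimes> d) \<otimes> s [^] (k + m)"
  using assms by (simp add: int_pow_mult m_ac)

lemma subgroup_adjoin:
  assumes C: "subgroup C G" and s: "s \<in> carrier G"
  shows "subgroup (adjoin C s) G"
proof (rule subgroupI)
  note sub = subgroup.mem_carrier[OF C]
  show "adjoin C s \<subseteq> carrier G" using sub s by (auto simp: adjoin_def)
  show "adjoin C s \<noteq> {}" using subgroup.one_closed[OF C] by (auto simp: adjoin_def)
  fix x assume "x \<in> adjoin C s"
  then obtain c k where x: "x = c \<otimes> s [^] (k :: int)" "c \<in> C" by (auto simp: adjoin_def)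
  have "inv x = inv c \<otimes> s [^] (- k)" using x sub s by (simp add: inv_mult int_pow_neg)
  then show "inv x \<in> adjoin C s" using subgroup.m_inv_closed[OF C x(2)] by (auto simp: adjoin_def)
  fix y assume "y \<in> adjoin C s"
  then obtain d m where y: "y = d \<otimes> s [^] (m :: int)" "d \<in> C" by (auto simp: adjoin_def)
  have "x \<otimes> y = (c \<otimes> d) \<otimes> s [^] (k + m)" using adjoin_mult[of c d s k m] x y sub s by simp
  then show "x \<otimes> y \<in> adjoin C s" using subgroup.m_closed[OF C x(2) y(2)] by (auto simp: adjoin_def)
qed

lemma additive_int_pow:
  assumes f: "\<And>x y. x \<in> C \<Longrightarrow> y \<in> C \<Longrightarrow> f (x \<otimes> y) = f x + (f y :: int)" and C: "subgroup C G" and x: "x \<in> C"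
  shows "f (x [^] (m :: int)) = m * f x"
proof -
  have p: "x [^] (k :: int) \<in> C" for k using subgroup_int_pow_closed[OF C x] .
  have xc: "x \<in> carrier G" using subgroup.mem_carrier[OF C x] .
  have one: "f \<one> = 0" using f[of \<one> \<one>] subgroup.one_closed[OF C] by simp
  have s: "f (x [^] (k + 1)) = f (x [^] k) + f x" for k :: int
    using f[OF p[of k] x] xc by (simp add: int_pow_mult)
  show ?thesis
  proof (induction m rule: int_induct[of _ 0])
    case (step1 k) then show ?case by (simp only: s) (simp only: distrib_right mult_1)
  next
    case (step2 k)
    have "k - 1 + 1 = k" by simp
    then have "f (x [^] k) = f (x [^] (k - 1)) + f x" using s[of "k - 1"] by (simp only:)
    then show ?case using step2 by (simp only: left_diff_distrib mult_1)
  qed (simp add: one)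
qed

text \<open>
If \<open>s [^] m\<close> lies in \<open>C\<close>, then \<open>C\<close> has finite index in the larger group, so \<open>N\<close> can be kept. A
homomorphism \<open>f\<close> is replaced by \<open>f (x [^] m)\<close>, which is \<open>m * f x\<close> on \<open>N\<close> and hence vanishes there if and
only if \<open>f\<close> does.
\<close>
lemma separated_adjoin_torsion:
  assumes C: "subgroup C G" and s: "s \<in> carrier G" and sep: "separated C"
    and m: "0 < (m :: int)" "s [^] m \<in> C"
  shows "separated (adjoin C s)"
proof -
  obtain F :: "('a \<Rightarrow> int) set" and N R where F': "finite F" "\<forall>f\<in>F. \<forall>x\<in>C. \<forall>y\<in>C. f (x \<otimes> y) = f x + f y"
    and N: "subgroup N G" "N \<subseteq> C" and R: "finite R" "R \<subseteq> C" and RN: "\<forall>x\<in>C. \<exists>r\<in>R. \<exists>n\<in>N. x = r \<otimes> n"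
    and N1: "\<forall>x\<in>N. (\<forall>f\<in>F. f x = 0) \<longrightarrow> x = \<one>"
    using sep unfolding separated_def by (elim exE conjE) (rule that)
  have F: "finite F" "\<And>f x y. f \<in> F \<Longrightarrow> x \<in> C \<Longrightarrow> y \<in> C \<Longrightarrow> f (x \<otimes> y) = f x + f y" using F' by blast+
  have triv: "x = \<one>" if "x \<in> N" "\<And>f. f \<in> F \<Longrightarrow> f x = 0" for x using N1 that by blast
  note sub = subgroup.mem_carrier[OF C] and subA = subgroup.mem_carrier[OF subgroup_adjoin[OF C s]]
  have pow: "x [^] m \<in> C" if xA: "x \<in> adjoin C s" for x
  proof -
    obtain c k where x: "x = c \<otimes> s [^] (k :: int)" "c \<in> C" using xA by (auto simp: adjoin_def)
    have "x [^] m = c [^] m \<otimes> (s [^] m) [^] k"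
      using x sub s by (simp add: int_pow_distrib int_pow_pow mult.commute)
    then show ?thesis using subgroup.m_closed[OF C] subgroup_int_pow_closed[OF C] m(2) x(2) by simp
  qed
  let ?F = "(\<lambda>f x. f (x [^] m)) ` F" and ?R = "(\<lambda>(r, j). r \<otimes> s [^] j) ` (R \<times> {0..<m})"
  have CA: "C \<subseteq> adjoin C s"
  proof
    fix c assume "c \<in> C"
    then have "c = c \<otimes> s [^] (0 :: int)" using sub by simp
    then show "c \<in> adjoin C s" using \<open>c \<in> C\<close> unfolding adjoin_def by blast
  qed
  have cover: "\<forall>x\<in>adjoin C s. \<exists>r\<in>?R. \<exists>n\<in>N. x = r \<otimes> n"
  proof
    fix x assume xA: "x \<in> adjoin C s"
    obtain c k where x: "x = c \<otimes> s [^] (k :: int)" "c \<in> C" using xA by (auto simp: adjoin_def)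
    have "c \<otimes> (s [^] m) [^] (k div m) \<in> C" using subgroup.m_closed[OF C] subgroup_int_pow_closed[OF C] m(2) x(2) by simp
    then obtain r n where rn: "r \<in> R" "n \<in> N" "c \<otimes> (s [^] m) [^] (k div m) = r \<otimes> n" using RN by blast
    have "s [^] k = (s [^] m) [^] (k div m) \<otimes> s [^] (k mod m)"
      using s by (simp add: int_pow_pow flip: int_pow_mult)
    then have "x = (c \<otimes> (s [^] m) [^] (k div m)) \<otimes> s [^] (k mod m)"
      using x sub s by (simp add: m_assoc)
    also have "\<dots> = (r \<otimes> s [^] (k mod m)) \<otimes> n"
      unfolding rn(3) using rn R(2) N(2) sub s by (simp add: subset_iff m_ac)
    finally show "\<exists>r\<in>?R. \<exists>n\<in>N. x = r \<otimes> n" using rn m(1) by (intro bexI[of _ "r \<otimes> s [^] (k mod m)"] bexI[of _ n]) auto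
  qed
  have RA: "?R \<subseteq> adjoin C s" using R(2) by (auto simp: adjoin_def)
  have kernel: "\<forall>x\<in>N. (\<forall>f\<in>?F. f x = 0) \<longrightarrow> x = \<one>"
  proof (intro ballI impI)
    fix x assume x: "x \<in> N" and 0: "\<forall>f\<in>?F. f x = 0"
    show "x = \<one>"
    proof (rule triv[OF x])
      fix f assume f: "f \<in> F"
      have "x \<in> C" using x N(2) by blast
      then have "f (x [^] m) = m * f x" using additive_int_pow[of C f x m] F(2)[OF f] C by blast
      moreover have "f (x [^] m) = 0" using bspec[OF 0 imageI[OF f]] .
      ultimately have "m * f x = 0" by (simp only:)
      then show "f x = 0" using m(1) by simp
    qed
  qed
  have hom: "\<forall>f\<in>?F. \<forall>x\<in>adjoin C s. \<forall>y\<in>adjoin C s. f (x \<otimes> y) = f x + f y"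
  proof (intro ballI)
    fix f x y assume "f \<in> ?F" and x: "x \<in> adjoin C s" and y: "y \<in> adjoin C s"
    then obtain g where g: "g \<in> F" "f = (\<lambda>x. g (x [^] m))" by (elim imageE)
    have "(x \<otimes> y) [^] m = x [^] m \<otimes> y [^] m" by (rule int_pow_distrib[OF subA[OF x] subA[OF y]])
    then show "f (x \<otimes> y) = f x + f y" unfolding g(2) using F(2)[OF g(1) pow[OF x] pow[OF y]] by (simp only:)
  qed
  have fin: "finite ?F" "finite ?R" using F(1) R(1) by auto
  show ?thesis unfolding separated_def
    by (rule exI[of _ ?F], rule exI[of _ N], rule exI[of _ ?R])
      (intro conjI fin hom N(1) subset_trans[OF N(2) CA] RA cover kernel)
qed

text \<open>
If no power of \<open>s\<close> lies in \<open>C\<close>, the larger group is the direct product of \<open>C\<close> with an infinite cyclic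
group; the new exponent is a further homomorphism.
\<close>
lemma separated_adjoin_free:
  assumes C: "subgroup C G" and s: "s \<in> carrier G" and sep: "separated C"
    and free: "\<And>m :: int. 0 < m \<Longrightarrow> s [^] m \<notin> C"
  shows "separated (adjoin C s)"
proof -
  obtain F :: "('a \<Rightarrow> int) set" and N R where F': "finite F" "\<forall>f\<in>F. \<forall>x\<in>C. \<forall>y\<in>C. f (x \<otimes> y) = f x + f y"
    and N: "subgroup N G" "N \<subseteq> C" and R: "finite R" "R \<subseteq> C" and RN: "\<forall>x\<in>C. \<exists>r\<in>R. \<exists>n\<in>N. x = r \<otimes> n"
    and N1: "\<forall>x\<in>N. (\<forall>f\<in>F. f x = 0) \<longrightarrow> x = \<one>"
    using sep unfolding separated_def by (elim exE conjE) (rule that)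
  have F: "finite F" "\<And>f x y. f \<in> F \<Longrightarrow> x \<in> C \<Longrightarrow> y \<in> C \<Longrightarrow> f (x \<otimes> y) = f x + f y" using F' by blast+
  have triv: "x = \<one>" if "x \<in> N" "\<And>f. f \<in> F \<Longrightarrow> f x = 0" for x using N1 that by blast
  note sub = subgroup.mem_carrier[OF C]
  have zero: "k = 0" if "s [^] (k :: int) \<in> C" for k
  proof (rule ccontr)
    assume "k \<noteq> 0"
    moreover have "s [^] (- k) \<in> C" using subgroup.m_inv_closed[OF C that] s by (simp add: int_pow_neg)
    ultimately show False using free[of k] free[of "- k"] that by linarith
  qed
  have unique: "c = d \<and> k = m" if "c \<otimes> s [^] (k :: int) = d \<otimes> s [^] (m :: int)" "c \<in> C" "d \<in> C" for c d k m
  proof -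
    have cd: "c \<in> carrier G" "d \<in> carrier G" using that sub by auto
    have "s [^] (k - m) = inv c \<otimes> (c \<otimes> s [^] k) \<otimes> s [^] (- m)"
      using cd s by (simp add: int_pow_diff int_pow_neg m_assoc[symmetric])
    also have "\<dots> = inv c \<otimes> d" unfolding that(1) using cd s by (simp add: m_assoc int_pow_neg)
    finally have "s [^] (k - m) \<in> C" using subgroup.m_closed[OF C subgroup.m_inv_closed[OF C that(2)] that(3)] by simp
    then have "k = m" using zero by force
    then show ?thesis using that(1) cd s by simp
  qed
  define e where "e = (\<lambda>x. THE k :: int. \<exists>c\<in>C. x = c \<otimes> s [^] k)"
  define q where "q = (\<lambda>x. THE c. c \<in> C \<and> (\<exists>k :: int. x = c \<otimes> s [^] k))"
  have e: "e (c \<otimes> s [^] k) = k" if "c \<in> C" for c k unfolding e_def using unique that by (intro the_equality) blast+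
  have q: "q (c \<otimes> s [^] (k :: int)) = c" if "c \<in> C" for c k unfolding q_def using unique that by (intro the_equality) blast+
  let ?F = "insert e ((\<lambda>f x. f (q x)) ` F)" and ?N = "adjoin N s"
  have CA: "C \<subseteq> adjoin C s" and NA: "?N \<subseteq> adjoin C s"
  proof
    fix c assume "c \<in> C"
    then have "c = c \<otimes> s [^] (0 :: int)" using sub by simp
    then show "c \<in> adjoin C s" using \<open>c \<in> C\<close> unfolding adjoin_def by blast
  qed (use N(2) in \<open>auto simp: adjoin_def\<close>)
  have hom: "\<forall>f\<in>?F. \<forall>x\<in>adjoin C s. \<forall>y\<in>adjoin C s. f (x \<otimes> y) = f x + f y"
  proof (intro ballI)
    fix f x y assume f: "f \<in> ?F" and x: "x \<in> adjoin C s" and y: "y \<in> adjoin C s"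
    obtain c k where c: "x = c \<otimes> s [^] (k :: int)" "c \<in> C" using x by (auto simp: adjoin_def)
    obtain d m where d: "y = d \<otimes> s [^] (m :: int)" "d \<in> C" using y by (auto simp: adjoin_def)
    have xy: "x \<otimes> y = (c \<otimes> d) \<otimes> s [^] (k + m)" using adjoin_mult[of c d s k m] c d sub s by simp
    have cd: "c \<otimes> d \<in> C" using subgroup.m_closed[OF C c(2) d(2)] .
    have eq: "e (x \<otimes> y) = e x + e y" "q (x \<otimes> y) = q x \<otimes> q y" "q x \<in> C" "q y \<in> C"
      unfolding xy e[OF cd] q[OF cd] using e q c d by simp_all
    from f show "f (x \<otimes> y) = f x + f y"
    proof (elim insertE imageE)
      fix g assume "g \<in> F" "f = (\<lambda>x. g (q x))"
      then show ?thesis using eq F(2) by simp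
    qed (use eq in simp)
  qed
  have cover: "\<forall>x\<in>adjoin C s. \<exists>r\<in>R. \<exists>n\<in>?N. x = r \<otimes> n"
  proof
    fix x assume "x \<in> adjoin C s"
    then obtain c k where c: "x = c \<otimes> s [^] (k :: int)" "c \<in> C" by (auto simp: adjoin_def)
    obtain r n where rn: "r \<in> R" "n \<in> N" "c = r \<otimes> n" using RN c(2) by blast
    then have "x = r \<otimes> (n \<otimes> s [^] k)" using c R(2) N(2) sub s by (simp add: subset_iff m_assoc)
    moreover have "n \<otimes> s [^] k \<in> ?N" using rn(2) unfolding adjoin_def by blast
    ultimately show "\<exists>r\<in>R. \<exists>n\<in>?N. x = r \<otimes> n" using rn(1) by blast
  qed
  have kernel: "\<forall>x\<in>?N. (\<forall>f\<in>?F. f x = 0) \<longrightarrow> x = \<one>"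
  proof (intro ballI impI)
    fix x assume x: "x \<in> ?N" and 0: "\<forall>f\<in>?F. f x = 0"
    obtain n k where n: "x = n \<otimes> s [^] (k :: int)" "n \<in> N" using x by (auto simp: adjoin_def)
    have nC: "n \<in> C" using n(2) N(2) by blast
    have "k = 0" using bspec[OF 0 insertI1] e[OF nC, of k] n(1) by simp
    then have xn: "x = n" using n(1) sub[OF nC] by simp
    have "f n = 0" if "f \<in> F" for f
      using bspec[OF 0 insertI2[OF imageI[OF that]]] q[OF nC, of k] n(1) by simp
    then show "x = \<one>" using triv[OF n(2)] xn by blast
  qed
  have fin: "finite ?F" using F(1) by auto
  show ?thesis unfolding separated_def
    by (rule exI[of _ ?F], rule exI[of _ ?N], rule exI[of _ R])
      (intro conjI fin hom subgroup_adjoin[OF N(1) s] NA R(1) subset_trans[OF R(2) CA] cover kernel)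
qed

lemma separated_generate:
  assumes "finite S" "S \<subseteq> carrier G"
  shows "separated (generate G S)"
  using assms
proof (induction S)
  case empty
  have "generate G {} = {\<one>}" by (rule generate_empty)
  moreover have "subgroup {\<one>} G" by (rule triv_subgroup)
  ultimately show ?case unfolding separated_def
    by (intro exI[of _ "{}"] exI[of _ "{\<one>}"]) auto
next
  case (insert s S)
  then have s: "s \<in> carrier G" and S: "S \<subseteq> carrier G" by auto
  note C = generate_is_subgroup[OF S]
  have "generate G (insert s S) = adjoin (generate G S) s"
  proof
    have "x = x \<otimes> s [^] (0 :: int)" if "x \<in> S" for x using that S by auto
    moreover have "s = \<one> \<otimes> s [^] (1 :: int)" using s by simp
    ultimately have "insert s S \<subseteq> adjoin (generate G S) s"
      unfolding adjoin_def using generate.incl[of _ S G] generate.one[of G S] by blast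
    then show "generate G (insert s S) \<subseteq> adjoin (generate G S) s"
      by (rule generate_subgroup_incl[OF _ subgroup_adjoin[OF C s]])
  next
    have D: "subgroup (generate G (insert s S)) G" using insert by (intro generate_is_subgroup) auto
    have "generate G S \<subseteq> generate G (insert s S)" by (rule mono_generate) auto
    moreover have "s [^] (k :: int) \<in> generate G (insert s S)" for k
      by (rule subgroup_int_pow_closed[OF D]) (auto intro: generate.incl)
    ultimately show "adjoin (generate G S) s \<subseteq> generate G (insert s S)"
      unfolding adjoin_def using subgroup.m_closed[OF D] by blast
  qed
  then show ?case
    using separated_adjoin_torsion[OF C s] separated_adjoin_free[OF C s] insert S by metis
qed

end

lemma (in group) additive_cancel:
  assumes f: "\<And>x y. x \<in> carrier G \<Longrightarrow> y \<in> carrier G \<Longrightarrow> f (x \<otimes> y) = f x + (f y :: int)"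
    and "a \<in> carrier G" "a' \<in> carrier G" "f a = f a'"
  shows "f (a \<otimes> inv a') = 0"
  using f[of "a \<otimes> inv a'" a'] assms(2-4) by (simp add: m_assoc)

text \<open>
A mark is a pair of a homomorphism, which is used for the rotation, and a coset of the subgroup of finite index, on
which \<open>A\<close> acts by translation. The zero homomorphism is added so that there is at least one mark for
every coset.
\<close>
lemma (in pointed_automorphisms) lamps_exist:
  fixes A :: "('b, 'p) monoid_scheme"
  assumes A: "comm_group A" and fg: "finitely_generated A"
  obtains M :: "(('b \<Rightarrow> int) \<times> 'b set) set" and act rot where "separating_lamps \<Sigma> a0 H u k n0 A M act rot"
proof -
  interpret A: comm_group A by (rule A)
  obtain S where "S \<subseteq> carrier A" "finite S" "generate A S = carrier A"
    using fg by (auto simp: finitely_generated_def)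
  then have "A.separated (carrier A)" using A.separated_generate by metis
  then obtain F :: "('b \<Rightarrow> int) set" and N R where
    F': "finite F" "\<forall>f\<in>F. \<forall>x\<in>carrier A. \<forall>y\<in>carrier A. f (x \<otimes>\<^bsub>A\<^esub> y) = f x + f y"
    and N: "subgroup N A" "N \<subseteq> carrier A" and R: "finite R" "R \<subseteq> carrier A"
    and RN: "\<forall>x\<in>carrier A. \<exists>r\<in>R. \<exists>n\<in>N. x = r \<otimes>\<^bsub>A\<^esub> n"
    and N1: "\<forall>x\<in>N. (\<forall>f\<in>F. f x = 0) \<longrightarrow> x = \<one>\<^bsub>A\<^esub>"
    unfolding A.separated_def by (elim exE conjE) (rule that)
  have F: "finite F" "\<And>f x y. f \<in> F \<Longrightarrow> x \<in> carrier A \<Longrightarrow> y \<in> carrier A \<Longrightarrow> f (x \<otimes>\<^bsub>A\<^esub> y) = f x + f y"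
    using F' by blast+
  have triv: "x = \<one>\<^bsub>A\<^esub>" if "x \<in> N" "\<And>f. f \<in> F \<Longrightarrow> f x = 0" for x using N1 that by blast
  define D where "D = (\<lambda>a. N #>\<^bsub>A\<^esub> a) ` carrier A"
  define act :: "'b \<Rightarrow> ('b \<Rightarrow> int) \<times> 'b set \<Rightarrow> ('b \<Rightarrow> int) \<times> 'b set" where "act = (\<lambda>a (f, E). (f, E #>\<^bsub>A\<^esub> a))"
  define rot :: "('b \<Rightarrow> int) \<times> 'b set \<Rightarrow> 'b \<Rightarrow> int" where "rot = (\<lambda>(f, E) a. if f \<in> F then f a else 0)"
  note Nsub = N(2) and N = N(1)
  have ND: "(N #>\<^bsub>A\<^esub> b) #>\<^bsub>A\<^esub> a = N #>\<^bsub>A\<^esub> (b \<otimes>\<^bsub>A\<^esub> a)" if "a \<in> carrier A" "b \<in> carrier A" for a b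
    using A.coset_mult_assoc[OF Nsub that(2,1)] .
  have "D \<subseteq> (\<lambda>a. N #>\<^bsub>A\<^esub> a) ` R"
  proof
    fix E assume "E \<in> D"
    then obtain a where a: "a \<in> carrier A" "E = N #>\<^bsub>A\<^esub> a" by (auto simp: D_def)
    obtain r n where rn: "r \<in> R" "n \<in> N" "a = r \<otimes>\<^bsub>A\<^esub> n" using RN a(1) by blast
    have c: "r \<in> carrier A" "n \<in> carrier A" using rn R(2) Nsub by auto
    have "E = (N #>\<^bsub>A\<^esub> n) #>\<^bsub>A\<^esub> r" using ND[OF c] A.m_comm[OF c] rn(3) a(2) by simp
    then show "E \<in> (\<lambda>a. N #>\<^bsub>A\<^esub> a) ` R" using A.coset_join2[OF c(2) N rn(2)] rn(1) by simp
  qed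
  then have finD: "finite D" using R(1) finite_surj by blast
  have "separating_lamps \<Sigma> a0 H u k n0 A (insert (\<lambda>_. 0) F \<times> D) act rot"
  proof (intro separating_lamps.intro lamps.intro lamps_axioms.intro separating_lamps_axioms.intro)
    show "pointed_automorphisms \<Sigma> a0 H u k n0" by unfold_locales
    show "comm_group A" by unfold_locales
    show "finite (insert (\<lambda>_. 0) F \<times> D)" using F(1) finD by simp
  next
    fix a c assume "a \<in> carrier A" "c \<in> insert (\<lambda>_. 0) F \<times> D"
    then show "act a c \<in> insert (\<lambda>_. 0) F \<times> D" using ND by (auto simp: act_def D_def)
  next
    fix a a' c assume a: "a \<in> carrier A" "a' \<in> carrier A" and "c \<in> insert (\<lambda>_. 0) F \<times> D"
    then obtain f b where c: "c = (f, N #>\<^bsub>A\<^esub> b)" "b \<in> carrier A" by (auto simp: D_def)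
    have "b \<otimes>\<^bsub>A\<^esub> (a \<otimes>\<^bsub>A\<^esub> a') = b \<otimes>\<^bsub>A\<^esub> a' \<otimes>\<^bsub>A\<^esub> a" using a c(2) by (simp add: A.m_ac)
    then show "act (a \<otimes>\<^bsub>A\<^esub> a') c = act a (act a' c)" using a c ND by (simp add: act_def)
  next
    fix c assume "c \<in> insert (\<lambda>_. 0) F \<times> D"
    then show "act \<one>\<^bsub>A\<^esub> c = c" using ND[OF A.one_closed] by (auto simp: act_def D_def)
  next
    fix a a' c assume "a \<in> carrier A" "a' \<in> carrier A"
    then show "rot c (a \<otimes>\<^bsub>A\<^esub> a') = rot c a + rot c a'" using F(2) by (auto simp: rot_def split: prod.splits)
  next
    fix a c show "rot (act a c) = rot c" by (auto simp: rot_def act_def split: prod.splits)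
  next
    fix a a' assume a: "a \<in> carrier A" "a' \<in> carrier A"
      and same: "\<And>c. c \<in> insert (\<lambda>_. 0) F \<times> D \<Longrightarrow> rot c a = rot c a' \<and> act a c = act a' c"
    have ND1: "N \<in> D" unfolding D_def using A.coset_mult_one[OF Nsub] by (metis A.one_closed imageI)
    have "f a = f a'" if "f \<in> F" for f using same[of "(f, N)"] ND1 that by (simp add: rot_def)
    then have "f (a \<otimes>\<^bsub>A\<^esub> inv\<^bsub>A\<^esub> a') = 0" if "f \<in> F" for f
      using A.additive_cancel[of f a a'] F(2) a that by blast
    moreover have "N #>\<^bsub>A\<^esub> a = N #>\<^bsub>A\<^esub> a'" using same[of "(\<lambda>_. 0, N)"] ND1 by (simp add: act_def)
    then have "N #>\<^bsub>A\<^esub> (a \<otimes>\<^bsub>A\<^esub> inv\<^bsub>A\<^esub> a') = N"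
      using ND[of "inv\<^bsub>A\<^esub> a'" a] ND[of "inv\<^bsub>A\<^esub> a'" a'] a A.coset_mult_one[OF Nsub] by simp
    then have "a \<otimes>\<^bsub>A\<^esub> inv\<^bsub>A\<^esub> a' \<in> N" using A.coset_join1[OF _ _ N] a by simp
    ultimately have "a \<otimes>\<^bsub>A\<^esub> inv\<^bsub>A\<^esub> a' = \<one>\<^bsub>A\<^esub>" using triv by blast
    then show "a = a'" using a by (metis A.inv_closed A.inv_equality A.inv_inv)
  qed
  then show ?thesis by (rule that)
qed

section \<open>The theorem\<close>

text \<open>
Conjugation with the letterwise bijection.
\<close>
lemma rename_letters:
  assumes e: "inj_on e S"
  obtains \<phi> where "\<phi> \<in> mon (shift_Aut S) (shift_Aut (e ` S))"
proof -
  define r where "r = inv_into S e"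
  have re: "r (e s) = s" if "s \<in> S" for s using e that by (simp add: r_def)
  have er: "e (r t) = t" "r t \<in> S" if "t \<in> e ` S" for t
    using that by (simp_all add: r_def f_inv_into_f inv_into_into)
  let ?E = "\<lambda>x :: int \<Rightarrow> 'a. e \<circ> x" and ?R = "\<lambda>x :: int \<Rightarrow> 'b. r \<circ> x"
  have c: "continuous_map (full_shift X1) (full_shift X2) (\<lambda>x. f \<circ> x)" if "f ` X1 \<subseteq> X2"
    for f :: "'x \<Rightarrow> 'y" and X1 X2
  proof -
    have "eventually (\<lambda>x'. (f \<circ> x') j = (f \<circ> x) j) (nhdsin (full_shift X1) x)" for x j
      by (rule eventually_mono[OF eventually_coordinate[of j]]) simp
    then show ?thesis using that unfolding continuous_map_full_shift_iff
      by (auto simp: configs_iff image_subset_iff)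
  qed
  have RE: "?R (?E x) = x" "?E x \<in> configs (e ` S)" if "x \<in> configs S" for x
    using that re by (auto simp: configs_iff fun_eq_iff)
  have ER: "?E (?R x) = x" "?R x \<in> configs S" if "x \<in> configs (e ` S)" for x
    using that er unfolding configs_iff fun_eq_iff by simp_all
  have hm: "homeomorphic_maps (full_shift S) (full_shift (e ` S)) ?E ?R"
    unfolding homeomorphic_maps_def using RE(1) ER(1) er(2) by (intro conjI c ballI) auto
  have hE: "homeomorphic_map (full_shift S) (full_shift (e ` S)) ?E"
    and hR: "homeomorphic_map (full_shift (e ` S)) (full_shift S) ?R"
    using hm homeomorphic_maps_map by blast+
  define \<phi> where "\<phi> = (\<lambda>f. restrict (\<lambda>x. ?E (f (?R x))) (configs (e ` S)))"
  have fc: "f x \<in> configs S" if "f \<in> carrier (shift_Aut S)" "x \<in> configs S" for f x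
    using shift_Aut_in_configs that .
  have "\<phi> f \<in> carrier (shift_Aut (e ` S))" if f: "f \<in> carrier (shift_Aut S)" for f
  proof -
    have "homeomorphic_map (full_shift (e ` S)) (full_shift (e ` S)) (?E \<circ> (f \<circ> ?R))"
      using homeomorphic_map_compose[OF homeomorphic_map_compose[OF hR] hE] f unfolding shift_Aut_iff by blast
    then have h: "homeomorphic_map (full_shift (e ` S)) (full_shift (e ` S)) (\<phi> f)"
      by (rule homeomorphic_map_eq) (simp add: \<phi>_def)
    have "\<phi> f \<in> Bij (configs (e ` S))"
      using h unfolding Bij_def homeomorphic_eq_everything_map by (auto simp: bij_betw_def \<phi>_def)
    moreover have "\<phi> f (shift x) = shift (\<phi> f x)" if x: "x \<in> configs (e ` S)" for x
    proof -
      have "f (shift (?R x)) = shift (f (?R x))" using f ER(2)[OF x] by (simp add: shift_Aut_iff)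
      moreover have "?R (shift x) = shift (?R x)" "?E (shift z) = shift (?E z)" for z by (simp_all add: shift_def comp_def)
      ultimately show ?thesis using x shift_configs[OF x] by (simp add: \<phi>_def)
    qed
    ultimately show ?thesis using h by (simp add: shift_Aut_iff)
  qed
  note closed = this
  moreover have "\<phi> (f \<otimes>\<^bsub>shift_Aut S\<^esub> g) = \<phi> f \<otimes>\<^bsub>shift_Aut (e ` S)\<^esub> \<phi> g"
    if f: "f \<in> carrier (shift_Aut S)" and g: "g \<in> carrier (shift_Aut S)" for f g
    unfolding shift_Aut_mult[OF f g] shift_Aut_mult[OF closed[OF f] closed[OF g]]
    using ER RE fc[OF g] by (auto simp: \<phi>_def compose_def intro!: restrict_ext)
  moreover have "inj_on \<phi> (carrier (shift_Aut S))"
  proof (rule inj_onI)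
    fix f g assume f: "f \<in> carrier (shift_Aut S)" and g: "g \<in> carrier (shift_Aut S)" and eq: "\<phi> f = \<phi> g"
    have "f x = g x" if x: "x \<in> configs S" for x
    proof -
      have "?E (f x) = ?E (g x)" using fun_cong[OF eq, of "?E x"] RE[OF x] by (simp add: \<phi>_def)
      then have "?R (?E (f x)) = ?R (?E (g x))" by simp
      then show ?thesis using RE(1) fc[OF f x] fc[OF g x] by simp
    qed
    moreover have "f \<in> extensional (configs S)" "g \<in> extensional (configs S)"
      using f g Bij_imp_extensional unfolding shift_Aut_iff by blast+
    ultimately show "f = g" by (rule extensionalityI[rotated 2])
  qed
  ultimately have "\<phi> \<in> mon (shift_Aut S) (shift_Aut (e ` S))" by (simp add: mon_def hom_def)
  then show ?thesis by (rule that)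
qed

lemma embeds_in_shift_AutI:
  fixes S :: "'s set"
  assumes "group G" "finite S" "2 \<le> card S" "\<psi> \<in> mon G (shift_Aut S)"
  shows "embeds_in_shift_Aut G"
proof -
  obtain e :: "'s \<Rightarrow> nat" where e: "inj_on e S" using finite_imp_inj_to_nat_seg[OF assms(2)] by blast
  obtain \<phi> where \<phi>: "\<phi> \<in> mon (shift_Aut S) (shift_Aut (e ` S))" using rename_letters[OF e] by blast
  have "\<phi> \<circ> \<psi> \<in> mon G (shift_Aut (e ` S))"
    using \<phi> assms(4) hom_compose[of \<psi> G "shift_Aut S" \<phi> "shift_Aut (e ` S)"]
    by (auto simp: mon_def hom_def intro!: comp_inj_on inj_on_subset[of \<phi> "carrier (shift_Aut S)"])
  moreover have "finite (e ` S)" "2 \<le> card (e ` S)" using assms(2,3) e by (auto simp: card_image)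
  ultimately show ?thesis unfolding embeds_in_shift_Aut_def using assms(1) by blast
qed

theorem lemma2:
  fixes \<Sigma> :: "'a set" and a0 :: 'a
    and H :: "((int \<Rightarrow> 'a) \<Rightarrow> int \<Rightarrow> 'a) set" and x0 :: "int \<Rightarrow> 'a"
    and A :: "('b, 'p) monoid_scheme"
  assumes "finite \<Sigma>" and "a0 \<in> \<Sigma>"
    and "weakly_pointy \<Sigma> a0 H x0"
    and "comm_group A" and "finitely_generated A"
  shows "embeds_in_shift_Aut (orbit_wreath_product A \<Sigma> H x0)"
proof -
  obtain u k n1 where H: "subgroup H (shift_Aut0 \<Sigma> a0)" and u: "set u \<subseteq> \<Sigma>" and x0: "x0 = finite_point a0 u k"
    and n1: "\<And>n. n1 \<le> n \<Longrightarrow> stabilizer (shift_Aut \<Sigma>\<lparr>carrier := H\<rparr>) (\<lambda>h. h) x0 \<subseteq>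
      stabilizer (shift_Aut \<Sigma>\<lparr>carrier := H\<rparr>) word_act (u @ replicate (n - length u) a0)"
    using assms(3) unfolding weakly_pointy_def eventually_sequentially by blast
  define n0 where "n0 = max n1 (Suc (length u))"
  \<comment> \<open>Periods must be positive and leave room for the whole word.\<close>
  interpret pointed_automorphisms \<Sigma> a0 H u k n0
    by (rule pointed_automorphisms.intro) (use assms(1,2) H u n1 x0 in \<open>auto simp: n0_def\<close>)
  obtain M :: "(('b \<Rightarrow> int) \<times> 'b set) set" and act rot where "separating_lamps \<Sigma> a0 H u k n0 A M act rot"
    using lamps_exist[OF assms(4,5)] .
  then interpret separating_lamps \<Sigma> a0 H u k n0 A M act rot .
  show ?thesis unfolding x0 by (rule embeds_in_shift_AutI[OF group_wreath finite_cells two_cells embed_mon])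
qed

end
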